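(* For $\sigma>0$ let $\pi_\sigma=\frac12\mathcal N(-1,\sigma^2)+\frac12\mathcal N(1,\sigma^2)$ on $\mathbb R$, let $K_\sigma$ be the transition kernel of the random walk Metropolis algorithm with step size $\sigma$ and target distribution $\pi_\sigma$, let $\lambda_\sigma$ be the relaxation time of $K_\sigma$, let $\Phi_\sigma=\Phi(K_\sigma,(-\infty,0))$, and let $\Phi(K_\sigma)$ be the conductance of $K_\sigma$. For $x\in(-\infty,0)$ let $\{X^{(\sigma)}_t\}_{t\in\mathbb N}$ be a Markov chain with transition kernel $K_\sigma$ and initial point $X^{(\sigma)}_1=x$, and let $\tau^{(\sigma)}_x=\inf\{t>0:X^{(\sigma)}_t\notin(-\infty,0)\}$. Then for all $\epsilon>0$ and every fixed $x\in(-\infty,0)$, $$\lim_{\sigma\to0}\mathbb P\left[\frac{\log(\tau^{(\sigma)}_x)}{\log(\Phi_\sigma^{-1})}<1+\epsilon\right]=1,$$ and $$\lim_{\sigma\to0}\frac{\log(\lambda_\sigma)}{\log(\Phi_\sigma^{-1})}=\lim_{\sigma\to0}\frac{\log(\lambda_\sigma)}{\log(\Phi(K_\sigma)^{-1})}=1 .$$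
   Context: Random walk Metropolis algorithm with step size $\sigma>0$ and target distribution on $\mathbb R$ with density $\rho$: from $x$, sample independently $\epsilon\sim\mathcal N(0,\sigma^2)$ and $U\sim\mathrm{Unif}[0,1]$; if $U<\rho(x+\epsilon)/\rho(x)$ the next state is $x+\epsilon$, otherwise it is $x$. For a reversible kernel $L$ with stationary distribution $\mu$ and a measurable set $S$ with $\mu(S)>0$, $\displaystyle\Phi(L,S)=\frac{\int_S L(x,S^c)\,\mu(dx)}{\mu(S)}$, and the conductance is $\Phi(L)=\inf\{\Phi(L,S):S\text{ measurable},\ 0<\mu(S)<\tfrac12\}$. The spectral gap of $L$ is $1-\sup\{|\lambda|:\lambda\in\mathrm{Spectrum}(L^\perp)\}$, where $L^\perp$ is the restriction of $L$, acting on $L_2(\mu)$ by $(Lf)(x)=\int L(x,dy)f(y)$, to $\{f\in L_2(\mu):\int f\,d\mu=0\}$. The relaxation time is the reciprocal of the spectral gap. *)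

theory Defs
  imports "HOL-Probability.Probability"
begin

text \<open>Random walk Metropolis kernel with step size \<open>\<sigma>\<close> and target density \<open>\<rho>\<close>: the law of the
  next state as a function of the independent proposal increment and uniform variable.\<close>

definition rwm_kernel :: "real \<Rightarrow> (real \<Rightarrow> real) \<Rightarrow> real \<Rightarrow> real measure" where
  "rwm_kernel \<sigma> \<rho> x =
     distr (density lborel (\<lambda>e. ennreal (normal_density 0 \<sigma> e)) \<Otimes>\<^sub>M uniform_measure lborel {0..1})
       borel (\<lambda>(e, u). if u < \<rho> (x + e) / \<rho> x then x + e else x)"

definition mix_density :: "real \<Rightarrow> real \<Rightarrow> real" where
  "mix_density \<sigma> x = 1/2 * normal_density (-1) \<sigma> x + 1/2 * normal_density 1 \<sigma> x"

definition mix_measure :: "real \<Rightarrow> real measure" where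
  "mix_measure \<sigma> = density lborel (\<lambda>x. ennreal (mix_density \<sigma> x))"

definition K_mix :: "real \<Rightarrow> real \<Rightarrow> real measure" where
  "K_mix \<sigma> = rwm_kernel \<sigma> (mix_density \<sigma>)"

definition set_conductance :: "('a \<Rightarrow> 'a measure) \<Rightarrow> 'a measure \<Rightarrow> 'a set \<Rightarrow> real" where
  "set_conductance L \<mu> S = (LINT x:S|\<mu>. measure (L x) (space \<mu> - S)) / measure \<mu> S"

definition conductance :: "('a \<Rightarrow> 'a measure) \<Rightarrow> 'a measure \<Rightarrow> real" where
  "conductance L \<mu> =
     (INF S \<in> {S \<in> sets \<mu>. 0 < measure \<mu> S \<and> measure \<mu> S < 1/2}. set_conductance L \<mu> S)"

text \<open>Elements of complex \<open>L\<^sub>2(\<mu>)\<close> are represented by square-integrable functions, identified when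
  they agree almost everywhere; hence all equations between them below are \<open>AE\<close> equations.\<close>

definition L2_fun :: "'a measure \<Rightarrow> ('a \<Rightarrow> complex) set" where
  "L2_fun \<mu> = {f \<in> borel_measurable \<mu>. integrable \<mu> (\<lambda>x. (cmod (f x))\<^sup>2)}"

definition L2_fun_norm :: "'a measure \<Rightarrow> ('a \<Rightarrow> complex) \<Rightarrow> real" where
  "L2_fun_norm \<mu> f = sqrt (LINT x|\<mu>. (cmod (f x))\<^sup>2)"

definition L2_mean_zero :: "'a measure \<Rightarrow> ('a \<Rightarrow> complex) set" where
  "L2_mean_zero \<mu> = {f \<in> L2_fun \<mu>. (LINT x|\<mu>. f x) = 0}"

text \<open>For \<open>f \<in> L\<^sub>2(\<mu>)\<close> with \<open>\<mu>\<close> stationary, \<open>f\<close> is \<open>L x\<close>-integrable for \<open>\<mu>\<close>-almost every \<open>x\<close>; on the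
  exceptional null set the integral defaults to \<open>0\<close>.\<close>

definition kernel_op :: "('a \<Rightarrow> 'a measure) \<Rightarrow> ('a \<Rightarrow> complex) \<Rightarrow> 'a \<Rightarrow> complex" where
  "kernel_op L f x = (LINT y|L x. f y)"

text \<open>A linear operator \<open>T\<close> on a subspace \<open>V\<close> of \<open>L\<^sub>2(\<mu>)\<close> is bijective (modulo null sets) and its
  inverse is bounded.\<close>

definition boundedly_invertible_on ::
    "'a measure \<Rightarrow> ('a \<Rightarrow> complex) set \<Rightarrow> (('a \<Rightarrow> complex) \<Rightarrow> 'a \<Rightarrow> complex) \<Rightarrow> bool" where
  "boundedly_invertible_on \<mu> V T \<longleftrightarrow>
     (\<forall>g\<in>V. \<exists>f\<in>V. (AE x in \<mu>. T f x = g x) \<and>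
        (\<forall>h\<in>V. (AE x in \<mu>. T h x = g x) \<longrightarrow> (AE x in \<mu>. h x = f x))) \<and>
     (\<exists>C. \<forall>f\<in>V. L2_fun_norm \<mu> f \<le> C * L2_fun_norm \<mu> (T f))"

definition spectrum_mean_zero :: "('a \<Rightarrow> 'a measure) \<Rightarrow> 'a measure \<Rightarrow> complex set" where
  "spectrum_mean_zero L \<mu> =
     {z. \<not> boundedly_invertible_on \<mu> (L2_mean_zero \<mu>) (\<lambda>f x. kernel_op L f x - z * f x)}"

definition spectral_gap :: "('a \<Rightarrow> 'a measure) \<Rightarrow> 'a measure \<Rightarrow> real" where
  "spectral_gap L \<mu> = 1 - (SUP z \<in> spectrum_mean_zero L \<mu>. cmod z)"

definition relaxation_time :: "('a \<Rightarrow> 'a measure) \<Rightarrow> 'a measure \<Rightarrow> real" where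
  "relaxation_time L \<mu> = 1 / spectral_gap L \<mu>"

text \<open>Processes are indexed by \<open>t = 1, 2, \<dots>\<close>; the value at index \<open>0\<close> is never used.\<close>

definition process_history :: "'w measure \<Rightarrow> (nat \<Rightarrow> 'w \<Rightarrow> real) \<Rightarrow> nat \<Rightarrow> 'w measure" where
  "process_history M X t =
     sigma (space M) {X i -` A \<inter> space M | i A. 1 \<le> i \<and> i \<le> t \<and> A \<in> sets borel}"

definition markov_chain_from ::
    "'w measure \<Rightarrow> (real \<Rightarrow> real measure) \<Rightarrow> real \<Rightarrow> (nat \<Rightarrow> 'w \<Rightarrow> real) \<Rightarrow> bool" where
  "markov_chain_from M L x X \<longleftrightarrow>
     prob_space M \<and>
     (\<forall>t\<ge>1. X t \<in> borel_measurable M) \<and>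
     (AE \<omega> in M. X 1 \<omega> = x) \<and>
     (\<forall>t\<ge>1. \<forall>A\<in>sets borel. AE \<omega> in M.
        real_cond_exp M (process_history M X t) (\<lambda>\<omega>'. indicator A (X (Suc t) \<omega>')) \<omega>
          = measure (L (X t \<omega>)) A)"

text \<open>The infimum of the empty set is \<open>\<infinity>\<close>.\<close>

definition exit_time :: "(nat \<Rightarrow> 'w \<Rightarrow> real) \<Rightarrow> real set \<Rightarrow> 'w \<Rightarrow> enat" where
  "exit_time X S \<omega> = (INF t \<in> {t. t > 0 \<and> X t \<omega> \<notin> S}. enat t)"

fun ln_enat :: "enat \<Rightarrow> ereal" where
  "ln_enat (enat n) = ereal (ln (real n))"
| "ln_enat \<infinity> = \<infinity>"

end

theory Submission
  imports Defs "HOL-Real_Asymp.Real_Asymp"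
begin

text \<open>
  All three quantities decay like \<open>exp (- 2 / (5 \<sigma>\<^sup>2))\<close> up to powers of \<open>\<sigma>\<close>. The exponent is
  not that of the barrier height at \<open>0\<close>: a proposal of macroscopic length \<open>d\<close> only costs a factor
  \<open>exp (- d\<^sup>2 / (2 \<sigma>\<^sup>2))\<close>, so it is cheapest to climb to \<open>- 1/5\<close> by small steps and to jump to \<open>1/5\<close>;
  \<open>(1 - a)\<^sup>2 + (2 a)\<^sup>2\<close> has minimum \<open>4/5\<close>, at \<open>a = 1/5\<close>. The same minimum bounds the flow across \<open>0\<close>.

  The Poincare inequality for the kernel combines the drift of \<open>exp |x|\<close> outside \<open>[- 3, 3]\<close> with
  straight-line paths to the two sides of the jump. The kernel is positive semidefinite (Gaussian
  proposals are convolution squares and \<open>min\<close> is an integral of products of indicators), so that it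
  bounds the whole spectrum on mean-zero functions, and likewise the norm of the kernel killed
  outside \<open>(- \<infinity>, 0)\<close>. After its first move the law of the chain has a bounded density with
  respect to the target, up to a geometrically small atom at the starting point, so the latter bound
  controls the exit time from a fixed point.
\<close>

section \<open>Reversible kernels with a density\<close>

text \<open>Only the exponent matters: multiplied by \<open>\<sigma>\<^sup>2\<close>, the logarithm
  of a power of \<open>\<sigma>\<close> tends to zero, so every estimate may lose polynomial
  factors. One Poincare constant bounds the gap and both conductances from below, and one indicator
  test function each bounds them from above. Conductance is thus reached through the easy half of
  Cheeger's inequality alone; the hard half squares the conductance, which would double the exponent
  and spoil the limits.

  Positivity of the kernel is what makes a bound on the quadratic form sufficient. The gap is
  defined through \<open>|\<lambda>|\<close>, and for an indefinite form such a bound would say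
  nothing about the bottom of the spectrum.

  A fixed starting point has density as large as
  \<open>exp (well x / (2 * \<sigma>\<^sup>2))\<close> after its first move, exponentially large in
  \<open>1 / \<sigma>\<^sup>2\<close>. This is affordable because running longer than the relaxation
  time by a factor \<open>exp (\<delta> / \<sigma>\<^sup>2)\<close> makes the survival probability
  doubly exponentially small.\<close>

lemma (in prob_space) integrable_of_L2_fun:
  assumes f: "f \<in> L2_fun M" shows "integrable M f"
proof (rule Bochner_Integration.integrable_bound)
  show "integrable M (\<lambda>x. 1 + (cmod (f x))\<^sup>2)" using f by (simp add: L2_fun_def)
  show "f \<in> borel_measurable M" using f by (simp add: L2_fun_def)
  show "AE x in M. norm (f x) \<le> norm (1 + (cmod (f x))\<^sup>2)"
  proof (rule AE_I2)
    fix x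
    have "2 * cmod (f x) \<le> (cmod (f x))\<^sup>2 + 1" using sum_squares_bound[of "cmod (f x)" 1] by simp
    then have "cmod (f x) \<le> 1 + (cmod (f x))\<^sup>2" using norm_ge_zero[of "f x"] by linarith
    then show "norm (f x) \<le> norm (1 + (cmod (f x))\<^sup>2)" by simp
  qed
qed

text \<open>\<open>k x y\<close> is the density with respect to \<open>\<mu>\<close> of the accepted
  moves from \<open>x\<close>; the missing mass stays at \<open>x\<close>, and symmetry of
  \<open>k\<close> is reversibility. The bound \<open>D x\<close> depends on \<open>x\<close> but is
  finite everywhere, so integrals against \<open>k x\<close> converge for every \<open>x\<close> and
  not only almost every \<open>x\<close>. It is also the density bound needed for a chain started at
  a fixed point.\<close>

locale reversible_kernel = prob_space \<mu> for \<mu> :: "real measure" +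
  fixes k :: "real \<Rightarrow> real \<Rightarrow> real" and D :: "real \<Rightarrow> real" and L :: "real \<Rightarrow> real measure"
  assumes sets_mu[measurable_cong, simp]: "sets \<mu> = sets borel"
    and k_measurable: "case_prod k \<in> borel_measurable (borel \<Otimes>\<^sub>M borel)"
    and k_nonneg: "0 \<le> k x y"
    and k_sym: "k x y = k y x"
    and k_le: "k x y \<le> D x"
    and k_mass_le: "(LINT y|\<mu>. k x y) \<le> 1"
    and k_pos: "f \<in> L2_fun \<mu> \<Longrightarrow> 0 \<le> (LINT z|(\<mu> \<Otimes>\<^sub>M \<mu>). k (fst z) (snd z) * (f (snd z) \<bullet> f (fst z)))"
    and L_prob: "prob_space (L x)"
    and L_sets: "sets (L x) = sets borel"
    and L_integral: "f \<in> L2_fun \<mu> \<Longrightarrow>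
      (LINT y|L x. f y) = (LINT y|\<mu>. k x y *\<^sub>R f y) + (1 - (LINT y|\<mu>. k x y)) *\<^sub>R f x"
begin

lemma space_mu[simp]: "space \<mu> = UNIV"
  using sets_eq_imp_space_eq[OF sets_mu] by simp

lemma prob_UNIV[simp]: "measure \<mu> UNIV = 1"
  using prob_space by simp

lemma borel_measurable_mu[simp]: "borel_measurable \<mu> = borel_measurable borel"
  by (rule measurable_cong_sets) auto

lemma k_comp[measurable (raw)]:
  assumes [measurable]: "f \<in> borel_measurable M" "g \<in> borel_measurable M"
  shows "(\<lambda>x. k (f x) (g x)) \<in> borel_measurable M"
proof -
  have "(\<lambda>x. case_prod k (f x, g x)) \<in> borel_measurable M"
    by (rule measurable_compose[OF _ k_measurable]) simp
  then show ?thesis by simp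
qed

sublocale sq: pair_sigma_finite \<mu> \<mu> ..

definition p :: "real \<Rightarrow> real" where "p x = (LINT y|\<mu>. k x y)"

definition op :: "(real \<Rightarrow> complex) \<Rightarrow> real \<Rightarrow> complex" where
  "op f x = (LINT y|\<mu>. k x y *\<^sub>R f y) + (1 - p x) *\<^sub>R f x"

text \<open>On complex numbers \<open>\<bullet>\<close> is the Euclidean product of the plane, so
  \<open>ip\<close> is the real part of the Hermitian product. Nothing is lost: the kernel is real
  and symmetric, hence its quadratic form is real, and \<open>ip f f\<close> is the full squared
  norm.\<close>

definition ip :: "(real \<Rightarrow> complex) \<Rightarrow> (real \<Rightarrow> complex) \<Rightarrow> real" where
  "ip f g = (LINT x|\<mu>. f x \<bullet> g x)"

definition energy :: "(real \<Rightarrow> complex) \<Rightarrow> real" where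
  "energy f = ip f f - ip (op f) f"

lemma k_integrable[simp, intro]: "integrable \<mu> (k x)"
  by (rule integrable_const_bound[where B = "D x"]) (auto simp: k_nonneg k_le)

lemma p_nonneg: "0 \<le> p x" and p_le_1: "p x \<le> 1"
  using k_mass_le by (auto simp: p_def k_nonneg)

lemma p_measurable[measurable]: "p \<in> borel_measurable borel"
  unfolding p_def[abs_def] by measurable

section \<open>Calculus of square-integrable functions and the kernel operator\<close>

lemma L2_iff: "f \<in> L2_fun \<mu> \<longleftrightarrow> f \<in> borel_measurable borel \<and> integrable \<mu> (\<lambda>x. f x \<bullet> f x)"
  by (simp add: L2_fun_def dot_square_norm)

lemma L2_measurable: "f \<in> L2_fun \<mu> \<Longrightarrow> f \<in> borel_measurable borel"
  by (simp add: L2_iff)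

lemma L2_integrable_norm: "f \<in> L2_fun \<mu> \<Longrightarrow> integrable \<mu> (\<lambda>x. (cmod (f x))\<^sup>2)"
  by (simp add: L2_fun_def)

lemma L2_norm_eq: "L2_fun_norm \<mu> f = sqrt (ip f f)"
  by (simp add: L2_fun_norm_def ip_def dot_square_norm)

lemma ip_self: "ip f f = (LINT x|\<mu>. (cmod (f x))\<^sup>2)"
  by (simp add: ip_def dot_square_norm)

lemma ip_nonneg: "0 \<le> ip f f"
  by (simp add: ip_def)

lemma abs_inner_le: "\<bar>(a::complex) \<bullet> b\<bar> \<le> (cmod a)\<^sup>2 + (cmod b)\<^sup>2"
proof -
  have "\<bar>a \<bullet> b\<bar> \<le> cmod a * cmod b" by (rule Cauchy_Schwarz_ineq2)
  also have "\<dots> \<le> (cmod a)\<^sup>2 + (cmod b)\<^sup>2"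
    using sum_squares_bound[of "cmod a" "cmod b"] mult_nonneg_nonneg[OF norm_ge_zero[of a] norm_ge_zero[of b]]
    by linarith
  finally show ?thesis .
qed

lemma ip_integrable:
  assumes f: "f \<in> L2_fun \<mu>" and g: "g \<in> L2_fun \<mu>"
  shows "integrable \<mu> (\<lambda>x. f x \<bullet> g x)"
proof (rule Bochner_Integration.integrable_bound)
  show "integrable \<mu> (\<lambda>x. (cmod (f x))\<^sup>2 + (cmod (g x))\<^sup>2)"
    using f g by (simp add: L2_integrable_norm)
  show "(\<lambda>x. f x \<bullet> g x) \<in> borel_measurable \<mu>"
    using L2_measurable[OF f] L2_measurable[OF g] by measurable
qed (rule AE_I2, simp add: abs_inner_le)

lemma L2_add:
  assumes f: "f \<in> L2_fun \<mu>" and g: "g \<in> L2_fun \<mu>"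
  shows "(\<lambda>x. f x + g x) \<in> L2_fun \<mu>"
proof -
  have "(\<lambda>x. f x + g x) \<in> borel_measurable borel"
    using L2_measurable[OF f] L2_measurable[OF g] by measurable
  moreover have "(\<lambda>x. (f x + g x) \<bullet> (f x + g x)) = (\<lambda>x. f x \<bullet> f x + 2 * (f x \<bullet> g x) + g x \<bullet> g x)"
    by (rule ext) (simp add: inner_add_left inner_add_right inner_commute[of "g _" "f _"])
  ultimately show ?thesis
    using ip_integrable[OF f f] ip_integrable[OF g g] ip_integrable[OF f g] by (simp add: L2_iff)
qed

lemma L2_mult:
  assumes f: "f \<in> L2_fun \<mu>" shows "(\<lambda>x. c * f x) \<in> L2_fun \<mu>"
  using f L2_measurable[OF f] by (simp add: L2_fun_def norm_mult power_mult_distrib)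

lemma L2_diff:
  assumes f: "f \<in> L2_fun \<mu>" and g: "g \<in> L2_fun \<mu>"
  shows "(\<lambda>x. f x - g x) \<in> L2_fun \<mu>"
  using L2_add[OF f L2_mult[OF g, of "-1"]] by simp

lemma L2_bounded:
  assumes [measurable]: "f \<in> borel_measurable borel" and B: "\<And>x. cmod (f x) \<le> B"
  shows "f \<in> L2_fun \<mu>"
proof -
  have "integrable \<mu> (\<lambda>x. (cmod (f x))\<^sup>2)"
    by (rule integrable_const_bound[where B = "B\<^sup>2"]) (auto intro!: power_mono B)
  then show ?thesis by (simp add: L2_fun_def)
qed

lemma L2_integrable: "f \<in> L2_fun \<mu> \<Longrightarrow> integrable \<mu> f"
  by (rule integrable_of_L2_fun)

lemma L2_indicator:
  assumes f: "f \<in> L2_fun \<mu>" and [measurable]: "S \<in> sets borel"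
  shows "(\<lambda>x. indicator S x *\<^sub>R f x) \<in> L2_fun \<mu>"
proof -
  have "(\<lambda>x. indicator S x *\<^sub>R f x) \<in> borel_measurable borel"
    using L2_measurable[OF f] by measurable
  moreover have "integrable \<mu> (\<lambda>x. (cmod (indicator S x *\<^sub>R f x))\<^sup>2)"
    by (rule Bochner_Integration.integrable_bound[OF L2_integrable_norm[OF f]])
      (use L2_measurable[OF f] in \<open>auto split: split_indicator\<close>)
  ultimately show ?thesis by (simp add: L2_fun_def)
qed

lemma k_scaleR_integrable:
  assumes f: "integrable \<mu> f" and [measurable]: "f \<in> borel_measurable borel"
  shows "integrable \<mu> (\<lambda>y. k x y *\<^sub>R (f y :: 'b::{banach, second_countable_topology}))"
proof (rule Bochner_Integration.integrable_bound)
  show "integrable \<mu> (\<lambda>y. D x * norm (f y))" using f by simp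
  show "AE y in \<mu>. norm (k x y *\<^sub>R f y) \<le> norm (D x * norm (f y))"
  proof (rule AE_I2)
    fix y
    have "norm (k x y *\<^sub>R f y) = k x y * norm (f y)" by (simp add: k_nonneg)
    also have "\<dots> \<le> \<bar>D x\<bar> * norm (f y)"
      by (rule mult_right_mono[OF order_trans[OF k_le abs_ge_self]]) simp
    finally show "norm (k x y *\<^sub>R f y) \<le> norm (D x * norm (f y))" by (simp add: abs_mult)
  qed
qed measurable

lemma prod_k_fst_integrable:
  assumes g: "integrable \<mu> (g :: real \<Rightarrow> real)" and [measurable]: "g \<in> borel_measurable borel"
  shows "integrable (\<mu> \<Otimes>\<^sub>M \<mu>) (\<lambda>z. k (fst z) (snd z) * g (fst z))"
proof (rule sq.Fubini_integrable)
  have "integrable \<mu> (\<lambda>x. p x * norm (g x))"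
    by (rule Bochner_Integration.integrable_bound[OF g]) (auto simp: abs_mult p_nonneg p_le_1 intro!: mult_left_le_one_le)
  moreover have "(LINT y|\<mu>. norm (k x y * g x)) = p x * norm (g x)" for x
    by (simp add: p_def abs_mult k_nonneg)
  ultimately show "integrable \<mu> (\<lambda>x. LINT y|\<mu>. norm (k (fst (x, y)) (snd (x, y)) * g (fst (x, y))))"
    by simp
qed auto

lemma prod_k_snd_integrable:
  assumes g: "integrable \<mu> (g :: real \<Rightarrow> real)" and [measurable]: "g \<in> borel_measurable borel"
  shows "integrable (\<mu> \<Otimes>\<^sub>M \<mu>) (\<lambda>z. k (fst z) (snd z) * g (snd z))"
  using sq.integrable_product_swap[OF prod_k_fst_integrable[OF assms]]
  by (simp add: case_prod_beta' k_sym)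

lemma prod_k_ip_integrable:
  assumes f: "f \<in> L2_fun \<mu>" and g: "g \<in> L2_fun \<mu>"
  shows "integrable (\<mu> \<Otimes>\<^sub>M \<mu>) (\<lambda>z. k (fst z) (snd z) * (f (snd z) \<bullet> g (fst z)))"
proof (rule Bochner_Integration.integrable_bound)
  have [measurable]: "f \<in> borel_measurable borel" "g \<in> borel_measurable borel"
    using L2_measurable[OF f] L2_measurable[OF g] by auto
  show "integrable (\<mu> \<Otimes>\<^sub>M \<mu>) (\<lambda>z. k (fst z) (snd z) * (cmod (f (snd z)))\<^sup>2 + k (fst z) (snd z) * (cmod (g (fst z)))\<^sup>2)"
    by (intro Bochner_Integration.integrable_add prod_k_fst_integrable prod_k_snd_integrable
        L2_integrable_norm f g) measurable
  show "(\<lambda>z. k (fst z) (snd z) * (f (snd z) \<bullet> g (fst z))) \<in> borel_measurable (\<mu> \<Otimes>\<^sub>M \<mu>)"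
    by measurable
  show "AE z in \<mu> \<Otimes>\<^sub>M \<mu>. norm (k (fst z) (snd z) * (f (snd z) \<bullet> g (fst z)))
      \<le> norm (k (fst z) (snd z) * (cmod (f (snd z)))\<^sup>2 + k (fst z) (snd z) * (cmod (g (fst z)))\<^sup>2)"
    by (rule AE_I2) (auto simp: abs_mult k_nonneg distrib_left[symmetric] intro!: mult_left_mono abs_inner_le)
qed

lemma k_int_sq_integrable:
  assumes f: "f \<in> L2_fun \<mu>"
  shows "integrable \<mu> (\<lambda>x. LINT y|\<mu>. k x y * (cmod (f y))\<^sup>2)"
proof -
  have [measurable]: "f \<in> borel_measurable borel" using L2_measurable[OF f] by auto
  from sq.integrable_fst'[OF prod_k_snd_integrable[OF L2_integrable_norm[OF f]]]
  show ?thesis by simp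
qed

text \<open>Jensen's inequality for the subprobability with density \<open>k x\<close>: expanding
  the integral of \<open>k x y * (cmod (f y) - m)\<^sup>2\<close> gives
  \<open>(2 - p x) * m\<^sup>2\<close> on the left, and \<open>p x \<le> 1\<close> makes that at
  least \<open>m\<^sup>2\<close>.\<close>

lemma norm_k_int_le:
  assumes f: "f \<in> L2_fun \<mu>"
  shows "(cmod (LINT y|\<mu>. k x y *\<^sub>R f y))\<^sup>2 \<le> (LINT y|\<mu>. k x y * (cmod (f y))\<^sup>2)"
proof -
  have [measurable]: "f \<in> borel_measurable borel" using L2_measurable[OF f] by auto
  define m where "m = (LINT y|\<mu>. k x y * cmod (f y))"
  have i1: "integrable \<mu> (\<lambda>y. k x y * cmod (f y))"
    using k_scaleR_integrable[of "\<lambda>y. cmod (f y)" x] L2_integrable[OF f] by simp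
  have i2: "integrable \<mu> (\<lambda>y. k x y * (cmod (f y))\<^sup>2)"
    using k_scaleR_integrable[of "\<lambda>y. (cmod (f y))\<^sup>2" x] L2_integrable_norm[OF f] by simp
  have "cmod (LINT y|\<mu>. k x y *\<^sub>R f y) \<le> (LINT y|\<mu>. cmod (k x y *\<^sub>R f y))"
    by (rule integral_norm_bound)
  also have "\<dots> = m" by (simp add: m_def k_nonneg)
  finally have 1: "cmod (LINT y|\<mu>. k x y *\<^sub>R f y) \<le> m" .
  have "0 \<le> (LINT y|\<mu>. k x y * (cmod (f y) - m)\<^sup>2)"
    by (auto intro!: integral_nonneg_AE simp: k_nonneg)
  also have "\<dots> = (LINT y|\<mu>. k x y * (cmod (f y))\<^sup>2 - 2 * m * (k x y * cmod (f y)) + m\<^sup>2 * k x y)"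
    by (intro Bochner_Integration.integral_cong) (auto simp: power2_diff algebra_simps)
  also have "\<dots> = (LINT y|\<mu>. k x y * (cmod (f y))\<^sup>2) - 2 * m * m + m\<^sup>2 * p x"
    using i1 i2 by (simp add: m_def p_def)
  finally have "2 * m\<^sup>2 - m\<^sup>2 * p x \<le> (LINT y|\<mu>. k x y * (cmod (f y))\<^sup>2)"
    by (simp add: power2_eq_square)
  moreover have "m\<^sup>2 * p x \<le> m\<^sup>2 * 1" using p_le_1 by (intro mult_left_mono) auto
  moreover have "(cmod (LINT y|\<mu>. k x y *\<^sub>R f y))\<^sup>2 \<le> m\<^sup>2"
    using 1 by (intro power_mono) auto
  ultimately show ?thesis by simp
qed

lemma op_L2:
  assumes f: "f \<in> L2_fun \<mu>"
  shows "op f \<in> L2_fun \<mu>"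
proof -
  have [measurable]: "f \<in> borel_measurable borel" using L2_measurable[OF f] by auto
  have m: "(\<lambda>x. LINT y|\<mu>. k x y *\<^sub>R f y) \<in> borel_measurable borel" by measurable
  have "integrable \<mu> (\<lambda>x. (cmod (LINT y|\<mu>. k x y *\<^sub>R f y))\<^sup>2)"
  proof (rule Bochner_Integration.integrable_bound[OF k_int_sq_integrable[OF f]])
    show "AE x in \<mu>. norm ((cmod (LINT y|\<mu>. k x y *\<^sub>R f y))\<^sup>2) \<le> norm (LINT y|\<mu>. k x y * (cmod (f y))\<^sup>2)"
      using order_trans[OF norm_k_int_le[OF f] abs_ge_self] by simp
  qed measurable
  then have "(\<lambda>x. LINT y|\<mu>. k x y *\<^sub>R f y) \<in> L2_fun \<mu>"
    using m by (simp add: L2_fun_def)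
  moreover have "integrable \<mu> (\<lambda>x. (cmod ((1 - p x) *\<^sub>R f x))\<^sup>2)"
    by (rule Bochner_Integration.integrable_bound[OF L2_integrable_norm[OF f]])
      (auto simp: p_nonneg p_le_1 power_mult_distrib intro!: mult_left_le_one_le power_le_one)
  then have "(\<lambda>x. (1 - p x) *\<^sub>R f x) \<in> L2_fun \<mu>" by (simp add: L2_fun_def)
  ultimately have "(\<lambda>x. (LINT y|\<mu>. k x y *\<^sub>R f y) + (1 - p x) *\<^sub>R f x) \<in> L2_fun \<mu>" by (rule L2_add)
  then show ?thesis unfolding op_def[abs_def] .
qed

lemma kernel_op_eq: "f \<in> L2_fun \<mu> \<Longrightarrow> kernel_op L f x = op f x"
  by (simp add: kernel_op_def L_integral op_def p_def)

lemma op_linear: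
  assumes f: "f \<in> L2_fun \<mu>" and g: "g \<in> L2_fun \<mu>"
  shows "op (\<lambda>x. f x + c * g x) = (\<lambda>x. op f x + c * op g x)"
proof
  fix x
  have i: "integrable \<mu> (\<lambda>y. k x y *\<^sub>R f y)" "integrable \<mu> (\<lambda>y. k x y *\<^sub>R g y)"
    using k_scaleR_integrable[OF L2_integrable L2_measurable] f g by auto
  have "(LINT y|\<mu>. k x y *\<^sub>R (f y + c * g y)) = (LINT y|\<mu>. k x y *\<^sub>R f y + c * (k x y *\<^sub>R g y))"
    by (intro Bochner_Integration.integral_cong refl) (simp add: scaleR_add_right mult_scaleR_right)
  also have "\<dots> = (LINT y|\<mu>. k x y *\<^sub>R f y) + c * (LINT y|\<mu>. k x y *\<^sub>R g y)"
    using i by (simp del: mult_scaleR_right)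
  finally show "op (\<lambda>x. f x + c * g x) x = op f x + c * op g x"
    by (simp add: op_def algebra_simps)
qed

lemma op_const: "op (\<lambda>_. c) = (\<lambda>_. c)"
  by (simp add: op_def p_def fun_eq_iff algebra_simps)

definition bip :: "(real \<Rightarrow> complex) \<Rightarrow> (real \<Rightarrow> complex) \<Rightarrow> real" where
  "bip f g = (LINT z|(\<mu> \<Otimes>\<^sub>M \<mu>). k (fst z) (snd z) * (f (snd z) \<bullet> g (fst z)))"

lemma bip_sym:
  assumes f: "f \<in> L2_fun \<mu>" and g: "g \<in> L2_fun \<mu>"
  shows "bip f g = bip g f"
  using sq.integral_product_swap[OF borel_measurable_integrable[OF prod_k_ip_integrable[OF f g]]]
  by (simp add: bip_def case_prod_beta' k_sym inner_commute)

lemma ip_op: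
  assumes f: "f \<in> L2_fun \<mu>" and g: "g \<in> L2_fun \<mu>"
  shows "ip (op f) g = bip f g + (LINT x|\<mu>. (1 - p x) * (f x \<bullet> g x))"
proof -
  have [measurable]: "f \<in> borel_measurable borel" "g \<in> borel_measurable borel"
    using L2_measurable[OF f] L2_measurable[OF g] by auto
  have i: "integrable \<mu> (\<lambda>y. k x y *\<^sub>R f y)" for x
    using k_scaleR_integrable[OF L2_integrable L2_measurable] f by auto
  have e: "(LINT y|\<mu>. k x y * (f y \<bullet> g x)) = (LINT y|\<mu>. k x y *\<^sub>R f y) \<bullet> g x" for x
    using integral_inner_left[of "g x" \<mu> "\<lambda>y. k x y *\<^sub>R f y"] i by simp
  have "bip f g = (LINT x|\<mu>. LINT y|\<mu>. k x y * (f y \<bullet> g x))"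
    unfolding bip_def using sq.integral_fst'[OF prod_k_ip_integrable[OF f g]] by simp
  then have b: "bip f g = (LINT x|\<mu>. (LINT y|\<mu>. k x y *\<^sub>R f y) \<bullet> g x)" by (simp add: e)
  have 1: "integrable \<mu> (\<lambda>x. (LINT y|\<mu>. k x y *\<^sub>R f y) \<bullet> g x)"
    using sq.integrable_fst'[OF prod_k_ip_integrable[OF f g]] by (simp add: e)
  have 2: "integrable \<mu> (\<lambda>x. (1 - p x) * (f x \<bullet> g x))"
    by (rule Bochner_Integration.integrable_bound[OF ip_integrable[OF f g]])
      (auto simp: abs_mult p_nonneg p_le_1 intro!: mult_left_le_one_le)
  show ?thesis
    using 1 2 by (simp add: ip_def op_def inner_add_left b)
qed

lemma op_sym:
  assumes f: "f \<in> L2_fun \<mu>" and g: "g \<in> L2_fun \<mu>"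
  shows "ip (op f) g = ip f (op g)"
proof -
  have "ip f (op g) = ip (op g) f" by (simp add: ip_def inner_commute)
  then show ?thesis using ip_op[OF f g] ip_op[OF g f] bip_sym[OF f g] by (simp add: inner_commute)
qed

text \<open>The accepted moves contribute a nonnegative form by \<open>k_pos\<close>, and the
  rejections contribute the nonnegative weight \<open>1 - p x\<close>.\<close>

lemma ip_op_nonneg:
  assumes f: "f \<in> L2_fun \<mu>"
  shows "0 \<le> ip (op f) f"
  using k_pos[OF f] ip_op[OF f f] by (auto simp: bip_def p_le_1 intro!: add_nonneg_nonneg integral_nonneg_AE)

text \<open>Rejections leave \<open>f\<close> unchanged, so only moves count. Each of the two
  squares integrates to \<open>p\<close> times the squared modulus, the cross term is
  \<open>bip\<close>, and every pair appears in both orders, whence the factor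
  \<open>2\<close>.\<close>

lemma energy_integral:
  assumes f: "f \<in> L2_fun \<mu>"
  shows "integrable (\<mu> \<Otimes>\<^sub>M \<mu>) (\<lambda>z. k (fst z) (snd z) * (cmod (f (fst z) - f (snd z)))\<^sup>2)"
    and "(LINT z|(\<mu> \<Otimes>\<^sub>M \<mu>). k (fst z) (snd z) * (cmod (f (fst z) - f (snd z)))\<^sup>2) = 2 * energy f"
proof -
  have [measurable]: "f \<in> borel_measurable borel" using L2_measurable[OF f] by auto
  let ?k = "\<lambda>z. k (fst z) (snd z)"
  note i = prod_k_fst_integrable[OF L2_integrable_norm[OF f]] prod_k_snd_integrable[OF L2_integrable_norm[OF f]]
    prod_k_ip_integrable[OF f f]
  have eq: "(\<lambda>z. ?k z * (cmod (f (fst z) - f (snd z)))\<^sup>2) = (\<lambda>z. ?k z * (cmod (f (fst z)))\<^sup>2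
      + ?k z * (cmod (f (snd z)))\<^sup>2 - 2 * (?k z * (f (snd z) \<bullet> f (fst z))))"
    by (auto simp: power2_norm_eq_inner algebra_simps inner_diff_left inner_diff_right inner_commute[of "f (snd _)" "f (fst _)"])
  show int: "integrable (\<mu> \<Otimes>\<^sub>M \<mu>) (\<lambda>z. ?k z * (cmod (f (fst z) - f (snd z)))\<^sup>2)"
    unfolding eq using i by simp
  have a: "(LINT z|(\<mu> \<Otimes>\<^sub>M \<mu>). ?k z * (cmod (f (fst z)))\<^sup>2) = (LINT x|\<mu>. p x * (cmod (f x))\<^sup>2)"
    using sq.integral_fst'[OF i(1)] by (simp add: p_def)
  have "(LINT z|(\<mu> \<Otimes>\<^sub>M \<mu>). ?k z * (cmod (f (snd z)))\<^sup>2) = (LINT z|(\<mu> \<Otimes>\<^sub>M \<mu>). ?k z * (cmod (f (fst z)))\<^sup>2)"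
    using sq.integral_product_swap[OF borel_measurable_integrable[OF i(1)]] by (simp add: case_prod_beta' k_sym)
  with a have b: "(LINT z|(\<mu> \<Otimes>\<^sub>M \<mu>). ?k z * (cmod (f (snd z)))\<^sup>2) = (LINT x|\<mu>. p x * (cmod (f x))\<^sup>2)" by simp
  have ip: "integrable \<mu> (\<lambda>x. p x * (cmod (f x))\<^sup>2)"
    by (rule Bochner_Integration.integrable_bound[OF L2_integrable_norm[OF f]])
      (auto simp: abs_mult p_nonneg p_le_1 intro!: mult_left_le_one_le)
  have c: "ip (op f) f = bip f f + ip f f - (LINT x|\<mu>. p x * (cmod (f x))\<^sup>2)"
    using ip_op[OF f f] ip L2_integrable_norm[OF f]
    by (simp add: ip_self power2_norm_eq_inner[symmetric] left_diff_distrib)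
  show "(LINT z|(\<mu> \<Otimes>\<^sub>M \<mu>). ?k z * (cmod (f (fst z) - f (snd z)))\<^sup>2) = 2 * energy f"
    unfolding eq using i by (simp add: a b c energy_def bip_def)
qed

lemma energy_nonneg: "f \<in> L2_fun \<mu> \<Longrightarrow> 0 \<le> energy f"
proof -
  assume "f \<in> L2_fun \<mu>"
  then have "2 * energy f = (LINT z|(\<mu> \<Otimes>\<^sub>M \<mu>). k (fst z) (snd z) * (cmod (f (fst z) - f (snd z)))\<^sup>2)"
    by (rule energy_integral(2)[symmetric])
  also have "0 \<le> \<dots>" by (intro Bochner_Integration.integral_nonneg) (simp add: k_nonneg)
  finally show ?thesis by simp
qed

lemma nn_energy:
  assumes f: "f \<in> L2_fun \<mu>"
  shows "(\<integral>\<^sup>+x. \<integral>\<^sup>+y. ennreal (k x y * (cmod (f x - f y))\<^sup>2) \<partial>\<mu> \<partial>\<mu>) = ennreal (2 * energy f)"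
proof -
  have [measurable]: "f \<in> borel_measurable borel" using L2_measurable[OF f] .
  have m: "(\<lambda>z. ennreal (k (fst z) (snd z) * (cmod (f (fst z) - f (snd z)))\<^sup>2)) \<in> borel_measurable (\<mu> \<Otimes>\<^sub>M \<mu>)"
    by measurable
  show ?thesis
    using nn_integral_fst[OF m] nn_integral_eq_integral[OF energy_integral(1)[OF f]]
    by (simp add: k_nonneg energy_integral(2)[OF f])
qed

lemma ip_bilinear:
  assumes "f \<in> L2_fun \<mu>" "g \<in> L2_fun \<mu>" "f' \<in> L2_fun \<mu>" "g' \<in> L2_fun \<mu>"
  shows "ip (\<lambda>x. f x + complex_of_real c * g x) (\<lambda>x. f' x + complex_of_real c * g' x)
    = ip f f' + c * ip f g' + c * ip g f' + c\<^sup>2 * ip g g'"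
proof -
  have eq: "(f x + complex_of_real c * g x) \<bullet> (f' x + complex_of_real c * g' x)
      = f x \<bullet> f' x + c * (f x \<bullet> g' x) + c * (g x \<bullet> f' x) + c\<^sup>2 * (g x \<bullet> g' x)" for x
    by (simp add: scaleR_conv_of_real[symmetric] inner_add_left inner_add_right power2_eq_square
        algebra_simps del: scaleR_scaleR)
  show ?thesis
    unfolding ip_def eq using assms by (simp add: ip_integrable)
qed

lemma ip_commute: "ip f g = ip g f"
  by (simp add: ip_def inner_commute)

text \<open>The quadratic form \<open>f \<mapsto> \<langle>Tf, f\<rangle>\<close> is nonnegative at \<open>f - h / \<beta>\<close>; expanding gives the bound.\<close>

lemma contraction:
  assumes f: "f \<in> L2_fun \<mu>" and h: "h \<in> L2_fun \<mu>" and \<beta>: "0 < \<beta>"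
    and fh: "ip (op f) h = ip h h" and hh: "ip (op h) h \<le> \<beta> * ip h h"
  shows "ip h h \<le> \<beta> * ip (op f) f"
proof -
  let ?c = "- 1 / \<beta>"
  let ?F = "\<lambda>x. f x + complex_of_real ?c * h x"
  have "0 \<le> ip (op ?F) ?F"
    by (intro ip_op_nonneg L2_add L2_mult f h)
  also have "\<dots> = ip (op f) f + ?c * ip (op f) h + ?c * ip (op h) f + ?c\<^sup>2 * ip (op h) h"
    unfolding op_linear[OF f h] by (rule ip_bilinear) (use f h op_L2 in auto)
  also have "ip (op h) f = ip h h"
    using op_sym[OF h f] fh by (simp add: ip_commute)
  also have "ip (op f) f + ?c * ip (op f) h + ?c * ip h h + ?c\<^sup>2 * ip (op h) h
      \<le> ip (op f) f + ?c * ip h h + ?c * ip h h + ?c\<^sup>2 * (\<beta> * ip h h)"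
    using hh fh by (simp add: mult_left_mono divide_right_mono)
  also have "\<dots> = ip (op f) f - ip h h / \<beta>"
    using \<beta> by (simp add: power2_eq_square field_simps)
  finally show ?thesis using \<beta> by (simp add: field_simps)
qed

section \<open>Spectrum on mean-zero functions\<close>

lemma mean_zeroD: "f \<in> L2_mean_zero \<mu> \<Longrightarrow> f \<in> L2_fun \<mu>" "f \<in> L2_mean_zero \<mu> \<Longrightarrow> (LINT x|\<mu>. f x) = 0"
  by (auto simp: L2_mean_zero_def)

lemma mean_zeroI: "f \<in> L2_fun \<mu> \<Longrightarrow> (LINT x|\<mu>. f x) = 0 \<Longrightarrow> f \<in> L2_mean_zero \<mu>"
  by (auto simp: L2_mean_zero_def)

lemma mean_zero_add:
  assumes "f \<in> L2_mean_zero \<mu>" "g \<in> L2_mean_zero \<mu>"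
  shows "(\<lambda>x. f x + c * g x) \<in> L2_mean_zero \<mu>"
  using assms by (auto intro!: mean_zeroI L2_add L2_mult dest: mean_zeroD simp: L2_integrable mean_zeroD)

lemma mean_zero_mult: "f \<in> L2_mean_zero \<mu> \<Longrightarrow> (\<lambda>x. c * f x) \<in> L2_mean_zero \<mu>"
  by (auto intro!: mean_zeroI L2_mult dest: mean_zeroD simp: mean_zeroD)

lemma ip_const: "f \<in> L2_fun \<mu> \<Longrightarrow> ip f (\<lambda>_. c) = (LINT x|\<mu>. f x) \<bullet> c"
  unfolding ip_def by (rule integral_inner_left) (simp add: L2_integrable)

lemma L2_const: "(\<lambda>_. c) \<in> L2_fun \<mu>"
  by (rule L2_bounded[where B = "cmod c"]) auto

text \<open>Stationarity, obtained from self-adjointness by testing against constants, which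
  \<open>op\<close> fixes. Since \<open>\<bullet>\<close> sees only real parts, both
  \<open>1\<close> and \<open>\<i>\<close> serve as tests.\<close>

lemma integral_op:
  assumes f: "f \<in> L2_fun \<mu>"
  shows "(LINT x|\<mu>. op f x) = (LINT x|\<mu>. f x)"
proof -
  have "(LINT x|\<mu>. op f x) \<bullet> c = (LINT x|\<mu>. f x) \<bullet> c" for c
    using op_sym[OF f L2_const[of c]] by (simp add: op_const ip_const op_L2 f)
  from this[of 1] this[of \<i>] show ?thesis by (simp add: complex_eq_iff)
qed

lemma op_mean_zero: "f \<in> L2_mean_zero \<mu> \<Longrightarrow> op f \<in> L2_mean_zero \<mu>"
  by (auto intro!: mean_zeroI op_L2 dest: mean_zeroD simp: integral_op mean_zeroD)

lemma ip_op_le: "f \<in> L2_fun \<mu> \<Longrightarrow> ip (op f) f \<le> ip f f"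
  using energy_nonneg by (simp add: energy_def)

text \<open>This is \<open>contraction\<close> with \<open>h = op f\<close>: the squared norm of
  \<open>op f\<close> is at most \<open>\<beta>\<close> times the form at \<open>f\<close>, which
  costs a second factor \<open>\<beta>\<close>. Mean-zero functions are invariant, so the hypothesis
  applies to \<open>op f\<close> as well.\<close>

lemma op_norm_le:
  assumes f: "f \<in> L2_mean_zero \<mu>" and \<beta>: "0 < \<beta>"
    and le: "\<And>f. f \<in> L2_mean_zero \<mu> \<Longrightarrow> ip (op f) f \<le> \<beta> * ip f f"
  shows "ip (op f) (op f) \<le> \<beta>\<^sup>2 * ip f f"
proof -
  have "ip (op f) (op f) \<le> \<beta> * ip (op f) f"
    using f \<beta> le op_mean_zero by (intro contraction) (auto dest: mean_zeroD intro: op_L2)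
  also have "\<dots> \<le> \<beta> * (\<beta> * ip f f)" using le[OF f] \<beta> by (intro mult_left_mono) auto
  finally show ?thesis by (simp add: power2_eq_square)
qed

text \<open>The reverse triangle inequality for \<open>op f - z f\<close>, with
  \<open>op_norm_le\<close> controlling \<open>op f\<close>, carried out on squares under the
  integral.\<close>

lemma lower_bound_off_spectrum:
  assumes f: "f \<in> L2_mean_zero \<mu>" and \<beta>: "0 < \<beta>" and z: "\<beta> < cmod z"
    and le: "\<And>f. f \<in> L2_mean_zero \<mu> \<Longrightarrow> ip (op f) f \<le> \<beta> * ip f f"
  shows "(cmod z - \<beta>)\<^sup>2 * ip f f \<le> ip (\<lambda>x. op f x - z * f x) (\<lambda>x. op f x - z * f x)"
proof -
  let ?h = "\<lambda>x. op f x - z * f x"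
  let ?d = "cmod z - \<beta>"
  have f2: "f \<in> L2_fun \<mu>" using f by (rule mean_zeroD)
  have h2: "?h \<in> L2_fun \<mu>" by (intro L2_diff op_L2 L2_mult f2)
  have d: "0 < ?d" using z by simp
  have pt: "\<beta> * ?d * (cmod (z * f x))\<^sup>2 \<le> \<beta> * cmod z * (cmod (?h x))\<^sup>2 + ?d * cmod z * (cmod (op f x))\<^sup>2" for x
  proof -
    define a b where "a = cmod (op f x)" and "b = cmod (?h x)"
    have "cmod (z * f x) \<le> a + b"
      unfolding a_def b_def using norm_triangle_ineq4[of "op f x" "?h x"] by simp
    then have "(cmod (z * f x))\<^sup>2 \<le> (a + b)\<^sup>2" by (intro power_mono) auto
    then have "\<beta> * ?d * (cmod (z * f x))\<^sup>2 \<le> \<beta> * ?d * (a + b)\<^sup>2" using \<beta> d by (intro mult_left_mono) auto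
    \<comment> \<open>The added square is the one that cancels the cross term of
      \<open>(a + b)\<^sup>2\<close>; since \<open>\<beta> + ?d = cmod z\<close>, the remaining
      weights are \<open>\<beta> * cmod z\<close> and \<open>?d * cmod z\<close>.\<close>
    also have "\<dots> \<le> \<beta> * ?d * (a + b)\<^sup>2 + (\<beta> * b - ?d * a)\<^sup>2" by simp
    also have "\<dots> = \<beta> * cmod z * b\<^sup>2 + ?d * cmod z * a\<^sup>2" by (simp add: power2_eq_square algebra_simps)
    finally show ?thesis by (simp add: a_def b_def)
  qed
  have zf: "(LINT x|\<mu>. (cmod (z * f x))\<^sup>2) = (cmod z)\<^sup>2 * ip f f"
    by (simp add: ip_self norm_mult power_mult_distrib)
  have "\<beta> * ?d * (LINT x|\<mu>. (cmod (z * f x))\<^sup>2) = (LINT x|\<mu>. \<beta> * ?d * (cmod (z * f x))\<^sup>2)" by simp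
  also have "\<dots> \<le> (LINT x|\<mu>. \<beta> * cmod z * (cmod (?h x))\<^sup>2 + ?d * cmod z * (cmod (op f x))\<^sup>2)"
    by (intro integral_mono pt Bochner_Integration.integrable_add integrable_mult_right L2_integrable_norm h2 op_L2 L2_mult f2)
  also have "\<dots> = \<beta> * cmod z * ip ?h ?h + ?d * cmod z * ip (op f) (op f)"
    by (simp add: ip_self L2_integrable_norm[OF h2] L2_integrable_norm[OF op_L2[OF f2]])
  also have "\<dots> \<le> \<beta> * cmod z * ip ?h ?h + ?d * cmod z * (\<beta>\<^sup>2 * ip f f)"
    using op_norm_le[OF f \<beta> le] d by (intro add_left_mono mult_left_mono) auto
  finally have "\<beta> * cmod z * (?d * cmod z * ip f f) \<le> \<beta> * cmod z * (ip ?h ?h + ?d * \<beta> * ip f f)"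
    unfolding zf by (simp only: power2_eq_square algebra_simps)
  then have "?d * cmod z * ip f f \<le> ip ?h ?h + ?d * \<beta> * ip f f"
    by (rule mult_left_le_imp_le) (use \<beta> z in \<open>(intro mult_pos_pos; linarith)\<close>)
  then show ?thesis by (simp add: power2_eq_square algebra_simps)
qed

lemma ip_eq_0_AE:
  assumes f: "f \<in> L2_fun \<mu>" and "ip f f \<le> 0"
  shows "AE x in \<mu>. f x = 0"
proof -
  have "(LINT x|\<mu>. (cmod (f x))\<^sup>2) = 0" using assms(2) ip_nonneg[of f] by (simp add: ip_self[symmetric])
  then show ?thesis
    using integral_nonneg_eq_0_iff_AE[OF L2_integrable_norm[OF f]] by simp
qed

lemma ip_cong_AE:
  assumes "f \<in> L2_fun \<mu>" "g \<in> L2_fun \<mu>" "AE x in \<mu>. f x = g x"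
  shows "ip f f = ip g g"
  unfolding ip_def using assms L2_measurable by (intro integral_cong_AE) auto

lemma L1_le_L2:
  assumes f: "f \<in> L2_fun \<mu>"
  shows "(LINT x|\<mu>. cmod (f x)) \<le> sqrt (ip f f)"
proof -
  define m where "m = (LINT x|\<mu>. cmod (f x))"
  have "0 \<le> (LINT x|\<mu>. (cmod (f x) - m)\<^sup>2)" by simp
  also have "(\<lambda>x. (cmod (f x) - m)\<^sup>2) = (\<lambda>x. (cmod (f x))\<^sup>2 - 2 * m * cmod (f x) + m\<^sup>2)"
    by (auto simp: power2_diff)
  also have "(LINT x|\<mu>. (cmod (f x))\<^sup>2 - 2 * m * cmod (f x) + m\<^sup>2) = ip f f - 2 * m * m + m\<^sup>2"
    using L2_integrable_norm[OF f] L2_integrable[OF f] by (simp add: ip_self m_def prob_space)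
  finally have "m\<^sup>2 \<le> ip f f" by (simp add: power2_eq_square)
  then show ?thesis unfolding m_def by (rule real_le_rsqrt)
qed

lemma AE_summable_if_L1_summable:
  fixes a :: "nat \<Rightarrow> real \<Rightarrow> complex"
  assumes a: "\<And>n. integrable \<mu> (a n)" and s: "summable (\<lambda>n. LINT x|\<mu>. cmod (a n x))"
  shows "AE x in \<mu>. summable (\<lambda>n. cmod (a n x))"
proof -
  have [measurable]: "a n \<in> borel_measurable \<mu>" for n using a by (rule borel_measurable_integrable)
  have "(\<integral>\<^sup>+x. (\<Sum>n. ennreal (cmod (a n x))) \<partial>\<mu>) = (\<Sum>n. \<integral>\<^sup>+x. ennreal (cmod (a n x)) \<partial>\<mu>)"
    by (rule nn_integral_suminf) measurable
  also have "\<dots> = (\<Sum>n. ennreal (LINT x|\<mu>. cmod (a n x)))"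
    using a by (intro suminf_cong nn_integral_eq_integral) auto
  also have "\<dots> = ennreal (\<Sum>n. LINT x|\<mu>. cmod (a n x))"
    by (rule suminf_ennreal2[OF _ s]) simp
  finally have "(\<integral>\<^sup>+x. (\<Sum>n. ennreal (cmod (a n x))) \<partial>\<mu>) \<noteq> \<infinity>" by simp
  then have "AE x in \<mu>. (\<Sum>n. ennreal (cmod (a n x))) \<noteq> \<infinity>"
    by (intro nn_integral_PInf_AE) measurable
  then show ?thesis
  proof eventually_elim
    case (elim x)
    then show ?case by (intro summable_suminf_not_top) auto
  qed
qed

text \<open>The resolvent equation is solved by the Neumann series; square integrability of its sum follows
  from Fatou's lemma and the weighted Cauchy--Schwarz inequality with weights \<open>(\<beta> / |z|)\<^sup>n\<close>.\<close>

lemma resolvent_exists: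
  assumes g: "g \<in> L2_mean_zero \<mu>" and \<beta>: "0 < \<beta>" and z: "\<beta> < cmod z"
    and le: "\<And>f. f \<in> L2_mean_zero \<mu> \<Longrightarrow> ip (op f) f \<le> \<beta> * ip f f"
  shows "\<exists>f\<in>L2_mean_zero \<mu>. AE x in \<mu>. op f x - z * f x = g x"
proof -
  define s where "s = \<beta> / cmod z"
  have z0: "0 < cmod z" using \<beta> z by linarith
  have s: "0 < s" "s < 1" using \<beta> z z0 by (auto simp: s_def)
  define G where "G n = (op ^^ n) g" for n
  have G_Suc: "G (Suc n) = op (G n)" for n by (simp add: G_def)
  have GV: "G n \<in> L2_mean_zero \<mu>" for n
    by (induction n) (auto simp: G_Suc op_mean_zero, simp add: G_def g)
  have Gn: "ip (G n) (G n) \<le> (\<beta> ^ n)\<^sup>2 * ip g g" for n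
  proof (induction n)
    case (Suc n)
    have "ip (G (Suc n)) (G (Suc n)) \<le> \<beta>\<^sup>2 * ip (G n) (G n)"
      unfolding G_Suc by (rule op_norm_le[OF GV \<beta> le])
    also have "\<dots> \<le> \<beta>\<^sup>2 * ((\<beta> ^ n)\<^sup>2 * ip g g)" using Suc by (intro mult_left_mono) auto
    finally show ?case by (simp add: power2_eq_square mult_ac)
  qed (simp add: G_def)
  \<comment> \<open>The terms of \<open>- \<Sum> T^n g / z^(n+1)\<close>, the expansion of the
    inverse of \<open>T - z\<close> at \<open>g\<close>.\<close>
  define a where "a n = (\<lambda>x. - (1 / z ^ Suc n) * G n x)" for n
  have aV: "a n \<in> L2_mean_zero \<mu>" for n unfolding a_def by (rule mean_zero_mult[OF GV])
  have a2: "a n \<in> L2_fun \<mu>" for n using aV by (rule mean_zeroD)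
  have [measurable]: "a n \<in> borel_measurable borel" for n using L2_measurable[OF a2] .
  define N where "N = ip g g / (cmod z)\<^sup>2"
  have N0: "0 \<le> N" by (simp add: N_def ip_nonneg)
  have ipa: "ip (a n) (a n) \<le> (s ^ n)\<^sup>2 * N" for n
  proof -
    have "ip (a n) (a n) = (1 / cmod z ^ Suc n)\<^sup>2 * ip (G n) (G n)"
      unfolding ip_self a_def norm_mult power_mult_distrib by (simp add: norm_divide norm_power norm_mult)
    also have "\<dots> \<le> (1 / cmod z ^ Suc n)\<^sup>2 * ((\<beta> ^ n)\<^sup>2 * ip g g)"
      using Gn by (intro mult_left_mono) auto
    also have "\<dots> = (s ^ n)\<^sup>2 * N" using z0 by (simp add: s_def N_def power_divide power_mult_distrib)
    finally show ?thesis .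
  qed
  have L1a: "(LINT x|\<mu>. cmod (a n x)) \<le> s ^ n * sqrt N" for n
  proof -
    have "(LINT x|\<mu>. cmod (a n x)) \<le> sqrt (ip (a n) (a n))" by (rule L1_le_L2[OF a2])
    also have "\<dots> \<le> sqrt ((s ^ n)\<^sup>2 * N)" using ipa by simp
    also have "\<dots> = s ^ n * sqrt N" using s by (simp add: real_sqrt_mult)
    finally show ?thesis .
  qed
  have sum1: "summable (\<lambda>n. LINT x|\<mu>. cmod (a n x))"
    by (rule summable_comparison_test'[of "\<lambda>n. s ^ n * sqrt N" 0])
      (use L1a s in \<open>auto intro!: summable_mult2 summable_geometric\<close>)
  have AEs: "AE x in \<mu>. summable (\<lambda>n. cmod (a n x))"
    by (rule AE_summable_if_L1_summable[OF L2_integrable[OF a2] sum1])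
  define f where "f x = (\<Sum>n. a n x)" for x
  have f_meas[measurable]: "f \<in> borel_measurable borel" unfolding f_def by measurable
  have f2: "f \<in> L2_fun \<mu>"
  proof -
    define u where "u N x = (\<Sum>n<N. a n x)" for N x
    have [measurable]: "u N \<in> borel_measurable borel" for N unfolding u_def by measurable
    define C where "C = (1 / (1 - s)) * (N / (1 - s))"
    have geo: "(\<Sum>n<m. s ^ n) \<le> 1 / (1 - s)" for m
      using sum_le_suminf[OF summable_geometric, of s "{..<m}"] s by (simp add: suminf_geometric)
    have pt: "(cmod (u m x))\<^sup>2 \<le> (1 / (1 - s)) * (\<Sum>n<m. (cmod (a n x))\<^sup>2 / s ^ n)" for m x
    proof -
      have "(cmod (u m x))\<^sup>2 \<le> (\<Sum>n<m. cmod (a n x))\<^sup>2"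
        unfolding u_def by (intro power_mono norm_sum) auto
      also have "(\<Sum>n<m. cmod (a n x)) = (\<Sum>n<m. sqrt (s ^ n) * (cmod (a n x) / sqrt (s ^ n)))"
        using s by (intro sum.cong) auto
      also have "\<dots>\<^sup>2 \<le> (\<Sum>n<m. (sqrt (s ^ n))\<^sup>2) * (\<Sum>n<m. (cmod (a n x) / sqrt (s ^ n))\<^sup>2)"
        by (rule Cauchy_Schwarz_ineq_sum)
      also have "\<dots> = (\<Sum>n<m. s ^ n) * (\<Sum>n<m. (cmod (a n x))\<^sup>2 / s ^ n)"
        using s by (simp add: power_divide)
      also have "\<dots> \<le> (1 / (1 - s)) * (\<Sum>n<m. (cmod (a n x))\<^sup>2 / s ^ n)"
        using geo s by (intro mult_right_mono sum_nonneg) auto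
      finally show ?thesis .
    qed
    have uC: "(\<integral>\<^sup>+x. ennreal ((cmod (u m x))\<^sup>2) \<partial>\<mu>) \<le> ennreal C" for m
    proof -
      have i: "integrable \<mu> (\<lambda>x. (1 / (1 - s)) * (\<Sum>n<m. (cmod (a n x))\<^sup>2 / s ^ n))"
        by (intro integrable_mult_right Bochner_Integration.integrable_sum integrable_divide L2_integrable_norm a2)
      have "(\<integral>\<^sup>+x. ennreal ((cmod (u m x))\<^sup>2) \<partial>\<mu>) \<le> (\<integral>\<^sup>+x. ennreal ((1 / (1 - s)) * (\<Sum>n<m. (cmod (a n x))\<^sup>2 / s ^ n)) \<partial>\<mu>)"
        by (intro nn_integral_mono ennreal_leI pt)
      also have "\<dots> = ennreal (LINT x|\<mu>. (1 / (1 - s)) * (\<Sum>n<m. (cmod (a n x))\<^sup>2 / s ^ n))"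
        using s by (intro nn_integral_eq_integral[OF i] AE_I2 mult_nonneg_nonneg sum_nonneg) auto
      also have "(LINT x|\<mu>. (1 / (1 - s)) * (\<Sum>n<m. (cmod (a n x))\<^sup>2 / s ^ n))
          = (1 / (1 - s)) * (\<Sum>n<m. ip (a n) (a n) / s ^ n)"
        by (simp add: ip_self L2_integrable_norm[OF a2])
      also have "\<dots> \<le> C"
      proof -
        have "(\<Sum>n<m. ip (a n) (a n) / s ^ n) \<le> (\<Sum>n<m. s ^ n * N)"
        proof (rule sum_mono)
          fix n
          have "ip (a n) (a n) / s ^ n \<le> (s ^ n)\<^sup>2 * N / s ^ n"
            using ipa s by (intro divide_right_mono) auto
          also have "\<dots> = s ^ n * N" using s by (simp add: power2_eq_square)
          finally show "ip (a n) (a n) / s ^ n \<le> s ^ n * N" .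
        qed
        also have "\<dots> \<le> N / (1 - s)"
          using mult_right_mono[OF geo N0] by (simp add: sum_distrib_right)
        finally show ?thesis unfolding C_def using s by (intro mult_left_mono) auto
      qed
      finally show ?thesis by (simp add: ennreal_leI)
    qed
    have "AE x in \<mu>. ennreal ((cmod (f x))\<^sup>2) = liminf (\<lambda>m. ennreal ((cmod (u m x))\<^sup>2))"
      using AEs
    proof eventually_elim
      case (elim x)
      then have "(\<lambda>m. u m x) \<longlonglongrightarrow> f x"
        unfolding u_def f_def by (rule summable_LIMSEQ[OF summable_norm_cancel])
      then have "(\<lambda>m. ennreal ((cmod (u m x))\<^sup>2)) \<longlonglongrightarrow> ennreal ((cmod (f x))\<^sup>2)"
        by (intro tendsto_ennrealI tendsto_power tendsto_norm)
      then show ?case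
        by (rule lim_imp_Liminf[OF trivial_limit_sequentially, symmetric])
    qed
    then have "(\<integral>\<^sup>+x. ennreal ((cmod (f x))\<^sup>2) \<partial>\<mu>) = (\<integral>\<^sup>+x. liminf (\<lambda>m. ennreal ((cmod (u m x))\<^sup>2)) \<partial>\<mu>)"
      by (rule nn_integral_cong_AE)
    also have "\<dots> \<le> liminf (\<lambda>m. \<integral>\<^sup>+x. ennreal ((cmod (u m x))\<^sup>2) \<partial>\<mu>)"
      by (rule nn_integral_liminf) measurable
    also have "\<dots> \<le> ennreal C"
      using Liminf_mono[of _ "\<lambda>_. ennreal C" sequentially] uC by (simp add: Liminf_const)
    finally have "(\<integral>\<^sup>+x. ennreal ((cmod (f x))\<^sup>2) \<partial>\<mu>) < \<infinity>" by (simp add: order_le_less_trans)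
    then have "integrable \<mu> (\<lambda>x. (cmod (f x))\<^sup>2)"
      by (intro integrableI_bounded) auto
    then show ?thesis using f_meas by (simp add: L2_fun_def)
  qed
  have "(LINT x|\<mu>. f x) = (\<Sum>n. LINT x|\<mu>. a n x)"
    unfolding f_def by (rule integral_suminf[OF L2_integrable[OF a2] AEs sum1])
  also have "\<dots> = 0" using aV by (simp add: mean_zeroD)
  finally have fV: "f \<in> L2_mean_zero \<mu>" using f2 by (intro mean_zeroI)
  have op_a: "op (a n) x = z * a (Suc n) x" for n x
    using op_linear[OF L2_const[of 0] mean_zeroD(1)[OF GV[of n]], of "- (1 / z ^ Suc n)"] z0
    by (simp add: a_def G_Suc op_const)
  have "AE x in \<mu>. op f x - z * f x = g x"
    using AEs
  proof eventually_elim
    case (elim x)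
    then have sx: "summable (\<lambda>n. a n x)" by (rule summable_norm_cancel)
    \<comment> \<open>The series is pushed through the kernel at this one \<open>x\<close>. Because
      \<open>k x\<close> is bounded by \<open>D x\<close>, summability in the \<open>L^1\<close>
      norm is enough, so the only exceptional points are those where the series itself fails to
      converge.\<close>
    have ik: "integrable \<mu> (\<lambda>y. k x y *\<^sub>R a n y)" for n
      by (intro k_scaleR_integrable L2_integrable a2) measurable
    have AEk: "AE y in \<mu>. summable (\<lambda>n. norm (k x y *\<^sub>R a n y))"
      using AEs by eventually_elim (simp add: summable_mult k_nonneg)
    have "norm (LINT y|\<mu>. norm (k x y *\<^sub>R a n y)) \<le> \<bar>D x\<bar> * (s ^ n * sqrt N)" for n
    proof -
      have "(LINT y|\<mu>. norm (k x y *\<^sub>R a n y)) \<le> (LINT y|\<mu>. \<bar>D x\<bar> * cmod (a n y))"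
      proof (rule integral_mono)
        show "integrable \<mu> (\<lambda>y. norm (k x y *\<^sub>R a n y))" using ik by (rule integrable_norm)
        show "integrable \<mu> (\<lambda>y. \<bar>D x\<bar> * cmod (a n y))" using L2_integrable[OF a2] by simp
        show "norm (k x y *\<^sub>R a n y) \<le> \<bar>D x\<bar> * cmod (a n y)" for y
          using mult_right_mono[OF order_trans[OF k_le[of x y] abs_ge_self], of "cmod (a n y)"]
          by (simp add: k_nonneg)
      qed
      also have "\<dots> = \<bar>D x\<bar> * (LINT y|\<mu>. cmod (a n y))" by simp
      also have "\<dots> \<le> \<bar>D x\<bar> * (s ^ n * sqrt N)" by (intro mult_left_mono L1a) auto
      finally show ?thesis by simp
    qed
    moreover have "summable (\<lambda>n. \<bar>D x\<bar> * (s ^ n * sqrt N))"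
      by (rule summable_mult[OF summable_mult2[OF summable_geometric]]) (use s in simp)
    ultimately have sumk: "summable (\<lambda>n. LINT y|\<mu>. norm (k x y *\<^sub>R a n y))"
      by (rule summable_comparison_test'[rotated, where N = 0])
    have e1: "(\<lambda>n. LINT y|\<mu>. k x y *\<^sub>R a n y) sums (LINT y|\<mu>. (\<Sum>n. k x y *\<^sub>R a n y))"
      by (rule sums_integral[OF ik AEk sumk])
    have e2: "(LINT y|\<mu>. (\<Sum>n. k x y *\<^sub>R a n y)) = (LINT y|\<mu>. k x y *\<^sub>R f y)"
    proof (rule integral_cong_AE)
      show "AE y in \<mu>. (\<Sum>n. k x y *\<^sub>R a n y) = k x y *\<^sub>R f y"
        using AEs by eventually_elim (simp add: f_def suminf_scaleR_right[symmetric] summable_norm_cancel)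
    qed measurable
    have "(\<lambda>n. (LINT y|\<mu>. k x y *\<^sub>R a n y) + (1 - p x) *\<^sub>R a n x) sums ((LINT y|\<mu>. k x y *\<^sub>R f y) + (1 - p x) *\<^sub>R f x)"
      using e1 summable_sums[OF sx] unfolding e2 f_def by (intro sums_add sums_scaleR_right)
    then have "(\<lambda>n. op (a n) x) sums op f x" by (simp add: op_def)
    then have "(\<lambda>n. z * a (Suc n) x) sums op f x" by (simp add: op_a)
    moreover have "(\<lambda>n. z * a (Suc n) x) sums (z * (f x - a 0 x))"
      using summable_sums[OF sx] unfolding f_def by (intro sums_mult) (subst sums_Suc_iff, simp)
    \<comment> \<open>Applying \<open>op\<close> shifts the series by one term; the dropped term
      satisfies \<open>- z * a 0 x = g x\<close>.\<close>
    ultimately have "op f x = z * (f x - a 0 x)" by (rule sums_unique2)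
    then show ?case
      using z0 by (simp add: a_def G_def algebra_simps)
  qed
  with fV show ?thesis by blast
qed

text \<open>The Neumann series supplies solutions; the lower bound supplies both their uniqueness
  modulo null sets and the bound on the inverse.\<close>

lemma invertible_off_spectrum:
  assumes \<beta>: "0 < \<beta>" and z: "\<beta> < cmod z"
    and le: "\<And>f. f \<in> L2_mean_zero \<mu> \<Longrightarrow> ip (op f) f \<le> \<beta> * ip f f"
  shows "z \<notin> spectrum_mean_zero L \<mu>"
proof -
  let ?T = "\<lambda>f x. kernel_op L f x - z * f x"
  let ?S = "\<lambda>f x. op f x - z * f x"
  have T: "?T f = ?S f" if "f \<in> L2_mean_zero \<mu>" for f
    using kernel_op_eq[OF mean_zeroD(1)[OF that]] by auto
  have S2: "?S f \<in> L2_fun \<mu>" if "f \<in> L2_mean_zero \<mu>" for f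
    using that by (intro L2_diff op_L2 L2_mult mean_zeroD)
  note lb = lower_bound_off_spectrum[OF _ \<beta> z le]
  have d: "0 < (cmod z - \<beta>)\<^sup>2" using z by simp
  have unique: "AE x in \<mu>. h x = f x"
    if f: "f \<in> L2_mean_zero \<mu>" "AE x in \<mu>. ?S f x = g x" and h: "h \<in> L2_mean_zero \<mu>" "AE x in \<mu>. ?S h x = g x" for f g h
  proof -
    let ?e = "\<lambda>x. h x + (-1) * f x"
    have e: "?e \<in> L2_mean_zero \<mu>" using h(1) f(1) by (rule mean_zero_add)
    have ope: "op ?e = (\<lambda>x. op h x + (-1) * op f x)"
      by (rule op_linear[OF mean_zeroD(1)[OF h(1)] mean_zeroD(1)[OF f(1)]])
    have "AE x in \<mu>. ?S ?e x = 0"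
      using f(2) h(2) unfolding ope by eventually_elim (simp add: algebra_simps)
    then have "ip (?S ?e) (?S ?e) = ip (\<lambda>_. 0) (\<lambda>_. 0)"
      by (intro ip_cong_AE S2[OF e] L2_const)
    then have "ip (?S ?e) (?S ?e) = 0" by (simp add: ip_def)
    then have "(cmod z - \<beta>)\<^sup>2 * ip ?e ?e \<le> 0" using lb[OF e] by simp
    then have "ip ?e ?e \<le> 0" using d by (simp add: mult_le_0_iff)
    then have "AE x in \<mu>. ?e x = 0" by (rule ip_eq_0_AE[OF mean_zeroD(1)[OF e]])
    then show ?thesis by eventually_elim simp
  qed
  have "L2_fun_norm \<mu> f \<le> (1 / (cmod z - \<beta>)) * L2_fun_norm \<mu> (?T f)" if f: "f \<in> L2_mean_zero \<mu>" for f
  proof -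
    have "sqrt ((cmod z - \<beta>)\<^sup>2 * ip f f) \<le> sqrt (ip (?S f) (?S f))" using lb[OF f] by simp
    then have "(cmod z - \<beta>) * sqrt (ip f f) \<le> sqrt (ip (?S f) (?S f))"
      using z by (simp add: real_sqrt_mult)
    then show ?thesis unfolding T[OF f] L2_norm_eq using z by (simp add: field_simps)
  qed
  moreover have "\<exists>f\<in>L2_mean_zero \<mu>. (AE x in \<mu>. ?T f x = g x) \<and>
        (\<forall>h\<in>L2_mean_zero \<mu>. (AE x in \<mu>. ?T h x = g x) \<longrightarrow> (AE x in \<mu>. h x = f x))"
    if g: "g \<in> L2_mean_zero \<mu>" for g
  proof -
    obtain f where f: "f \<in> L2_mean_zero \<mu>" "AE x in \<mu>. ?S f x = g x"
      using resolvent_exists[OF g \<beta> z le] by auto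
    show ?thesis
    proof (intro bexI[OF _ f(1)] conjI ballI impI)
      show "AE x in \<mu>. ?T f x = g x" using f(2) fun_cong[OF T[OF f(1)]] by simp
      fix h assume h: "h \<in> L2_mean_zero \<mu>" "AE x in \<mu>. ?T h x = g x"
      show "AE x in \<mu>. h x = f x"
        by (rule unique[OF f h(1)]) (use h(2) fun_cong[OF T[OF h(1)]] in simp)
    qed
  qed
  ultimately show ?thesis
    unfolding spectrum_mean_zero_def boundedly_invertible_on_def by blast
qed

text \<open>The supremum \<open>m\<close> of the form over the unit sphere is an approximate
  eigenvalue. For a unit vector \<open>f\<close>, expanding the square and applying
  \<open>contraction\<close> to \<open>op f\<close> bounds the squared norm of
  \<open>op f - m f\<close> by \<open>m * (m - ip (op f) f)\<close>, which tends to zero along a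
  maximizing sequence. The positive value at \<open>f0\<close> ensures \<open>m > 0\<close>, as
  \<open>contraction\<close> requires.\<close>

lemma sup_numerical_range_in_spectrum:
  assumes f0: "f0 \<in> L2_mean_zero \<mu>" "ip f0 f0 = 1" "0 < ip (op f0) f0"
  obtains m where "ip (op f0) f0 \<le> m" "complex_of_real m \<in> spectrum_mean_zero L \<mu>"
proof -
  define R where "R = {ip (op f) f | f. f \<in> L2_mean_zero \<mu> \<and> ip f f = 1}"
  define m where "m = Sup R"
  have bdd: "bdd_above R"
    unfolding R_def by (rule bdd_aboveI[where M = 1]) (use ip_op_le in \<open>auto dest: mean_zeroD(1)\<close>, metis ip_op_le mean_zeroD(1))
  have R0: "ip (op f0) f0 \<in> R" using f0 by (auto simp: R_def)
  have m0: "ip (op f0) f0 \<le> m" unfolding m_def by (rule cSup_upper[OF R0 bdd])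
  then have mpos: "0 < m" using f0(3) by simp
  have le: "ip (op f) f \<le> m * ip f f" if f: "f \<in> L2_mean_zero \<mu>" for f
  proof (cases "ip f f = 0")
    case True
    then show ?thesis using ip_op_le[OF mean_zeroD(1)[OF f]] by simp
  next
    case False
    then have pos: "0 < ip f f" using ip_nonneg[of f] by simp
    define c where "c = 1 / sqrt (ip f f)"
    let ?F = "\<lambda>x. 0 + complex_of_real c * f x"
    have f2: "f \<in> L2_fun \<mu>" using f by (rule mean_zeroD)
    have c2: "c\<^sup>2 = 1 / ip f f" using pos by (simp add: c_def power_divide)
    have F: "?F \<in> L2_mean_zero \<mu>" using mean_zero_mult[OF f] by simp
    have z: "ip (\<lambda>_. 0) h = 0" "ip h (\<lambda>_. 0) = 0" for h by (simp_all add: ip_def)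
    have "ip ?F ?F = c\<^sup>2 * ip f f"
      using ip_bilinear[OF L2_const[of 0] f2 L2_const[of 0] f2, of c] by (simp only: z)
    then have "ip ?F ?F = 1" using pos c2 by simp
    moreover have "ip (op ?F) ?F = c\<^sup>2 * ip (op f) f"
      using ip_bilinear[OF L2_const[of 0] op_L2[OF f2] L2_const[of 0] f2, of c]
      unfolding op_linear[OF L2_const[of 0] f2] op_const by (simp only: z)
    ultimately have "c\<^sup>2 * ip (op f) f \<in> R" using F by (auto simp: R_def) metis
    then have "c\<^sup>2 * ip (op f) f \<le> m" unfolding m_def by (rule cSup_upper[OF _ bdd])
    then show ?thesis using pos by (simp add: c2 field_simps)
  qed
  have "complex_of_real m \<in> spectrum_mean_zero L \<mu>"
  proof (rule ccontr)
    assume "complex_of_real m \<notin> spectrum_mean_zero L \<mu>"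
    then obtain C where C: "\<And>f. f \<in> L2_mean_zero \<mu> \<Longrightarrow>
        L2_fun_norm \<mu> f \<le> C * L2_fun_norm \<mu> (\<lambda>x. kernel_op L f x - complex_of_real m * f x)"
      unfolding spectrum_mean_zero_def boundedly_invertible_on_def by blast
    define c where "c = \<bar>C\<bar> + 1"
    have c: "0 < c" by (simp add: c_def)
    \<comment> \<open>The margin is chosen so that
      \<open>c\<^sup>2 * m * (m - ip (op f) f) < 1\<close>, while an inverse bounded by
      \<open>c\<close> would force this quantity to be at least \<open>1\<close>.\<close>
    have "m - 1 / (c\<^sup>2 * m) < m" using c mpos by simp
    then obtain r where "r \<in> R" "m - 1 / (c\<^sup>2 * m) < r"
      unfolding m_def using less_cSup_iff[OF _ bdd] R0 by (metis empty_iff)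
    then obtain f where f: "f \<in> L2_mean_zero \<mu>" "ip f f = 1" "m - 1 / (c\<^sup>2 * m) < ip (op f) f"
      by (auto simp: R_def)
    have f2: "f \<in> L2_fun \<mu>" using f(1) by (rule mean_zeroD)
    let ?h = "\<lambda>x. op f x + complex_of_real (- m) * f x"
    have eq: "(\<lambda>x. kernel_op L f x - complex_of_real m * f x) = ?h"
      using kernel_op_eq[OF f2] by auto
    have "ip ?h ?h = ip (op f) (op f) - 2 * m * ip (op f) f + m\<^sup>2"
      using ip_bilinear[OF op_L2[OF f2] f2 op_L2[OF f2] f2, of "- m"] f(2)
      by (simp add: ip_commute[of f "op f"])
    also have "ip (op f) (op f) \<le> m * ip (op f) f"
      by (rule contraction[OF f2 op_L2[OF f2] mpos refl le[OF op_mean_zero[OF f(1)]]])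
    finally have hh: "ip ?h ?h \<le> m * (m - ip (op f) f)"
      by (simp add: power2_eq_square algebra_simps)
    have "1 \<le> C * sqrt (ip ?h ?h)"
      using C[OF f(1)] unfolding eq L2_norm_eq f(2) by simp
    also have "\<dots> \<le> c * sqrt (ip ?h ?h)"
      unfolding c_def by (intro mult_right_mono) (auto simp: ip_nonneg)
    finally have "1\<^sup>2 \<le> (c * sqrt (ip ?h ?h))\<^sup>2" by (intro power_mono) auto
    then have "1 \<le> c\<^sup>2 * ip ?h ?h" by (simp add: power_mult_distrib ip_nonneg)
    also have "\<dots> \<le> c\<^sup>2 * (m * (m - ip (op f) f))" using hh by (intro mult_left_mono) auto
    also have "\<dots> < c\<^sup>2 * (m * (1 / (c\<^sup>2 * m)))"
      using f(3) c mpos by (intro mult_strict_left_mono) auto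
    also have "\<dots> = 1" using c mpos by simp
    finally show False by simp
  qed
  then show thesis using m0 that by blast
qed

text \<open>The test function \<open>f0\<close> does two things: it bounds the gap from above, and
  it shows that the spectrum is nonempty, without which the supremum in \<open>spectral_gap\<close>
  would carry no information.\<close>

lemma spectral_gap_bounds:
  assumes f0: "f0 \<in> L2_mean_zero \<mu>" "ip f0 f0 = 1" "energy f0 < 1"
    and G: "G < 1" and poincare: "\<And>f. f \<in> L2_mean_zero \<mu> \<Longrightarrow> G * ip f f \<le> energy f"
  shows "G \<le> spectral_gap L \<mu>" "spectral_gap L \<mu> \<le> energy f0"
proof -
  let ?Sp = "spectrum_mean_zero L \<mu>"
  have "0 < ip (op f0) f0" using f0 by (simp add: energy_def)
  then obtain m where m: "ip (op f0) f0 \<le> m" "complex_of_real m \<in> ?Sp"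
    using sup_numerical_range_in_spectrum f0 by blast
  have ub: "cmod z \<le> 1 - G" if "z \<in> ?Sp" for z
  proof (rule ccontr)
    assume "\<not> cmod z \<le> 1 - G"
    then have "z \<notin> ?Sp"
      using G poincare by (intro invertible_off_spectrum[of "1 - G"]) (auto simp: energy_def algebra_simps)
    then show False using that by simp
  qed
  have "(SUP z\<in>?Sp. cmod z) \<le> 1 - G"
    by (rule cSUP_least) (use m ub in auto)
  then show "G \<le> spectral_gap L \<mu>" by (simp add: spectral_gap_def)
  have "m \<le> cmod (complex_of_real m)" by simp
  also have "\<dots> \<le> (SUP z\<in>?Sp. cmod z)"
    by (rule cSUP_upper[OF m(2) bdd_aboveI2[OF ub]])
  finally show "spectral_gap L \<mu> \<le> energy f0"
    using m(1) f0(2) by (simp add: spectral_gap_def energy_def)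
qed

section \<open>Conductance from indicator test functions\<close>

definition ind :: "real set \<Rightarrow> real \<Rightarrow> complex" where
  "ind S x = complex_of_real (indicator S x)"

lemma ind_L2: "S \<in> sets borel \<Longrightarrow> ind S \<in> L2_fun \<mu>"
  unfolding ind_def[abs_def] by (rule L2_bounded[where B = 1]) (auto split: split_indicator)

lemma space_L[simp]: "space (L x) = UNIV"
  using sets_eq_imp_space_eq[OF L_sets] by simp

lemma op_ind:
  assumes S: "S \<in> sets borel"
  shows "op (ind S) x = complex_of_real (measure (L x) S)"
proof -
  have "op (ind S) x = (LINT y|L x. complex_of_real (indicator S y))"
    using kernel_op_eq[OF ind_L2[OF S], of x] by (simp add: kernel_op_def ind_def)
  also have "\<dots> = complex_of_real (measure (L x) S)"
    by (subst integral_complex_of_real) (use S in \<open>simp add: L_sets\<close>)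
  finally show ?thesis .
qed

lemma measure_L_measurable:
  assumes S: "S \<in> sets borel"
  shows "(\<lambda>x. measure (L x) S) \<in> borel_measurable borel"
proof -
  have "(\<lambda>x. Re (op (ind S) x)) \<in> borel_measurable borel"
    using L2_measurable[OF op_L2[OF ind_L2[OF S]]] by measurable
  then show ?thesis by (simp add: op_ind S)
qed

text \<open>\<open>1 - measure (L x) S\<close> is the escape probability, so the energy of an
  indicator is the stationary flow out of the set. Through this identity one flow estimate serves
  the conductances and the spectral gap alike.\<close>

lemma energy_ind:
  assumes S: "S \<in> sets borel" and pos: "0 < measure \<mu> S"
  shows "energy (ind S) = set_conductance L \<mu> S * measure \<mu> S"
proof -
  have [measurable]: "S \<in> sets borel" "(\<lambda>x. measure (L x) S) \<in> borel_measurable borel"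
    using S measure_L_measurable by auto
  have c: "measure (L x) (UNIV - S) = 1 - measure (L x) S" for x
    using prob_space.prob_compl[OF L_prob, of S x] S by (simp add: L_sets)
  have i1: "integrable \<mu> (\<lambda>x. indicator S x :: real)"
    by (rule integrable_const_bound[where B = 1]) (auto split: split_indicator)
  have le1: "measure (L x) S \<le> 1" for x using prob_space.prob_le_1[OF L_prob] .
  have i2: "integrable \<mu> (\<lambda>x. indicator S x * measure (L x) S)"
    by (rule integrable_const_bound[where B = 1]) (auto split: split_indicator simp: le1)
  have "ip (ind S) (ind S) = (LINT x|\<mu>. indicator S x)"
    unfolding ip_def by (intro Bochner_Integration.integral_cong) (auto simp: ind_def split: split_indicator)
  moreover have "ip (op (ind S)) (ind S) = (LINT x|\<mu>. indicator S x * measure (L x) S)"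
    unfolding ip_def by (intro Bochner_Integration.integral_cong) (auto simp: op_ind S ind_def inner_complex_def split: split_indicator)
  ultimately have "energy (ind S) = (LINT x|\<mu>. indicator S x * (1 - measure (L x) S))"
    using i1 i2 by (simp add: energy_def right_diff_distrib)
  then show ?thesis using pos by (simp add: set_conductance_def set_lebesgue_integral_def c)
qed

lemma energy_shift:
  assumes f: "f \<in> L2_fun \<mu>"
  shows "energy (\<lambda>x. f x + c) = energy f"
    and "ip (\<lambda>x. f x + c) (\<lambda>x. f x + c) = ip f f + 2 * ((LINT x|\<mu>. f x) \<bullet> c) + (cmod c)\<^sup>2"
proof -
  let ?F = "\<lambda>x. f x + complex_of_real 1 * c"
  have cc: "ip (\<lambda>_. c) (\<lambda>_. c) = (cmod c)\<^sup>2" by (simp add: ip_self)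
  have 1: "ip ?F ?F = ip f f + 2 * ((LINT x|\<mu>. f x) \<bullet> c) + (cmod c)\<^sup>2"
    using ip_bilinear[OF f L2_const f L2_const, of 1 c c] ip_commute[of "\<lambda>_. c" f]
    by (simp add: ip_const f cc)
  have 2: "ip (op ?F) ?F = ip (op f) f + 2 * ((LINT x|\<mu>. f x) \<bullet> c) + (cmod c)\<^sup>2"
    using ip_bilinear[OF op_L2[OF f] L2_const f L2_const, of 1 c c] ip_commute[of "\<lambda>_. c" f]
      op_linear[OF f L2_const[of c], of 1]
    by (simp add: ip_const f cc op_const op_L2 integral_op)
  show "energy (\<lambda>x. f x + c) = energy f" using 1 2 by (simp add: energy_def)
  show "ip (\<lambda>x. f x + c) (\<lambda>x. f x + c) = ip f f + 2 * ((LINT x|\<mu>. f x) \<bullet> c) + (cmod c)\<^sup>2"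
    using 1 by simp
qed

lemma energy_scale:
  assumes f: "f \<in> L2_fun \<mu>"
  shows "energy (\<lambda>x. complex_of_real c * f x) = c\<^sup>2 * energy f"
    and "ip (\<lambda>x. complex_of_real c * f x) (\<lambda>x. complex_of_real c * f x) = c\<^sup>2 * ip f f"
proof -
  let ?F = "\<lambda>x. 0 + complex_of_real c * f x"
  have z: "ip (\<lambda>_. 0) h = 0" "ip h (\<lambda>_. 0) = 0" for h by (simp_all add: ip_def)
  have 1: "ip ?F ?F = c\<^sup>2 * ip f f"
    using ip_bilinear[OF L2_const[of 0] f L2_const[of 0] f, of c] by (simp only: z)
  have 2: "ip (op ?F) ?F = c\<^sup>2 * ip (op f) f"
    using ip_bilinear[OF L2_const[of 0] op_L2[OF f] L2_const[of 0] f, of c]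
    unfolding op_linear[OF L2_const[of 0] f] op_const by (simp only: z)
  show "ip (\<lambda>x. complex_of_real c * f x) (\<lambda>x. complex_of_real c * f x) = c\<^sup>2 * ip f f"
    using 1 by simp
  show "energy (\<lambda>x. complex_of_real c * f x) = c\<^sup>2 * energy f"
    using 1 2 by (simp add: energy_def right_diff_distrib)
qed

lemma variance_le_energy:
  assumes poincare: "\<And>f. f \<in> L2_mean_zero \<mu> \<Longrightarrow> G * ip f f \<le> energy f" and f: "f \<in> L2_fun \<mu>"
  shows "G * (ip f f - (cmod (LINT x|\<mu>. f x))\<^sup>2) \<le> energy f"
proof -
  define c where "c = - (LINT x|\<mu>. f x)"
  have "(\<lambda>x. f x + c) \<in> L2_mean_zero \<mu>"
    using f by (intro mean_zeroI L2_add L2_const) (auto simp: c_def L2_integrable)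
  then have "G * ip (\<lambda>x. f x + c) (\<lambda>x. f x + c) \<le> energy (\<lambda>x. f x + c)" by (rule poincare)
  moreover have "(LINT x|\<mu>. f x) \<bullet> c = - (cmod (LINT x|\<mu>. f x))\<^sup>2"
    by (simp add: c_def dot_square_norm)
  moreover have "(cmod c)\<^sup>2 = (cmod (LINT x|\<mu>. f x))\<^sup>2" by (simp add: c_def)
  ultimately show ?thesis unfolding energy_shift[OF f] by simp
qed

lemma ip_ind: 
  assumes S: "S \<in> sets borel" shows "ip (ind S) (ind S) = measure \<mu> S" "(LINT x|\<mu>. ind S x) = complex_of_real (measure \<mu> S)"
proof -
  have "ip (ind S) (ind S) = (LINT x|\<mu>. indicator S x)"
    unfolding ip_def by (intro Bochner_Integration.integral_cong) (auto simp: ind_def split: split_indicator)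
  then show "ip (ind S) (ind S) = measure \<mu> S" using S by simp
  show "(LINT x|\<mu>. ind S x) = complex_of_real (measure \<mu> S)"
    unfolding ind_def by (subst integral_complex_of_real) (use S in simp)
qed

text \<open>The easy half of Cheeger's inequality: an indicator of mass \<open>m \<le> 1/2\<close>
  has variance \<open>m * (1 - m) \<ge> m / 2\<close>.\<close>

lemma set_conductance_ge:
  assumes poincare: "\<And>f. f \<in> L2_mean_zero \<mu> \<Longrightarrow> G * ip f f \<le> energy f" and G: "0 \<le> G"
    and S: "S \<in> sets borel" "0 < measure \<mu> S" "measure \<mu> S \<le> 1/2"
  shows "G / 2 \<le> set_conductance L \<mu> S"
proof -
  let ?m = "measure \<mu> S"
  have "?m * (G * (1 - ?m)) \<le> ?m * set_conductance L \<mu> S"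
    using variance_le_energy[OF poincare ind_L2[OF S(1)]] energy_ind[OF S(1,2)]
    by (simp add: ip_ind S power2_eq_square algebra_simps)
  then have "G * (1 - ?m) \<le> set_conductance L \<mu> S"
    using S(2) by (simp only: mult_le_cancel_left_pos)
  moreover have "G * (1/2) \<le> G * (1 - ?m)" using S(3) G by (intro mult_left_mono) auto
  ultimately show ?thesis by simp
qed

text \<open>The infimum admits only masses strictly below \<open>1/2\<close>, which excludes the
  negative half-line of a symmetric target; the test set \<open>S\<close> is therefore left free
  here.\<close>

lemma conductance_bounds:
  assumes poincare: "\<And>f. f \<in> L2_mean_zero \<mu> \<Longrightarrow> G * ip f f \<le> energy f" and G: "0 \<le> G"
    and S: "S \<in> sets borel" "0 < measure \<mu> S" "measure \<mu> S < 1/2"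
  shows "G / 2 \<le> conductance L \<mu>" "conductance L \<mu> \<le> set_conductance L \<mu> S"
proof -
  let ?A = "{S \<in> sets \<mu>. 0 < measure \<mu> S \<and> measure \<mu> S < 1/2}"
  have SA: "S \<in> ?A" using S by simp
  have lb: "G / 2 \<le> set_conductance L \<mu> S" if "S \<in> ?A" for S
    using that by (intro set_conductance_ge poincare G) auto
  show "G / 2 \<le> conductance L \<mu>" unfolding conductance_def by (rule cINF_greatest) (use SA lb in auto)
  show "conductance L \<mu> \<le> set_conductance L \<mu> S"
    unfolding conductance_def by (rule cINF_lower[OF bdd_belowI2[OF lb] SA])
qed

text \<open>The test function is \<open>2 * ind S - 1\<close>. Mass one half gives it mean zero, its
  modulus is \<open>1\<close>, and its energy is four times that of \<open>ind S\<close>, that is,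
  twice the conductance of \<open>S\<close>. The bound \<open>1/2\<close> on the conductance makes
  this energy less than \<open>1\<close>.\<close>

lemma spectral_gap_half_bounds:
  assumes poincare: "\<And>f. f \<in> L2_mean_zero \<mu> \<Longrightarrow> G * ip f f \<le> energy f" and G: "G < 1"
    and S: "S \<in> sets borel" "measure \<mu> S = 1/2" and c: "set_conductance L \<mu> S < 1/2"
  shows "G \<le> spectral_gap L \<mu>" "spectral_gap L \<mu> \<le> 2 * set_conductance L \<mu> S"
proof -
  define h where "h x = ind S x + complex_of_real (- 1 / 2)" for x
  define f0 where "f0 x = complex_of_real 2 * h x" for x
  have h2: "h \<in> L2_fun \<mu>" unfolding h_def[abs_def] by (rule L2_add[OF ind_L2[OF S(1)] L2_const])
  have "(LINT x|\<mu>. h x) = 0"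
    using ip_ind(2)[OF S(1)] S(2) by (simp add: h_def L2_integrable[OF ind_L2[OF S(1)]])
  then have f0: "f0 \<in> L2_mean_zero \<mu>"
    unfolding f0_def[abs_def] by (intro mean_zero_mult mean_zeroI h2)
  have "ip h h = 1/4"
    unfolding h_def[abs_def] energy_shift(2)[OF ind_L2[OF S(1)]] ip_ind[OF S(1)] S(2)
    by (simp add: inner_complex_def power2_eq_square)
  then have ip0: "ip f0 f0 = 1" unfolding f0_def[abs_def] energy_scale(2)[OF h2] by simp
  have "energy f0 = 4 * energy (ind S)"
    unfolding f0_def[abs_def] energy_scale(1)[OF h2] unfolding h_def[abs_def] energy_shift(1)[OF ind_L2[OF S(1)]]
    by simp
  then have e: "energy f0 = 2 * set_conductance L \<mu> S" using energy_ind[OF S(1)] S(2) by simp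
  show "G \<le> spectral_gap L \<mu>" "spectral_gap L \<mu> \<le> 2 * set_conductance L \<mu> S"
    using spectral_gap_bounds[OF f0 ip0 _ G poincare] e c by auto
qed

section \<open>Decay of survival probabilities\<close>

primrec survival :: "real set \<Rightarrow> nat \<Rightarrow> real \<Rightarrow> real" where
  "survival S 0 = indicator S"
| "survival S (Suc n) = (\<lambda>x. indicator S x * (LINT y|L x. survival S n y))"

text \<open>\<open>survival S n x\<close> is the probability that the starting point and the next
  \<open>n\<close> states all lie in \<open>S\<close>, a power of the kernel killed outside
  \<open>S\<close>. Square integrability and the recursion through \<open>op\<close> are proved in
  one induction, since replacing the kernel integral by \<open>op\<close> presupposes the
  former.\<close>

lemma survival_op:
  assumes S: "S \<in> sets borel"
  shows "(\<lambda>x. complex_of_real (survival S n x)) \<in> L2_fun \<mu>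
    \<and> (\<forall>x. complex_of_real (survival S (Suc n) x) = indicator S x *\<^sub>R op (\<lambda>x. complex_of_real (survival S n x)) x)"
proof (induction n)
  have *: "complex_of_real (survival S (Suc n) x) = indicator S x *\<^sub>R op (\<lambda>x. complex_of_real (survival S n x)) x"
    if "(\<lambda>x. complex_of_real (survival S n x)) \<in> L2_fun \<mu>" for n x
    using kernel_op_eq[OF that, of x] by (simp add: kernel_op_def scaleR_conv_of_real)
  {
    case 0
    show ?case using ind_L2[OF S] *[of 0] by (simp add: ind_def[abs_def] del: survival.simps(2))
  next
    case (Suc n)
    then have "(\<lambda>x. complex_of_real (survival S (Suc n) x)) \<in> L2_fun \<mu>"
      using L2_indicator[OF op_L2 S] by (simp only:)
    then show ?case using * by blast
  }
qed

text \<open>A function supported in a set of mass at most \<open>1/2\<close> has squared mean at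
  most half its squared norm, by Cauchy--Schwarz. Its variance is thus at least half its squared
  norm, and the Poincare inequality survives killing with the loss of a factor two.\<close>

lemma killed_contraction:
  assumes poincare: "\<And>f. f \<in> L2_mean_zero \<mu> \<Longrightarrow> G * ip f f \<le> energy f" and G: "0 \<le> G" "G \<le> 1"
    and S: "S \<in> sets borel" "measure \<mu> S \<le> 1/2"
    and f: "f \<in> L2_fun \<mu>" and supp: "\<And>x. x \<notin> S \<Longrightarrow> f x = 0"
  shows "ip (op f) f \<le> (1 - G / 2) * ip f f"
proof -
  define a where "a = (LINT x|\<mu>. cmod (f x))"
  have int: "integrable \<mu> (\<lambda>x. cmod (f x))" using L2_integrable[OF f] by simp
  have int1: "integrable \<mu> (\<lambda>x. indicator S x :: real)"
    by (rule integrable_const_bound[where B = 1]) (use S in \<open>auto split: split_indicator\<close>)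
  \<comment> \<open>Cauchy--Schwarz on the support: \<open>2 * a\<close> is the best constant
    multiple of the indicator when \<open>S\<close> has mass exactly \<open>1/2\<close>.\<close>
  have "0 \<le> (LINT x|\<mu>. (cmod (f x) - 2 * a * indicator S x)\<^sup>2)" by simp
  also have "(\<lambda>x. (cmod (f x) - 2 * a * indicator S x)\<^sup>2)
      = (\<lambda>x. (cmod (f x))\<^sup>2 - 4 * a * cmod (f x) + 4 * a\<^sup>2 * indicator S x)"
    by (rule ext) (use supp in \<open>auto simp: power2_eq_square algebra_simps split: split_indicator\<close>)
  also have "(LINT x|\<mu>. (cmod (f x))\<^sup>2 - 4 * a * cmod (f x) + 4 * a\<^sup>2 * indicator S x)
      = ip f f - 4 * a * a + 4 * a\<^sup>2 * measure \<mu> S"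
    using L2_integrable_norm[OF f] int int1 S(1) by (simp add: ip_self a_def)
  also have "\<dots> \<le> ip f f - 4 * a * a + 4 * a\<^sup>2 * (1/2)"
    using S(2) by (intro add_left_mono mult_left_mono) auto
  finally have a2: "2 * a\<^sup>2 \<le> ip f f" by (simp add: power2_eq_square)
  have "cmod (LINT x|\<mu>. f x) \<le> a" unfolding a_def by (rule integral_norm_bound)
  then have "(cmod (LINT x|\<mu>. f x))\<^sup>2 \<le> a\<^sup>2" by (intro power_mono) auto
  then have "ip f f / 2 \<le> ip f f - (cmod (LINT x|\<mu>. f x))\<^sup>2" using a2 by simp
  then have "G * (ip f f / 2) \<le> G * (ip f f - (cmod (LINT x|\<mu>. f x))\<^sup>2)" using G by (intro mult_left_mono)
  also have "\<dots> \<le> energy f" by (rule variance_le_energy[OF poincare f])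
  finally show ?thesis by (simp add: energy_def algebra_simps)
qed

text \<open>\<open>u (Suc n)\<close> is the orthogonal projection of \<open>op (u n)\<close> onto
  functions supported in \<open>S\<close>. Pairing it with \<open>op (u n)\<close> therefore gives
  its own squared norm, which is the hypothesis of \<open>contraction\<close> with
  \<open>h = u (Suc n)\<close>.\<close>

lemma survival_norm:
  assumes poincare: "\<And>f. f \<in> L2_mean_zero \<mu> \<Longrightarrow> G * ip f f \<le> energy f" and G: "0 \<le> G" "G \<le> 1"
    and S: "S \<in> sets borel" "measure \<mu> S \<le> 1/2"
  defines "u \<equiv> \<lambda>n x. complex_of_real (survival S n x)"
  shows "ip (u n) (u n) \<le> ((1 - G / 2) ^ n)\<^sup>2"
proof (induction n)
  case 0
  have "ip (ind S) (ind S) \<le> 1" using ip_ind[OF S(1)] S(2) by simp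
  then show ?case by (simp add: u_def ind_def[abs_def])
next
  case (Suc n)
  have u2: "u m \<in> L2_fun \<mu>" for m using survival_op[OF S(1)] by (auto simp: u_def simp del: survival.simps(2))
  have uS: "u (Suc n) x = indicator S x *\<^sub>R op (u n) x" for x using survival_op[OF S(1)] by (auto simp: u_def simp del: survival.simps(2))
  have supp: "u m x = 0" if "x \<notin> S" for m x using that by (cases m) (auto simp: u_def)
  let ?\<beta> = "1 - G / 2"
  have \<beta>: "0 < ?\<beta>" using G by simp
  have le: "ip (op (u m)) (u m) \<le> ?\<beta> * ip (u m) (u m)" for m
    by (rule killed_contraction[OF poincare G S u2 supp])
  have eq: "ip (op (u n)) (u (Suc n)) = ip (u (Suc n)) (u (Suc n))"
    unfolding ip_def uS by (intro Bochner_Integration.integral_cong refl) (auto split: split_indicator)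
  have "ip (u (Suc n)) (u (Suc n)) \<le> ?\<beta> * ip (op (u n)) (u n)"
    by (rule contraction[OF u2 u2 \<beta> eq le])
  also have "\<dots> \<le> ?\<beta> * (?\<beta> * ip (u n) (u n))" using le \<beta> by (intro mult_left_mono) auto
  also have "\<dots> \<le> ?\<beta> * (?\<beta> * (?\<beta> ^ n)\<^sup>2)" using Suc \<beta> by (intro mult_left_mono) auto
  finally show ?case by (simp add: power2_eq_square mult_ac)
qed

text \<open>The chain either has not moved, which has geometrically small probability, or its law is
  dominated by a multiple of \<open>\<mu>\<close>, to which the \<open>L\<^sub>2\<close> bound applies.\<close>

lemma survival_le:
  assumes poincare: "\<And>f. f \<in> L2_mean_zero \<mu> \<Longrightarrow> G * ip f f \<le> energy f" and G: "G \<le> 1"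
    and S: "S \<in> sets borel" "measure \<mu> S \<le> 1/2"
    and \<eta>: "0 \<le> \<eta>" "\<eta> \<le> 1/2" "\<eta> \<le> G / 2" "\<eta> \<le> p x"
  shows "survival S n x \<le> (1 - \<eta>) ^ n * (1 + 2 * real n * D x)"
proof -
  define u where "u n x = complex_of_real (survival S n x)" for n x
  have G0: "0 \<le> G" using \<eta> by simp
  have u2: "u n \<in> L2_fun \<mu>" for n using survival_op[OF S(1)] by (auto simp: u_def[abs_def] simp del: survival.simps(2))
  have uS: "u (Suc n) x = indicator S x *\<^sub>R op (u n) x" for x n
    using survival_op[OF S(1)] by (auto simp: u_def[abs_def] simp del: survival.simps(2))
  have D: "0 \<le> D x" using k_nonneg[of x x] k_le[of x x] by linarith
  have L1: "(LINT x|\<mu>. cmod (u n x)) \<le> (1 - \<eta>) ^ n" for n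
  proof -
    have "(LINT x|\<mu>. cmod (u n x)) \<le> sqrt (ip (u n) (u n))" by (rule L1_le_L2[OF u2])
    also have "\<dots> \<le> sqrt (((1 - G / 2) ^ n)\<^sup>2)"
      using survival_norm[OF poincare G0 G S, of n] by (simp only: u_def[abs_def] real_sqrt_le_iff)
    also have "\<dots> = (1 - G / 2) ^ n" using G by simp
    also have "\<dots> \<le> (1 - \<eta>) ^ n" using \<eta> G by (intro power_mono) auto
    finally show ?thesis .
  qed
  have "cmod (u n x) \<le> (1 - \<eta>) ^ n * (1 + 2 * real n * D x)"
  proof (induction n)
    case 0
    show ?case by (simp add: u_def split: split_indicator)
  next
    case (Suc n)
    have "cmod (u (Suc n) x) \<le> cmod (op (u n) x)" by (simp add: uS split: split_indicator)
    also have "\<dots> \<le> cmod (LINT y|\<mu>. k x y *\<^sub>R u n y) + (1 - p x) * cmod (u n x)"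
      unfolding op_def by (rule order_trans[OF norm_triangle_ineq]) (use p_le_1 in simp)
    also have "cmod (LINT y|\<mu>. k x y *\<^sub>R u n y) \<le> (LINT y|\<mu>. cmod (k x y *\<^sub>R u n y))" by (rule integral_norm_bound)
    also have "\<dots> \<le> (LINT y|\<mu>. D x * cmod (u n y))"
    proof (rule integral_mono)
      show "integrable \<mu> (\<lambda>y. cmod (k x y *\<^sub>R u n y))"
        using k_scaleR_integrable[OF L2_integrable[OF u2] L2_measurable[OF u2]] by (rule integrable_norm)
      show "integrable \<mu> (\<lambda>y. D x * cmod (u n y))" using L2_integrable[OF u2] by simp
      show "cmod (k x y *\<^sub>R u n y) \<le> D x * cmod (u n y)" for y
        by (simp add: k_nonneg k_le mult_right_mono)
    qed
    also have "\<dots> = D x * (LINT y|\<mu>. cmod (u n y))" by simp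
    also have "\<dots> \<le> D x * (1 - \<eta>) ^ n" using L1 D by (rule mult_left_mono)
    also have "(1 - p x) * cmod (u n x) \<le> (1 - \<eta>) * ((1 - \<eta>) ^ n * (1 + 2 * real n * D x))"
      using Suc \<eta> p_le_1[of x] by (intro mult_mono) auto
    \<comment> \<open>The moving part carries one power of \<open>1 - \<eta>\<close> too few. As
      \<open>\<eta> \<le> 1/2\<close> gives \<open>1 \<le> 2 * (1 - \<eta>)\<close>, a factor two
      makes up for it; this is the \<open>2\<close> in the conclusion.\<close>
    also have "D x * (1 - \<eta>) ^ n \<le> 2 * D x * ((1 - \<eta>) * (1 - \<eta>) ^ n)"
    proof -
      have "1 * (D x * (1 - \<eta>) ^ n) \<le> (2 * (1 - \<eta>)) * (D x * (1 - \<eta>) ^ n)"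
        using \<eta> D by (intro mult_right_mono) auto
      then show ?thesis by (simp only: mult_ac mult_1)
    qed
    finally show ?case by (simp add: algebra_simps)
  qed
  moreover have "survival S n x \<le> cmod (u n x)" by (simp add: u_def)
  ultimately show ?thesis by linarith
qed

end

section \<open>Random walk Metropolis kernels\<close>

text \<open>If \<open>k x y\<close> is the integral over \<open>\<omega>\<close> of
  \<open>\<Gamma> x \<omega> * \<Gamma> y \<omega>\<close>, then by Fubini the form is the integral
  over \<open>\<omega>\<close> of the square of the integral of
  \<open>\<Gamma> x \<omega> * \<phi> x\<close>. Nonnegativity of \<open>\<Gamma>\<close> makes the
  absolute value of the integrand integrate back to \<open>k\<close>, so \<open>int\<close> already
  justifies the exchange.\<close>

lemma psd_of_factorization:
  fixes \<Gamma> :: "'a \<Rightarrow> 'b \<Rightarrow> real" and \<phi> :: "'a \<Rightarrow> real"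
  assumes M: "sigma_finite_measure M" and N: "sigma_finite_measure N"
    and \<Gamma>[measurable]: "case_prod \<Gamma> \<in> borel_measurable (M \<Otimes>\<^sub>M N)"
    and \<phi>[measurable]: "\<phi> \<in> borel_measurable M"
    and nonneg: "\<And>x \<omega>. 0 \<le> \<Gamma> x \<omega>" "\<And>x y. 0 \<le> k x y"
    and k: "\<And>x y. x \<in> space M \<Longrightarrow> y \<in> space M \<Longrightarrow> (\<integral>\<^sup>+\<omega>. ennreal (\<Gamma> x \<omega> * \<Gamma> y \<omega>) \<partial>N) = ennreal (k x y)"
    and int: "integrable (M \<Otimes>\<^sub>M M) (\<lambda>z. k (fst z) (snd z) * (\<phi> (fst z) * \<phi> (snd z)))"
  shows "0 \<le> (LINT z|(M \<Otimes>\<^sub>M M). k (fst z) (snd z) * (\<phi> (fst z) * \<phi> (snd z)))"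
proof -
  interpret M: sigma_finite_measure M by (rule M)
  interpret N: sigma_finite_measure N by (rule N)
  interpret MM: pair_sigma_finite M M ..
  interpret S: sigma_finite_measure "M \<Otimes>\<^sub>M M" by (rule MM.sigma_finite_measure_axioms)
  interpret P: pair_sigma_finite "M \<Otimes>\<^sub>M M" N ..
  have [measurable]: "(\<lambda>z. \<Gamma> (fst (fst z)) (snd z)) \<in> borel_measurable ((M \<Otimes>\<^sub>M M) \<Otimes>\<^sub>M N)"
    "(\<lambda>z. \<Gamma> (snd (fst z)) (snd z)) \<in> borel_measurable ((M \<Otimes>\<^sub>M M) \<Otimes>\<^sub>M N)"
    using measurable_compose[OF _ \<Gamma>, of "\<lambda>z. (fst (fst z), snd z)" "(M \<Otimes>\<^sub>M M) \<Otimes>\<^sub>M N"]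
      measurable_compose[OF _ \<Gamma>, of "\<lambda>z. (snd (fst z), snd z)" "(M \<Otimes>\<^sub>M M) \<Otimes>\<^sub>M N"] by simp_all
  have [measurable]: "\<Gamma> x \<in> borel_measurable N" if "x \<in> space M" for x
    using measurable_compose[OF measurable_Pair1'[OF that, of N] \<Gamma>] by simp
  define H where "H z \<omega> = \<Gamma> (fst z) \<omega> * \<Gamma> (snd z) \<omega> * (\<phi> (fst z) * \<phi> (snd z))" for z \<omega>
  have H[measurable]: "case_prod H \<in> borel_measurable ((M \<Otimes>\<^sub>M M) \<Otimes>\<^sub>M N)"
    unfolding H_def by (simp add: case_prod_beta') measurable
  have i\<Gamma>: "integrable N (\<lambda>\<omega>. \<Gamma> x \<omega> * \<Gamma> y \<omega>)" "(LINT \<omega>|N. \<Gamma> x \<omega> * \<Gamma> y \<omega>) = k x y"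
    if "x \<in> space M" "y \<in> space M" for x y
  proof -
    show "integrable N (\<lambda>\<omega>. \<Gamma> x \<omega> * \<Gamma> y \<omega>)"
      using that k[OF that] by (intro integrableI_nonneg) (auto simp: nonneg)
    show "(LINT \<omega>|N. \<Gamma> x \<omega> * \<Gamma> y \<omega>) = k x y"
      using that k[OF that] by (intro integral_eq_nn_integral[THEN trans]) (auto simp: nonneg)
  qed
  have Hint: "integrable ((M \<Otimes>\<^sub>M M) \<Otimes>\<^sub>M N) (case_prod H)"
  proof (rule P.Fubini_integrable)
    show "AE z in M \<Otimes>\<^sub>M M. integrable N (\<lambda>\<omega>. case_prod H (z, \<omega>))"
      using i\<Gamma>(1) by (intro AE_I2) (auto simp: H_def space_pair_measure)
    have eq: "(LINT \<omega>|N. norm (case_prod H (z, \<omega>))) = norm (k (fst z) (snd z) * (\<phi> (fst z) * \<phi> (snd z)))"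
      if "z \<in> space (M \<Otimes>\<^sub>M M)" for z
      using that i\<Gamma> by (auto simp: H_def abs_mult nonneg space_pair_measure)
    have "integrable (M \<Otimes>\<^sub>M M) (\<lambda>z. LINT \<omega>|N. norm (case_prod H (z, \<omega>)))
        \<longleftrightarrow> integrable (M \<Otimes>\<^sub>M M) (\<lambda>z. norm (k (fst z) (snd z) * (\<phi> (fst z) * \<phi> (snd z))))"
      by (rule Bochner_Integration.integrable_cong[OF refl eq])
    then show "integrable (M \<Otimes>\<^sub>M M) (\<lambda>z. LINT \<omega>|N. norm (case_prod H (z, \<omega>)))"
      using integrable_norm[OF int] by (rule iffD2)
  qed measurable
  have "(LINT z|(M \<Otimes>\<^sub>M M). k (fst z) (snd z) * (\<phi> (fst z) * \<phi> (snd z))) = (LINT z|(M \<Otimes>\<^sub>M M). LINT \<omega>|N. H z \<omega>)"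
    by (intro Bochner_Integration.integral_cong refl) (use i\<Gamma> in \<open>auto simp: H_def space_pair_measure\<close>)
  also have "\<dots> = (LINT \<omega>|N. LINT z|(M \<Otimes>\<^sub>M M). H z \<omega>)"
    by (rule P.Fubini_integral[OF Hint, symmetric])
  also have "0 \<le> \<dots>"
  proof (rule integral_nonneg_AE)
    have "AE \<omega> in N. integrable (M \<Otimes>\<^sub>M M) (\<lambda>z. H z \<omega>)"
      using P.AE_integrable_snd[OF Hint] .
    then show "AE \<omega> in N. 0 \<le> (LINT z|(M \<Otimes>\<^sub>M M). H z \<omega>)"
    proof eventually_elim
      case (elim \<omega>)
      have "(LINT z|(M \<Otimes>\<^sub>M M). H z \<omega>) = (LINT x|M. LINT y|M. H (x, y) \<omega>)"
        using MM.integral_fst'[OF elim] by simp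
      also have "\<dots> = (LINT x|M. \<Gamma> x \<omega> * \<phi> x * (LINT y|M. \<Gamma> y \<omega> * \<phi> y))"
        by (intro Bochner_Integration.integral_cong refl) (simp add: H_def mult_ac flip: integral_mult_right_zero)
      also have "\<dots> = (LINT y|M. \<Gamma> y \<omega> * \<phi> y)\<^sup>2" by (simp add: power2_eq_square)
      finally show ?case by simp
    qed
  qed
  finally show ?thesis .
qed

lemma normal_density_le_peak: "0 < \<sigma> \<Longrightarrow> normal_density 0 \<sigma> e \<le> normal_density 0 \<sigma> 0"
  unfolding normal_density_def by (intro mult_left_mono) auto

lemma normal_density_uminus: "normal_density 0 \<sigma> (- e) = normal_density 0 \<sigma> e"
  by (simp add: normal_density_def)

lemma normal_density_convolution_square:
  assumes "0 < \<sigma>"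
  shows "(\<integral>\<^sup>+w. ennreal (normal_density 0 (\<sigma> / sqrt 2) (x - w) * normal_density 0 (\<sigma> / sqrt 2) (y - w)) \<partial>lborel)
    = ennreal (normal_density 0 \<sigma> (y - x))"
proof -
  let ?g = "normal_density 0 (\<sigma> / sqrt 2)"
  have "(\<integral>\<^sup>+w. ennreal (?g (x - w) * ?g (y - w)) \<partial>lborel) = ennreal \<bar>1\<bar> * (\<integral>\<^sup>+w. ennreal (?g (x - (x + 1 * w)) * ?g (y - (x + 1 * w))) \<partial>lborel)"
    by (rule nn_integral_real_affine) auto
  also have "\<dots> = (\<integral>\<^sup>+w. ennreal (?g ((y - x) - w) * ?g w) \<partial>lborel)"
    by (simp add: normal_density_uminus mult.commute diff_diff_eq)
  also have "\<dots> = ennreal (normal_density 0 (sqrt ((\<sigma> / sqrt 2)\<^sup>2 + (\<sigma> / sqrt 2)\<^sup>2)) (y - x))"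
    using fun_cong[OF conv_normal_density_zero_mean[of "\<sigma> / sqrt 2" "\<sigma> / sqrt 2"], of "y - x"] assms by simp
  also have "sqrt ((\<sigma> / sqrt 2)\<^sup>2 + (\<sigma> / sqrt 2)\<^sup>2) = \<sigma>" using assms by (simp add: power_divide)
  finally show ?thesis .
qed

section \<open>The Metropolis kernel of a positive density\<close>

locale rwm_target =
  fixes \<sigma> :: real and \<rho> :: "real \<Rightarrow> real"
  assumes \<sigma>_pos: "0 < \<sigma>" and \<rho>_measurable[measurable]: "\<rho> \<in> borel_measurable borel"
    and \<rho>_pos: "0 < \<rho> x" and \<rho>_total: "(\<integral>\<^sup>+x. ennreal (\<rho> x) \<partial>lborel) = 1"
begin

definition target :: "real measure" where "target = density lborel (\<lambda>x. ennreal (\<rho> x))"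

text \<open>Accepted moves have Lebesgue density \<open>normal_density 0 \<sigma> (y - x) * min 1
  (\<rho> y / \<rho> x)\<close>. Dividing by \<open>\<rho> y\<close>, to obtain the density with
  respect to the target, turns the minimum into a symmetric maximum in the denominator.\<close>

definition rwm_density :: "real \<Rightarrow> real \<Rightarrow> real" where
  "rwm_density x y = normal_density 0 \<sigma> (y - x) / max (\<rho> x) (\<rho> y)"

definition rwm_bound :: "real \<Rightarrow> real" where "rwm_bound x = normal_density 0 \<sigma> 0 / \<rho> x"

lemma sets_target[measurable_cong, simp]: "sets target = sets borel" by (simp add: target_def)

lemma prob_space_target: "prob_space target"
  by (rule prob_spaceI) (simp add: target_def emeasure_density \<rho>_total)

lemma rwm_density_measurable[measurable]: "case_prod rwm_density \<in> borel_measurable (borel \<Otimes>\<^sub>M borel)"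
  unfolding rwm_density_def by measurable

lemma rwm_density_nonneg: "0 \<le> rwm_density x y"
  using \<rho>_pos[of x] by (simp add: rwm_density_def le_max_iff_disj less_imp_le)

lemma rwm_density_sym: "rwm_density x y = rwm_density y x"
  unfolding rwm_density_def using normal_density_uminus[of \<sigma> "y - x"] by (simp add: max.commute)

lemma rwm_density_le: "rwm_density x y \<le> rwm_bound x"
  unfolding rwm_density_def rwm_bound_def using \<rho>_pos[of x] normal_density_le_peak[OF \<sigma>_pos]
  by (intro frac_le) auto

lemma \<rho>_rwm_density: "\<rho> y * rwm_density x y = normal_density 0 \<sigma> (y - x) * min 1 (\<rho> y / \<rho> x)"
  using \<rho>_pos[of x] \<rho>_pos[of y] by (auto simp: rwm_density_def max_def min_def field_simps)

lemma integral_target: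
  fixes f :: "real \<Rightarrow> 'b::{banach, second_countable_topology}"
  assumes "f \<in> borel_measurable borel"
  shows "(LINT x|target. f x) = (LINT x|lborel. \<rho> x *\<^sub>R f x)"
    and "integrable target f \<longleftrightarrow> integrable lborel (\<lambda>x. \<rho> x *\<^sub>R f x)"
  using assms unfolding target_def
  by (auto simp: integral_density integrable_density \<rho>_pos less_imp_le)

lemma rwm_density_mass_le: "(LINT y|target. rwm_density x y) \<le> 1"
proof -
  have nd: "(\<lambda>y. normal_density 0 \<sigma> (y - x)) = normal_density x \<sigma>" by (rule ext) (simp add: normal_density_def)
  have i: "integrable lborel (\<lambda>y. normal_density 0 \<sigma> (y - x))"
    using integrable_normal_density[OF \<sigma>_pos, of x] unfolding nd .
  have e: "(LINT y|lborel. normal_density 0 \<sigma> (y - x)) = 1"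
    using integral_normal_density[OF \<sigma>_pos, of x] unfolding nd .
  have "(LINT y|target. rwm_density x y) = (LINT y|lborel. \<rho> y *\<^sub>R rwm_density x y)"
    by (rule integral_target) measurable
  also have "\<dots> \<le> (LINT y|lborel. normal_density 0 \<sigma> (y - x))"
  proof (rule integral_mono')
    show "\<rho> y *\<^sub>R rwm_density x y \<le> normal_density 0 \<sigma> (y - x)" for y
      by (simp add: \<rho>_rwm_density mult_left_le)
  qed (use i rwm_density_nonneg \<rho>_pos in \<open>auto simp: less_imp_le\<close>)
  finally show ?thesis using e by simp
qed

text \<open>\<open>1 / max (\<rho> x) (\<rho> y)\<close> is the length of the intersection of the
  intervals from \<open>0\<close> to \<open>1 / \<rho> x\<close> and from \<open>0\<close> to
  \<open>1 / \<rho> y\<close>, hence an integral of a product of indicators. The second coordinate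
  of \<open>\<omega>\<close> is the midpoint of a proposal split into two independent steps of
  standard deviation \<open>\<sigma> / sqrt 2\<close>.\<close>

lemma rwm_density_factor:
  "(\<integral>\<^sup>+\<omega>. ennreal (((if 0 < fst \<omega> \<and> fst \<omega> < 1 / \<rho> x then 1 else 0) * normal_density 0 (\<sigma> / sqrt 2) (x - snd \<omega>))
      * ((if 0 < fst \<omega> \<and> fst \<omega> < 1 / \<rho> y then 1 else 0) * normal_density 0 (\<sigma> / sqrt 2) (y - snd \<omega>))) \<partial>lborel) = ennreal (rwm_density x y)"
proof -
  let ?g = "normal_density 0 (\<sigma> / sqrt 2)"
  let ?m = "min (1 / \<rho> x) (1 / \<rho> y)"
  have m: "0 < ?m" using \<rho>_pos by simp
  have "(\<integral>\<^sup>+\<omega>. ennreal (((if 0 < fst \<omega> \<and> fst \<omega> < 1 / \<rho> x then 1 else 0) * ?g (x - snd \<omega>)) * ((if 0 < fst \<omega> \<and> fst \<omega> < 1 / \<rho> y then 1 else 0) * ?g (y - snd \<omega>))) \<partial>lborel)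
      = (\<integral>\<^sup>+\<omega>. ennreal (indicator {0<..<?m} (fst \<omega>)) * ennreal (?g (x - snd \<omega>) * ?g (y - snd \<omega>)) \<partial>(lborel \<Otimes>\<^sub>M lborel))"
    unfolding lborel_prod
    by (intro nn_integral_cong) (auto split: split_indicator simp: ennreal_mult''[symmetric])
  also have "\<dots> = (\<integral>\<^sup>+t. \<integral>\<^sup>+w. ennreal (indicator {0<..<?m} t) * ennreal (?g (x - w) * ?g (y - w)) \<partial>lborel \<partial>lborel)"
    by (subst lborel.nn_integral_fst[symmetric]) auto
  also have "\<dots> = (\<integral>\<^sup>+t. ennreal (indicator {0<..<?m} t) * ennreal (normal_density 0 \<sigma> (y - x)) \<partial>lborel)"
    by (subst nn_integral_cmult) (auto simp: normal_density_convolution_square[OF \<sigma>_pos])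
  also have "\<dots> = (\<integral>\<^sup>+t. indicator {0<..<?m} t \<partial>lborel) * ennreal (normal_density 0 \<sigma> (y - x))"
    by (subst nn_integral_multc) (auto simp: ennreal_indicator)
  also have "(\<integral>\<^sup>+t. indicator {0<..<?m} t \<partial>lborel) = ennreal ?m" using m by simp
  also have "ennreal ?m * ennreal (normal_density 0 \<sigma> (y - x)) = ennreal (rwm_density x y)"
    using m \<rho>_pos[of x] \<rho>_pos[of y] by (subst ennreal_mult[symmetric]) (auto simp: rwm_density_def max_def min_def field_simps)
  finally show ?thesis .
qed

lemma rwm_density_pos_real:
  assumes [measurable]: "\<phi> \<in> borel_measurable borel"
    and int: "integrable (target \<Otimes>\<^sub>M target) (\<lambda>z. rwm_density (fst z) (snd z) * (\<phi> (fst z) * \<phi> (snd z)))"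
  shows "0 \<le> (LINT z|(target \<Otimes>\<^sub>M target). rwm_density (fst z) (snd z) * (\<phi> (fst z) * \<phi> (snd z)))"
proof (rule psd_of_factorization[OF _ _ _ _ _ rwm_density_nonneg rwm_density_factor int])
  show "sigma_finite_measure target"
    using prob_space_target by (simp add: prob_space_imp_sigma_finite)
  show "sigma_finite_measure (lborel :: (real \<times> real) measure)" by (rule sigma_finite_lborel)
  have "sets (lborel :: (real \<times> real) measure) = sets (borel \<Otimes>\<^sub>M borel)"
    by (simp only: sets_lborel borel_prod)
  then have sets: "sets (target \<Otimes>\<^sub>M (lborel :: (real \<times> real) measure)) = sets (borel \<Otimes>\<^sub>M (borel \<Otimes>\<^sub>M borel))"
    by (intro sets_pair_measure_cong sets_target)
  show "(\<lambda>(x, \<omega>). (if 0 < fst \<omega> \<and> fst \<omega> < 1 / \<rho> x then 1 else 0) * normal_density 0 (\<sigma> / sqrt 2) (x - snd \<omega>))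
      \<in> borel_measurable (target \<Otimes>\<^sub>M (lborel :: (real \<times> real) measure))"
    unfolding measurable_cong_sets[OF sets refl] by measurable
qed auto

lemma rwm_map_measurable:
  "(\<lambda>(e, u). if u < \<rho> (x + e) / \<rho> x then x + e else x)
    \<in> (density lborel (\<lambda>e. ennreal (normal_density 0 \<sigma> e)) \<Otimes>\<^sub>M uniform_measure lborel {0..1::real}) \<rightarrow>\<^sub>M borel"
proof -
  have sets: "sets (density lborel (\<lambda>e. ennreal (normal_density 0 \<sigma> e)) \<Otimes>\<^sub>M uniform_measure lborel {0..1::real})
      = sets (borel \<Otimes>\<^sub>M borel)"
    by (intro sets_pair_measure_cong) auto
  show ?thesis unfolding measurable_cong_sets[OF sets refl] by measurable
qed

lemma prob_space_increment: "prob_space (density lborel (\<lambda>e. ennreal (normal_density 0 \<sigma> e)))"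
  by (rule prob_space_normal_density[OF \<sigma>_pos])

lemma prob_space_unit_interval: "prob_space (uniform_measure lborel {0..1::real})"
  by (rule prob_space_uniform_measure) auto

lemma rwm_prob: "prob_space (rwm_kernel \<sigma> \<rho> x)"
proof -
  interpret N: prob_space "density lborel (\<lambda>e. ennreal (normal_density 0 \<sigma> e))" by (rule prob_space_increment)
  interpret U: prob_space "uniform_measure lborel {0..1::real}" by (rule prob_space_unit_interval)
  interpret P: pair_prob_space "density lborel (\<lambda>e. ennreal (normal_density 0 \<sigma> e))" "uniform_measure lborel {0..1::real}" ..
  show ?thesis
    unfolding rwm_kernel_def using rwm_map_measurable by (rule P.prob_space_distr)
qed

lemma rwm_sets: "sets (rwm_kernel \<sigma> \<rho> x) = sets borel"
  by (simp add: rwm_kernel_def)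

lemma integral_threshold:
  fixes c d :: "'b::{banach, second_countable_topology}"
  assumes "0 \<le> \<alpha>"
  shows "(LINT u|uniform_measure lborel {0..1::real}. (if u < \<alpha> then c else d)) = min 1 \<alpha> *\<^sub>R c + (1 - min 1 \<alpha>) *\<^sub>R d"
proof -
  interpret U: prob_space "uniform_measure lborel {0..1::real}" by (rule prob_space_unit_interval)
  let ?U = "uniform_measure lborel {0..1::real}"
  have "{0..1} \<inter> {..<\<alpha>} = (if \<alpha> \<le> 1 then {0..<\<alpha>} else {0..1})" by auto
  then have m: "measure ?U {..<\<alpha>} = min 1 \<alpha>"
    using assms by (subst measure_uniform_measure) (auto simp: min_def)
  have eq: "(if u < \<alpha> then c else d) = d + indicator {..<\<alpha>} u *\<^sub>R (c - d)" for u
    by (simp split: split_indicator)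
  have i: "integrable ?U (\<lambda>u. indicator {..<\<alpha>} u :: real)"
    by (rule U.integrable_const_bound[where B = 1]) (auto split: split_indicator)
  have "(LINT u|?U. (if u < \<alpha> then c else d)) = d + measure ?U {..<\<alpha>} *\<^sub>R (c - d)"
    unfolding eq using i by (simp add: U.prob_space[simplified])
  then show ?thesis by (simp add: m algebra_simps)
qed

text \<open>Integrating out the uniform variable first replaces the comparison by the acceptance
  probability \<open>min 1 (\<rho> (x + e) / \<rho> x)\<close>; the translation
  \<open>y = x + e\<close> then yields the density. Boundedness of \<open>rwm_density x\<close>
  makes integrability of \<open>f\<close> under the target sufficient, at every
  \<open>x\<close>.\<close>

lemma rwm_integral:
  assumes f: "f \<in> L2_fun target"
  shows "(LINT y|rwm_kernel \<sigma> \<rho> x. f y) = (LINT y|target. rwm_density x y *\<^sub>R f y) + (1 - (LINT y|target. rwm_density x y)) *\<^sub>R f x"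
proof -
  let ?q = "normal_density 0 \<sigma>"
  let ?N = "density lborel (\<lambda>e. ennreal (?q e))"
  let ?U = "uniform_measure lborel {0..1::real}"
  interpret T: prob_space target by (rule prob_space_target)
  interpret N: prob_space ?N by (rule prob_space_increment)
  interpret U: prob_space ?U by (rule prob_space_unit_interval)
  interpret P: pair_prob_space ?N ?U ..
  let ?h = "\<lambda>(e, u). if u < \<rho> (x + e) / \<rho> x then x + e else x"
  have [measurable]: "f \<in> borel_measurable borel"
    using f measurable_cong_sets[OF sets_target refl, of borel] by (auto simp: L2_fun_def)
  have fi: "integrable target f" by (rule T.integrable_of_L2_fun[OF f])
  define a where "a e = min 1 (\<rho> (x + e) / \<rho> x)" for e
  have a: "0 \<le> a e" "a e \<le> 1" for e using \<rho>_pos[of x] \<rho>_pos[of "x + e"] by (auto simp: a_def)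
  have [measurable]: "a \<in> borel_measurable borel" unfolding a_def by measurable
  have shift: "(LINT y|lborel. \<rho> y *\<^sub>R (rwm_density x y *\<^sub>R \<phi> y)) = (LINT e|lborel. ?q e *\<^sub>R (a e *\<^sub>R \<phi> (x + e)))"
    "integrable lborel (\<lambda>e. ?q e *\<^sub>R (a e *\<^sub>R \<phi> (x + e)))" if "integrable target (\<lambda>y. rwm_density x y *\<^sub>R \<phi> y)" "\<phi> \<in> borel_measurable borel"
    for \<phi> :: "real \<Rightarrow> 'c::{banach, second_countable_topology}"
  proof -
    have [measurable]: "\<phi> \<in> borel_measurable borel" by fact
    have i: "integrable lborel (\<lambda>y. \<rho> y *\<^sub>R (rwm_density x y *\<^sub>R \<phi> y))"
      using that(1) by (subst (asm) integral_target(2)) auto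
    have e: "\<rho> (x + 1 * e) *\<^sub>R (rwm_density x (x + 1 * e) *\<^sub>R \<phi> (x + 1 * e)) = ?q e *\<^sub>R (a e *\<^sub>R \<phi> (x + e))" for e
      using \<rho>_rwm_density[of "x + e" x] by (simp add: a_def mult_ac)
    show "(LINT y|lborel. \<rho> y *\<^sub>R (rwm_density x y *\<^sub>R \<phi> y)) = (LINT e|lborel. ?q e *\<^sub>R (a e *\<^sub>R \<phi> (x + e)))"
      using lborel_integral_real_affine[of 1 "\<lambda>y. \<rho> y *\<^sub>R (rwm_density x y *\<^sub>R \<phi> y)" x] unfolding e by simp
    show "integrable lborel (\<lambda>e. ?q e *\<^sub>R (a e *\<^sub>R \<phi> (x + e)))"
      using lborel_integrable_real_affine[OF i, of 1 x] unfolding e by simp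
  qed
  have kint: "integrable target (\<lambda>y. rwm_density x y *\<^sub>R \<phi> y)" if "integrable target \<phi>" "\<phi> \<in> borel_measurable borel"
    for \<phi> :: "real \<Rightarrow> 'c::{banach, second_countable_topology}"
  proof (rule Bochner_Integration.integrable_bound)
    have [measurable]: "\<phi> \<in> borel_measurable borel" by fact
    show "integrable target (\<lambda>y. rwm_bound x * norm (\<phi> y))" using that by simp
    show "(\<lambda>y. rwm_density x y *\<^sub>R \<phi> y) \<in> borel_measurable target" by measurable
    show "AE y in target. norm (rwm_density x y *\<^sub>R \<phi> y) \<le> norm (rwm_bound x * norm (\<phi> y))"
    proof (rule AE_I2)
      fix y
      have "norm (rwm_density x y *\<^sub>R \<phi> y) = rwm_density x y * norm (\<phi> y)" by (simp add: rwm_density_nonneg)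
      also have "\<dots> \<le> rwm_bound x * norm (\<phi> y)" by (rule mult_right_mono[OF rwm_density_le]) simp
      also have "\<dots> \<le> norm (rwm_bound x * norm (\<phi> y))" by simp
      finally show "norm (rwm_density x y *\<^sub>R \<phi> y) \<le> norm (rwm_bound x * norm (\<phi> y))" .
    qed
  qed
  have iN: "integrable ?N g \<longleftrightarrow> integrable lborel (\<lambda>e. ?q e *\<^sub>R g e)" "(LINT e|?N. g e) = (LINT e|lborel. ?q e *\<^sub>R g e)"
    if "g \<in> borel_measurable borel" for g :: "real \<Rightarrow> 'c::{banach, second_countable_topology}"
    using that by (auto simp: integrable_density integral_density)
  \<comment> \<open>The codomain is left general because the fact is used at \<open>f\<close>, at
    \<open>cmod (f y)\<close> for absolute integrability, and at the constant \<open>1\<close> for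
    the acceptance mass.\<close>
  have ia: "integrable ?N (\<lambda>e. a e *\<^sub>R \<phi> (x + e))" "(LINT e|?N. a e *\<^sub>R \<phi> (x + e)) = (LINT y|target. rwm_density x y *\<^sub>R \<phi> y)"
    if "integrable target \<phi>" "\<phi> \<in> borel_measurable borel" for \<phi> :: "real \<Rightarrow> 'c::{banach, second_countable_topology}"
  proof -
    have [measurable]: "\<phi> \<in> borel_measurable borel" by fact
    show "integrable ?N (\<lambda>e. a e *\<^sub>R \<phi> (x + e))"
      using shift(2)[OF kint[OF that] that(2)] by (subst iN) auto
    show "(LINT e|?N. a e *\<^sub>R \<phi> (x + e)) = (LINT y|target. rwm_density x y *\<^sub>R \<phi> y)"
      using shift(1)[OF kint[OF that] that(2)] by (subst iN(2)) (auto simp: integral_target(1))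
  qed
  have inta: "integrable ?N a" "(LINT e|?N. a e) = (LINT y|target. rwm_density x y)"
    using ia[of "\<lambda>_. 1::real"] by auto
  have thr: "(LINT u|?U. (if u < \<rho> (x + e) / \<rho> x then c else d)) = a e *\<^sub>R c + (1 - a e) *\<^sub>R d"
    for e and c d :: "'c::{banach, second_countable_topology}"
    unfolding a_def by (rule integral_threshold) (use \<rho>_pos[of x] \<rho>_pos[of "x + e"] in auto)
  have m: "(\<lambda>z. f (?h z)) \<in> borel_measurable (?N \<Otimes>\<^sub>M ?U)"
    by (rule measurable_compose[OF rwm_map_measurable]) measurable
  have int: "integrable (?N \<Otimes>\<^sub>M ?U) (\<lambda>z. f (?h z))"
  proof (rule P.Fubini_integrable[OF m])
    have "integrable ?N (\<lambda>e. a e *\<^sub>R cmod (f (x + e)) + (1 - a e) *\<^sub>R cmod (f x))"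
      using ia(1)[of "\<lambda>y. cmod (f y)"] fi inta(1) by (intro Bochner_Integration.integrable_add) auto
    moreover have "(LINT u|?U. norm (f (?h (e, u)))) = a e *\<^sub>R cmod (f (x + e)) + (1 - a e) *\<^sub>R cmod (f x)" for e
      by (simp only: thr[symmetric] split) (auto intro!: Bochner_Integration.integral_cong)
    ultimately show "integrable ?N (\<lambda>e. LINT u|?U. norm (f (?h (e, u))))" by (simp only:)
    show "AE e in ?N. integrable ?U (\<lambda>u. f (?h (e, u)))"
    proof (rule AE_I2)
      fix e show "integrable ?U (\<lambda>u. f (?h (e, u)))"
        by (rule U.integrable_const_bound[where B = "cmod (f x) + cmod (f (x + e))"]) auto
    qed
  qed
  have "(LINT y|rwm_kernel \<sigma> \<rho> x. f y) = (LINT z|(?N \<Otimes>\<^sub>M ?U). f (?h z))"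
    unfolding rwm_kernel_def by (rule integral_distr[OF rwm_map_measurable]) measurable
  also have "\<dots> = (LINT e|?N. LINT u|?U. f (?h (e, u)))" by (rule P.integral_fst'[OF int, symmetric])
  also have "\<dots> = (LINT e|?N. a e *\<^sub>R f (x + e) + (1 - a e) *\<^sub>R f x)"
    by (simp only: thr[symmetric] split) (auto intro!: Bochner_Integration.integral_cong)
  also have "\<dots> = (LINT e|?N. a e *\<^sub>R f (x + e)) + (1 - (LINT e|?N. a e)) *\<^sub>R f x"
    using ia(1)[OF fi] inta(1) by (simp add: scaleR_left_diff_distrib N.prob_space[simplified])
  finally show ?thesis using ia(2)[OF fi] inta(2) by simp
qed

text \<open>The kernel is real, so the real and imaginary parts of \<open>f\<close> contribute
  separately.\<close>

lemma rwm_density_pos: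
  assumes f: "f \<in> L2_fun target"
  shows "0 \<le> (LINT z|(target \<Otimes>\<^sub>M target). rwm_density (fst z) (snd z) * (f (snd z) \<bullet> f (fst z)))"
proof -
  interpret T: prob_space target by (rule prob_space_target)
  interpret TT: pair_prob_space target target ..
  have sets2: "sets (target \<Otimes>\<^sub>M target) = sets (borel \<Otimes>\<^sub>M borel)" by (intro sets_pair_measure_cong sets_target)
  have [measurable]: "f \<in> borel_measurable borel"
    using f measurable_cong_sets[OF sets_target refl, of borel] by (auto simp: L2_fun_def)
  have f2: "integrable target (\<lambda>x. (cmod (f x))\<^sup>2)" using f by (simp add: L2_fun_def)
  have ki: "integrable target (rwm_density x)" for x
    by (rule T.integrable_const_bound[where B = "rwm_bound x"]) (auto simp: rwm_density_nonneg rwm_density_le)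
  have km: "(\<lambda>z. rwm_density (fst z) (snd z)) \<in> borel_measurable (borel \<Otimes>\<^sub>M borel)"
    using rwm_density_measurable by (simp add: case_prod_beta')
  have one: "integrable (target \<Otimes>\<^sub>M target) (\<lambda>z. rwm_density (fst z) (snd z) * (cmod (f (fst z)))\<^sup>2)"
  proof (rule TT.Fubini_integrable)
    show "(\<lambda>z. rwm_density (fst z) (snd z) * (cmod (f (fst z)))\<^sup>2) \<in> borel_measurable (target \<Otimes>\<^sub>M target)"
      unfolding measurable_cong_sets[OF sets2 refl] using km by measurable
    have "integrable target (\<lambda>x. (LINT y|target. rwm_density x y) * (cmod (f x))\<^sup>2)"
      by (rule Bochner_Integration.integrable_bound[OF f2])
        (auto simp: abs_mult rwm_density_nonneg rwm_density_mass_le intro!: mult_left_le_one_le)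
    then show "integrable target (\<lambda>x. LINT y|target. norm (rwm_density (fst (x, y)) (snd (x, y)) * (cmod (f (fst (x, y))))\<^sup>2))"
      by (simp add: abs_mult rwm_density_nonneg)
  qed (use ki in auto)
  have two: "integrable (target \<Otimes>\<^sub>M target) (\<lambda>z. rwm_density (fst z) (snd z) * (cmod (f (snd z)))\<^sup>2)"
    using TT.integrable_product_swap[OF one] by (simp add: case_prod_beta' rwm_density_sym)
  have \<phi>: "integrable (target \<Otimes>\<^sub>M target) (\<lambda>z. rwm_density (fst z) (snd z) * (\<phi> (fst z) * \<phi> (snd z)))"
    if [measurable]: "\<phi> \<in> borel_measurable borel" and le: "\<And>x. \<bar>\<phi> x\<bar> \<le> cmod (f x)" for \<phi>
  proof (rule Bochner_Integration.integrable_bound[OF Bochner_Integration.integrable_add[OF one two]])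
    show "(\<lambda>z. rwm_density (fst z) (snd z) * (\<phi> (fst z) * \<phi> (snd z))) \<in> borel_measurable (target \<Otimes>\<^sub>M target)"
      unfolding measurable_cong_sets[OF sets2 refl] using km by measurable
    show "AE z in target \<Otimes>\<^sub>M target. norm (rwm_density (fst z) (snd z) * (\<phi> (fst z) * \<phi> (snd z)))
      \<le> norm (rwm_density (fst z) (snd z) * (cmod (f (fst z)))\<^sup>2 + rwm_density (fst z) (snd z) * (cmod (f (snd z)))\<^sup>2)"
    proof (rule AE_I2)
      fix z :: "real \<times> real"
      define a b where "a = cmod (f (fst z))" and "b = cmod (f (snd z))"
      have ab: "0 \<le> a * b" by (simp add: a_def b_def)
      have "\<bar>\<phi> (fst z) * \<phi> (snd z)\<bar> \<le> a * b"
        unfolding abs_mult a_def b_def by (intro mult_mono le) auto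
      also have "\<dots> \<le> a\<^sup>2 + b\<^sup>2" using sum_squares_bound[of a b] ab by linarith
      finally have "rwm_density (fst z) (snd z) * \<bar>\<phi> (fst z) * \<phi> (snd z)\<bar> \<le> rwm_density (fst z) (snd z) * (a\<^sup>2 + b\<^sup>2)"
        by (rule mult_left_mono[OF _ rwm_density_nonneg])
      then show "norm (rwm_density (fst z) (snd z) * (\<phi> (fst z) * \<phi> (snd z)))
        \<le> norm (rwm_density (fst z) (snd z) * (cmod (f (fst z)))\<^sup>2 + rwm_density (fst z) (snd z) * (cmod (f (snd z)))\<^sup>2)"
        by (simp add: abs_mult rwm_density_nonneg a_def b_def distrib_left)
    qed
  qed
  have Re: "(\<lambda>x. Re (f x)) \<in> borel_measurable borel" "\<And>x. \<bar>Re (f x)\<bar> \<le> cmod (f x)" by (auto simp: abs_Re_le_cmod)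
  have Im: "(\<lambda>x. Im (f x)) \<in> borel_measurable borel" "\<And>x. \<bar>Im (f x)\<bar> \<le> cmod (f x)" by (auto simp: abs_Im_le_cmod)
  have "(LINT z|(target \<Otimes>\<^sub>M target). rwm_density (fst z) (snd z) * (f (snd z) \<bullet> f (fst z)))
      = (LINT z|(target \<Otimes>\<^sub>M target). rwm_density (fst z) (snd z) * (Re (f (fst z)) * Re (f (snd z))) + rwm_density (fst z) (snd z) * (Im (f (fst z)) * Im (f (snd z))))"
    by (intro Bochner_Integration.integral_cong refl) (simp add: inner_complex_def algebra_simps)
  also have "\<dots> = (LINT z|(target \<Otimes>\<^sub>M target). rwm_density (fst z) (snd z) * (Re (f (fst z)) * Re (f (snd z))))
      + (LINT z|(target \<Otimes>\<^sub>M target). rwm_density (fst z) (snd z) * (Im (f (fst z)) * Im (f (snd z))))"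
    by (rule Bochner_Integration.integral_add[OF \<phi>[OF Re] \<phi>[OF Im]])
  also have "0 \<le> \<dots>" by (intro add_nonneg_nonneg rwm_density_pos_real \<phi> Re Im)
  finally show ?thesis .
qed

sublocale reversible_kernel target rwm_density rwm_bound "rwm_kernel \<sigma> \<rho>"
  by (intro reversible_kernel.intro reversible_kernel_axioms.intro)
    (rule prob_space_target sets_target rwm_density_measurable rwm_density_nonneg rwm_density_sym rwm_density_le rwm_density_mass_le rwm_density_pos rwm_prob rwm_sets rwm_integral; assumption?)+

end

section \<open>Exit times of Markov chains\<close>

lemma enat_INF_attained:
  assumes "A \<noteq> {}" shows "\<exists>t\<in>A. (INF t\<in>A. enat t) = enat t"
proof -
  obtain a where "a \<in> A" using assms by blast
  then have "(LEAST x. x \<in> enat ` A) \<in> enat ` A" by (rule LeastI[of "\<lambda>x. x \<in> enat ` A", OF imageI])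
  then show ?thesis using assms by (auto simp: Inf_enat_def)
qed

lemma exit_time_cases:
  obtains "\<And>t. 0 < t \<Longrightarrow> X t \<omega> \<in> S" "exit_time X S \<omega> = \<infinity>"
  | t where "0 < t" "X t \<omega> \<notin> S" "exit_time X S \<omega> = enat t"
proof (cases "{t. t > 0 \<and> X t \<omega> \<notin> S} = {}")
  case True
  have "exit_time X S \<omega> = \<infinity>" unfolding exit_time_def True by (simp add: Inf_enat_def)
  then show ?thesis using True by (intro that(1)) blast+
next
  case False
  then show ?thesis using that(2) enat_INF_attained[OF False] by (auto simp: exit_time_def)
qed

lemma exit_time_le: "0 < t \<Longrightarrow> X t \<omega> \<notin> S \<Longrightarrow> exit_time X S \<omega> \<le> enat t"
  unfolding exit_time_def by (intro INF_lower) auto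

text \<open>The infimum over a nonempty set of times is attained and the logarithm is monotone, so
  the event is a countable union over times. An infinite exit time satisfies neither side.
  Measurability of the event is read off from this form.\<close>

lemma ln_exit_time_less_iff:
  assumes c: "0 < c"
  shows "ln_enat (exit_time X S \<omega>) / ereal c < ereal a \<longleftrightarrow> (\<exists>t>0. X t \<omega> \<notin> S \<and> ln (real t) / c < a)"
proof
  assume l: "ln_enat (exit_time X S \<omega>) / ereal c < ereal a"
  show "\<exists>t>0. X t \<omega> \<notin> S \<and> ln (real t) / c < a"
    by (cases rule: exit_time_cases[of X \<omega> S]) (use l c in \<open>auto\<close>)
next
  assume "\<exists>t>0. X t \<omega> \<notin> S \<and> ln (real t) / c < a"
  then obtain t where t: "0 < t" "X t \<omega> \<notin> S" "ln (real t) / c < a" by blast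
  show "ln_enat (exit_time X S \<omega>) / ereal c < ereal a"
  proof (cases rule: exit_time_cases[of X \<omega> S])
    case 1
    then show ?thesis using t by auto
  next
    case (2 s)
    then have "s \<le> t" using exit_time_le[of t X \<omega> S] t by simp
    then have "ln (real s) / c \<le> ln (real t) / c" using c 2(1) t(1) by (intro divide_right_mono) auto
    then show ?thesis using 2(3) t(3) c by simp
  qed
qed

section \<open>Markov chains and their histories\<close>

locale markov_process =
  fixes M :: "'w measure" and L :: "real \<Rightarrow> real measure" and x :: real and X :: "nat \<Rightarrow> 'w \<Rightarrow> real"
  assumes chain: "markov_chain_from M L x X"
    and L_kernel: "L \<in> borel \<rightarrow>\<^sub>M subprob_algebra borel"
    and L_stochastic: "prob_space (L y)"
begin

sublocale prob_space M using chain by (simp add: markov_chain_from_def)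

lemma X_measurable: "1 \<le> t \<Longrightarrow> X t \<in> borel_measurable M"
  using chain by (simp add: markov_chain_from_def)

lemma history_generators: "{X i -` A \<inter> space M | i A. 1 \<le> i \<and> i \<le> t \<and> A \<in> sets borel} \<subseteq> sets M"
  using measurable_sets[OF X_measurable] by auto

lemma history_sets:
  "sets (process_history M X t) = sigma_sets (space M) {X i -` A \<inter> space M | i A. 1 \<le> i \<and> i \<le> t \<and> A \<in> sets borel}"
  unfolding process_history_def by (rule sets_measure_of) auto

lemma history_subalgebra: "subalgebra M (process_history M X t)"
proof -
  have "space (process_history M X t) = space M"
    unfolding process_history_def by (rule space_measure_of) auto
  moreover have "sets (process_history M X t) \<subseteq> sets M"
    unfolding history_sets by (rule sets.sigma_sets_subset[OF history_generators])
  ultimately show ?thesis by (simp add: subalgebra_def)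
qed

text \<open>The Markov property is given for each \<open>A\<close> with its own exceptional null
  set. Integrated over a history event it becomes an exact identity between measures.\<close>

lemma markov_step_emeasure:
  assumes t: "1 \<le> t" and B: "B \<in> sets (process_history M X t)" and A: "A \<in> sets borel"
  shows "emeasure M (B \<inter> (X (Suc t) -` A \<inter> space M)) = (\<integral>\<^sup>+\<omega>. indicator B \<omega> * emeasure (L (X t \<omega>)) A \<partial>M)"
proof -
  interpret F: finite_measure_subalgebra M "process_history M X t"
    by unfold_locales (rule history_subalgebra)
  have [measurable]: "X t \<in> borel_measurable M" "X (Suc t) \<in> borel_measurable M" using X_measurable t by auto
  have BM[measurable]: "B \<in> sets M" using B history_subalgebra[of t] by (auto simp: subalgebra_def)
  note [measurable] = A
  have mL: "(\<lambda>y. measure (L y) A) \<in> borel_measurable borel"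
    using measurable_compose[OF L_kernel measurable_emeasure_subprob_algebra[OF A]]
    unfolding measure_def by measurable
  then have [measurable]: "(\<lambda>\<omega>. measure (L (X t \<omega>)) A) \<in> borel_measurable M"
    by (rule measurable_compose[rotated]) measurable
  let ?f = "\<lambda>\<omega>. indicator A (X (Suc t) \<omega>) :: real"
  have fi: "integrable M ?f"
    by (rule integrable_const_bound[where B = 1]) (auto split: split_indicator)
  have ae: "AE \<omega> in M. real_cond_exp M (process_history M X t) ?f \<omega> = measure (L (X t \<omega>)) A"
    using chain t A by (simp add: markov_chain_from_def)
  have li: "integrable M (\<lambda>\<omega>. indicator B \<omega> * measure (L (X t \<omega>)) A)"
    by (rule integrable_const_bound[where B = 1])
      (auto split: split_indicator simp: prob_space.prob_le_1[OF L_stochastic])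
  have "measure M (B \<inter> (X (Suc t) -` A \<inter> space M)) = (LINT \<omega>|M. indicator (B \<inter> (X (Suc t) -` A \<inter> space M)) \<omega>)"
    by simp
  also have "\<dots> = (LINT \<omega>|M. indicator B \<omega> * ?f \<omega>)"
    by (intro Bochner_Integration.integral_cong) (auto split: split_indicator)
  also have "\<dots> = (LINT \<omega>:B|M. ?f \<omega>)" by (simp add: set_lebesgue_integral_def)
  also have "\<dots> = (LINT \<omega>:B|M. real_cond_exp M (process_history M X t) ?f \<omega>)"
    by (rule F.real_cond_exp_intA[OF fi B])
  also have "\<dots> = (LINT \<omega>|M. indicator B \<omega> * real_cond_exp M (process_history M X t) ?f \<omega>)"
    by (simp add: set_lebesgue_integral_def)
  also have "\<dots> = (LINT \<omega>|M. indicator B \<omega> * measure (L (X t \<omega>)) A)"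
  proof (rule integral_cong_AE)
    show "AE \<omega> in M. indicator B \<omega> * real_cond_exp M (process_history M X t) ?f \<omega> = indicator B \<omega> * measure (L (X t \<omega>)) A"
      using ae by eventually_elim simp
  qed auto
  finally have eq: "measure M (B \<inter> (X (Suc t) -` A \<inter> space M)) = (LINT \<omega>|M. indicator B \<omega> * measure (L (X t \<omega>)) A)" .
  have "(\<integral>\<^sup>+\<omega>. indicator B \<omega> * emeasure (L (X t \<omega>)) A \<partial>M) = (\<integral>\<^sup>+\<omega>. ennreal (indicator B \<omega> * measure (L (X t \<omega>)) A) \<partial>M)"
    by (intro nn_integral_cong)
      (auto split: split_indicator simp: finite_measure.emeasure_eq_measure[OF prob_space.finite_measure[OF L_stochastic]])
  also have "\<dots> = ennreal (LINT \<omega>|M. indicator B \<omega> * measure (L (X t \<omega>)) A)"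
    by (rule nn_integral_eq_integral[OF li]) auto
  finally show ?thesis by (simp add: emeasure_eq_measure eq)
qed

lemma markov_step_nn_integral:
  assumes t: "1 \<le> t" and B: "B \<in> sets (process_history M X t)" and \<phi>: "\<phi> \<in> borel_measurable borel"
  shows "(\<integral>\<^sup>+\<omega>. indicator B \<omega> * \<phi> (X (Suc t) \<omega>) \<partial>M) = (\<integral>\<^sup>+\<omega>. indicator B \<omega> * (\<integral>\<^sup>+y. \<phi> y \<partial>L (X t \<omega>)) \<partial>M)"
proof -
  have [measurable]: "X t \<in> borel_measurable M" "X (Suc t) \<in> borel_measurable M" using X_measurable t by auto
  have BM[measurable]: "B \<in> sets M" using B history_subalgebra[of t] by (auto simp: subalgebra_def)
  note [measurable] = \<phi>
  define N1 where "N1 = distr (density M (indicator B)) borel (X (Suc t))"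
  define N0 where "N0 = distr (density M (indicator B)) borel (X t)"
  have K: "L \<in> N0 \<rightarrow>\<^sub>M subprob_algebra borel" using L_kernel by (simp add: N0_def)
  have ne: "space N0 \<noteq> {}" by (simp add: N0_def)
  \<comment> \<open>The laws of the present and of the next state, both restricted to
    \<open>B\<close>, differ by one application of the kernel. Agreement on sets suffices for this,
    and it delivers the claim for every \<open>\<phi>\<close> at once.\<close>
  have "N1 = N0 \<bind> L"
  proof (rule measure_eqI)
    show s: "sets N1 = sets (N0 \<bind> L)"
      using sets_bind_measurable[OF K ne] by (simp add: N1_def)
    fix A assume "A \<in> sets N1"
    then have A[measurable]: "A \<in> sets borel" by (simp add: N1_def)
    have [measurable]: "(\<lambda>y. emeasure (L y) A) \<in> borel_measurable borel"
      by (rule measurable_compose[OF L_kernel measurable_emeasure_subprob_algebra[OF A]])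
    have "emeasure N1 A = emeasure (density M (indicator B)) (X (Suc t) -` A \<inter> space M)"
      unfolding N1_def by (subst emeasure_distr) auto
    also have "\<dots> = (\<integral>\<^sup>+\<omega>. indicator B \<omega> * indicator (X (Suc t) -` A \<inter> space M) \<omega> \<partial>M)"
      by (rule emeasure_density) measurable
    also have "\<dots> = (\<integral>\<^sup>+\<omega>. indicator (B \<inter> (X (Suc t) -` A \<inter> space M)) \<omega> \<partial>M)"
      by (intro nn_integral_cong) (auto split: split_indicator)
    also have "\<dots> = emeasure M (B \<inter> (X (Suc t) -` A \<inter> space M))" by (rule nn_integral_indicator) measurable
    also have "\<dots> = (\<integral>\<^sup>+\<omega>. indicator B \<omega> * emeasure (L (X t \<omega>)) A \<partial>M)" by (rule markov_step_emeasure[OF t B A])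
    also have "\<dots> = (\<integral>\<^sup>+\<omega>. emeasure (L (X t \<omega>)) A \<partial>density M (indicator B))"
      by (subst nn_integral_density) auto
    also have "\<dots> = (\<integral>\<^sup>+y. emeasure (L y) A \<partial>N0)" unfolding N0_def by (subst nn_integral_distr) auto
    also have "\<dots> = emeasure (N0 \<bind> L) A" by (rule emeasure_bind[OF ne K A, symmetric])
    finally show "emeasure N1 A = emeasure (N0 \<bind> L) A" .
  qed
  have m: "(\<lambda>y. \<integral>\<^sup>+z. \<phi> z \<partial>L y) \<in> borel_measurable borel"
    by (rule measurable_compose[OF L_kernel nn_integral_measurable_subprob_algebra[OF \<phi>]])
  have "(\<integral>\<^sup>+\<omega>. indicator B \<omega> * \<phi> (X (Suc t) \<omega>) \<partial>M) = (\<integral>\<^sup>+y. \<phi> y \<partial>N1)"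
    unfolding N1_def by (simp add: nn_integral_distr nn_integral_density)
  also have "\<dots> = (\<integral>\<^sup>+y. \<integral>\<^sup>+z. \<phi> z \<partial>L y \<partial>N0)" unfolding \<open>N1 = N0 \<bind> L\<close> by (rule nn_integral_bind[OF \<phi> K])
  also have "\<dots> = (\<integral>\<^sup>+\<omega>. indicator B \<omega> * (\<integral>\<^sup>+y. \<phi> y \<partial>L (X t \<omega>)) \<partial>M)"
    unfolding N0_def using m by (simp add: nn_integral_distr nn_integral_density)
  finally show ?thesis .
qed

definition stay :: "real set \<Rightarrow> nat \<Rightarrow> 'w set" where
  "stay S t = {\<omega> \<in> space M. \<forall>i\<in>{1..t}. X i \<omega> \<in> S}"

lemma stay_history:
  assumes "S \<in> sets borel" shows "stay S t \<in> sets (process_history M X t)"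
proof -
  let ?H = "process_history M X t"
  have sp: "space ?H = space M" using history_subalgebra by (simp add: subalgebra_def)
  have "{\<omega> \<in> space ?H. \<forall>i\<in>{1..t}. X i \<omega> \<in> S} \<in> sets ?H"
  proof (rule sets.sets_Collect_finite_All)
    show "{\<omega> \<in> space ?H. X i \<omega> \<in> S} \<in> sets ?H" if "i \<in> {1..t}" for i
      unfolding history_sets sp using that assms by (intro sigma_sets.Basic) auto
  qed (auto)
  then show ?thesis by (simp add: stay_def sp)
qed

text \<open>Time starts at index \<open>1\<close>, so staying up to index \<open>Suc n\<close> means
  \<open>n\<close> transitions; hence \<open>v n\<close> and not \<open>v (Suc n)\<close>. Only the
  recursion for \<open>v\<close> is used, which keeps the probabilistic part apart from the
  \<open>L^2\<close> theory.\<close>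

lemma prob_stay_le:
  fixes v :: "nat \<Rightarrow> real \<Rightarrow> real"
  assumes S: "S \<in> sets borel"
    and v_meas: "\<And>n. v n \<in> borel_measurable borel"
    and v_bounds: "\<And>n y. 0 \<le> v n y" "\<And>n y. v n y \<le> 1"
    and v0: "v 0 = indicator S" and v_Suc: "\<And>n y. v (Suc n) y = indicator S y * (LINT z|L y. v n z)"
  shows "measure M (stay S (Suc n)) \<le> v n x"
proof -
  have L_sets: "sets (L y) = sets borel" for y
    using sets_kernel[OF L_kernel] by simp
  have step: "ennreal (v (Suc n) y) = indicator S y * (\<integral>\<^sup>+z. ennreal (v n z) \<partial>L y)" for n y
  proof -
    interpret Ly: prob_space "L y" by (rule L_stochastic)
    have "v n \<in> borel_measurable (L y)"
      using v_meas by (subst measurable_cong_sets[OF L_sets refl])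
    then have "integrable (L y) (v n)"
      by (intro Ly.integrable_const_bound[where B = 1]) (use v_bounds in auto)
    then have "(\<integral>\<^sup>+z. ennreal (v n z) \<partial>L y) = ennreal (LINT z|L y. v n z)"
      by (rule nn_integral_eq_integral) (use v_bounds in auto)
    then show ?thesis by (simp add: v_Suc split: split_indicator)
  qed
  have supp: "v n y = indicator S y * v n y" for n y
    by (cases n) (auto simp: v0 v_Suc split: split_indicator)
  have stay_sets: "stay S t \<in> sets M" for t
    using stay_history[OF S] history_subalgebra by (auto simp: subalgebra_def)
  \<comment> \<open>Each induction step exchanges one remaining transition for one unit of elapsed
    time, so \<open>t\<close> must vary. The condition on the new state can be added freely because
    \<open>v n\<close> vanishes outside \<open>S\<close>.\<close>
  have main: "(\<integral>\<^sup>+\<omega>. indicator (stay S t) \<omega> * ennreal (v n (X t \<omega>)) \<partial>M) = emeasure M (stay S (t + n))" if "1 \<le> t" for t n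
    using that
  proof (induction n arbitrary: t)
    case 0
    have "(\<integral>\<^sup>+\<omega>. indicator (stay S t) \<omega> * ennreal (v 0 (X t \<omega>)) \<partial>M) = (\<integral>\<^sup>+\<omega>. indicator (stay S t) \<omega> \<partial>M)"
      by (intro nn_integral_cong) (use 0 in \<open>auto simp: v0 stay_def split: split_indicator\<close>)
    then show ?case using stay_sets by simp
  next
    case (Suc n)
    have "(\<integral>\<^sup>+\<omega>. indicator (stay S t) \<omega> * ennreal (v (Suc n) (X t \<omega>)) \<partial>M)
        = (\<integral>\<^sup>+\<omega>. indicator (stay S t) \<omega> * (\<integral>\<^sup>+y. ennreal (v n y) \<partial>L (X t \<omega>)) \<partial>M)"
      unfolding step by (intro nn_integral_cong) (use Suc.prems in \<open>auto simp: stay_def split: split_indicator\<close>)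
    also have "\<dots> = (\<integral>\<^sup>+\<omega>. indicator (stay S t) \<omega> * ennreal (v n (X (Suc t) \<omega>)) \<partial>M)"
      by (rule markov_step_nn_integral[OF Suc.prems stay_history[OF S], symmetric]) (use v_meas in measurable)
    also have "\<dots> = (\<integral>\<^sup>+\<omega>. indicator (stay S (Suc t)) \<omega> * ennreal (v n (X (Suc t) \<omega>)) \<partial>M)"
    proof (intro nn_integral_cong)
      fix \<omega>
      show "indicator (stay S t) \<omega> * ennreal (v n (X (Suc t) \<omega>)) = indicator (stay S (Suc t)) \<omega> * ennreal (v n (X (Suc t) \<omega>))"
      proof (cases "X (Suc t) \<omega> \<in> S")
        case True
        then show ?thesis by (auto simp: stay_def atLeastAtMostSuc_conv split: split_indicator)
      next
        case False
        then show ?thesis using supp[of n "X (Suc t) \<omega>"] by simp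
      qed
    qed
    also have "\<dots> = emeasure M (stay S (Suc t + n))" by (rule Suc.IH) simp
    finally show ?case by simp
  qed
  have "emeasure M (stay S (Suc n)) = (\<integral>\<^sup>+\<omega>. indicator (stay S 1) \<omega> * ennreal (v n (X 1 \<omega>)) \<partial>M)"
    using main[of 1 n] by simp
  also have "\<dots> \<le> (\<integral>\<^sup>+\<omega>. ennreal (v n (X 1 \<omega>)) \<partial>M)"
    by (intro nn_integral_mono) (auto split: split_indicator)
  also have "\<dots> = (\<integral>\<^sup>+\<omega>. ennreal (v n x) \<partial>M)"
  proof (rule nn_integral_cong_AE)
    have "AE \<omega> in M. X 1 \<omega> = x" using chain by (simp add: markov_chain_from_def)
    then show "AE \<omega> in M. ennreal (v n (X 1 \<omega>)) = ennreal (v n x)" by eventually_elim simp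
  qed
  also have "\<dots> = ennreal (v n x)" by (simp add: emeasure_space_1)
  finally show ?thesis using v_bounds(1) by (simp add: emeasure_eq_measure)
qed

lemma prob_ln_exit_time_ge:
  assumes S: "S \<in> sets borel" and c: "0 < c" and n: "ln (real (Suc n)) / c < a"
  shows "1 - measure M (stay S (Suc n))
    \<le> measure M {\<omega> \<in> space M. ln_enat (exit_time X S \<omega>) / ereal c < ereal a}"
proof -
  let ?E = "{\<omega> \<in> space M. ln_enat (exit_time X S \<omega>) / ereal c < ereal a}"
  have E: "?E = (\<Union>t\<in>{t. 0 < t \<and> ln (real t) / c < a}. {\<omega> \<in> space M. X t \<omega> \<notin> S})"
    unfolding ln_exit_time_less_iff[OF c] by auto
  have "{\<omega> \<in> space M. X t \<omega> \<notin> S} \<in> sets M" if "0 < t" for t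
  proof -
    have [measurable]: "X t \<in> borel_measurable M" using X_measurable that by simp
    show ?thesis using S by measurable
  qed
  then have Es: "?E \<in> sets M" unfolding E by (intro sets.countable_UN') auto
  have ss: "stay S (Suc n) \<in> sets M"
    using stay_history[OF S] history_subalgebra by (auto simp: subalgebra_def)
  have "space M - stay S (Suc n) \<subseteq> ?E"
  proof
    fix \<omega> assume "\<omega> \<in> space M - stay S (Suc n)"
    then obtain i where i: "1 \<le> i" "i \<le> Suc n" "X i \<omega> \<notin> S" "\<omega> \<in> space M" by (auto simp: stay_def)
    have "ln (real i) / c \<le> ln (real (Suc n)) / c" using i c by (intro divide_right_mono) auto
    then show "\<omega> \<in> ?E" unfolding E using i n by (auto intro!: exI[of _ i])
  qed
  then have "measure M (space M - stay S (Suc n)) \<le> measure M ?E"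
    using Es by (rule finite_measure_mono)
  then show ?thesis using prob_compl[OF ss] by simp
qed

end

section \<open>Survival functions as bounds on exit probabilities\<close>

context reversible_kernel
begin

lemma survival_measurable: "S \<in> sets borel \<Longrightarrow> survival S n \<in> borel_measurable borel"
proof -
  assume S: "S \<in> sets borel"
  have [measurable]: "(\<lambda>x. complex_of_real (survival S n x)) \<in> borel_measurable borel"
    by (rule L2_measurable) (use survival_op[OF S] in blast)
  have "(\<lambda>x. Re (complex_of_real (survival S n x))) \<in> borel_measurable borel" by measurable
  then show ?thesis by simp
qed

lemma survival_bounds: "S \<in> sets borel \<Longrightarrow> 0 \<le> survival S n x \<and> survival S n x \<le> 1"
proof (induction n arbitrary: x)
  case 0
  then show ?case by (auto split: split_indicator)
next
  case (Suc n)
  interpret Lx: prob_space "L x" by (rule L_prob)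
  have "survival S n \<in> borel_measurable (L x)"
    using survival_measurable[OF Suc.prems] by (subst measurable_cong_sets[OF L_sets refl])
  then have "integrable (L x) (survival S n)"
    by (intro Lx.integrable_const_bound[where B = 1]) (use Suc in auto)
  then have "(LINT y|L x. survival S n y) \<le> 1"
    using Suc by (intro Lx.integral_le_const) auto
  moreover have "0 \<le> (LINT y|L x. survival S n y)" using Suc by (intro integral_nonneg_AE) auto
  ultimately show ?case by (auto split: split_indicator)
qed

lemma prob_exit_ge:
  assumes mc: "markov_chain_from M L x X" and K: "L \<in> borel \<rightarrow>\<^sub>M subprob_algebra borel"
    and S: "S \<in> sets borel" and c: "0 < c" and n: "ln (real (Suc n)) / c < a"
  shows "1 - survival S n x \<le> measure M {\<omega> \<in> space M. ln_enat (exit_time X S \<omega>) / ereal c < ereal a}"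
proof -
  interpret P: markov_process M L x X by (intro markov_process.intro mc K L_prob)
  have "measure M (P.stay S (Suc n)) \<le> survival S n x"
    using survival_bounds[OF S] survival_measurable[OF S] by (intro P.prob_stay_le S) auto
  then show ?thesis using P.prob_ln_exit_time_ge[OF S c n] by linarith
qed

end

lemma (in rwm_target) rwm_kernel_measurable: "rwm_kernel \<sigma> \<rho> \<in> borel \<rightarrow>\<^sub>M subprob_algebra borel"
  unfolding rwm_kernel_def[abs_def]
proof (rule measurable_distr2)
  let ?P = "density lborel (\<lambda>e. ennreal (normal_density 0 \<sigma> e)) \<Otimes>\<^sub>M uniform_measure lborel {0..1::real}"
  have "sets ?P = sets (borel \<Otimes>\<^sub>M borel)" by (intro sets_pair_measure_cong) auto
  then have sets: "sets (borel \<Otimes>\<^sub>M ?P) = sets (borel \<Otimes>\<^sub>M (borel \<Otimes>\<^sub>M borel))"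
    by (intro sets_pair_measure_cong) auto
  show "(\<lambda>(x, y). case y of (e, u) \<Rightarrow> if u < \<rho> (x + e) / \<rho> x then x + e else x) \<in> borel \<Otimes>\<^sub>M ?P \<rightarrow>\<^sub>M borel"
    unfolding measurable_cong_sets[OF sets refl] by measurable
  interpret N: prob_space "density lborel (\<lambda>e. ennreal (normal_density 0 \<sigma> e))" by (rule prob_space_increment)
  interpret U: prob_space "uniform_measure lborel {0..1::real}" by (rule prob_space_unit_interval)
  interpret P: pair_prob_space "density lborel (\<lambda>e. ennreal (normal_density 0 \<sigma> e))" "uniform_measure lborel {0..1::real}" ..
  show "(\<lambda>x. ?P) \<in> borel \<rightarrow>\<^sub>M subprob_algebra ?P"
    by (rule measurable_const) (simp add: space_subprob_algebra P.subprob_space_axioms)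
qed

section \<open>Poincare inequalities from drift and paths\<close>

context rwm_target
begin

text \<open>The joint Lebesgue density of a stationary state and its accepted successor, equal to
  \<open>\<rho> x * \<rho> y * rwm_density x y\<close>.\<close>

definition flow :: "real \<Rightarrow> real \<Rightarrow> real" where
  "flow x y = normal_density 0 \<sigma> (y - x) * min (\<rho> x) (\<rho> y)"

text \<open>Twice the energy, as an integral over Lebesgue measure with extended values, so that
  changes of variables and rearrangements need no integrability argument.\<close>

definition dirichlet :: "(real \<Rightarrow> complex) \<Rightarrow> ennreal" where
  "dirichlet f = (\<integral>\<^sup>+x. \<integral>\<^sup>+y. ennreal (flow x y * (cmod (f x - f y))\<^sup>2) \<partial>lborel \<partial>lborel)"

lemma flow_nonneg: "0 \<le> flow x y"
  using \<rho>_pos[of x] \<rho>_pos[of y] by (simp add: flow_def min_def less_imp_le)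

lemma flow_sym: "flow x y = flow y x"
  unfolding flow_def using normal_density_uminus[of \<sigma> "y - x"] by (simp add: min.commute)

lemma flow_measurable[measurable (raw)]:
  assumes [measurable]: "f \<in> borel_measurable N" "g \<in> borel_measurable N"
  shows "(\<lambda>x. flow (f x) (g x)) \<in> borel_measurable N"
  unfolding flow_def by measurable

lemma flow_rwm_density: "\<rho> x * (\<rho> y * rwm_density x y) = flow x y"
  using \<rho>_pos[of x] \<rho>_pos[of y] by (auto simp: rwm_density_def flow_def max_def min_def field_simps)

lemma nn_integral_target:
  assumes "f \<in> borel_measurable borel"
  shows "(\<integral>\<^sup>+x. f x \<partial>target) = (\<integral>\<^sup>+x. ennreal (\<rho> x) * f x \<partial>lborel)"
  using assms unfolding target_def by (simp add: nn_integral_density)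

lemma dirichlet_energy:
  assumes f: "f \<in> L2_fun target"
  shows "dirichlet f = ennreal (2 * energy f)"
proof -
  have [measurable]: "f \<in> borel_measurable borel" using L2_measurable[OF f] .
  have "(\<integral>\<^sup>+x. \<integral>\<^sup>+y. ennreal (rwm_density x y * (cmod (f x - f y))\<^sup>2) \<partial>target \<partial>target)
      = (\<integral>\<^sup>+x. ennreal (\<rho> x) * (\<integral>\<^sup>+y. ennreal (\<rho> y) * ennreal (rwm_density x y * (cmod (f x - f y))\<^sup>2) \<partial>lborel) \<partial>lborel)"
    by (simp add: nn_integral_target)
  also have "\<dots> = (\<integral>\<^sup>+x. \<integral>\<^sup>+y. ennreal (\<rho> x) * (ennreal (\<rho> y) * ennreal (rwm_density x y * (cmod (f x - f y))\<^sup>2)) \<partial>lborel \<partial>lborel)"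
    by (intro nn_integral_cong nn_integral_cmult[symmetric]) measurable
  also have "\<dots> = dirichlet f"
    unfolding dirichlet_def
    by (intro nn_integral_cong) (simp add: ennreal_mult'[symmetric] \<rho>_pos less_imp_le rwm_density_nonneg flow_rwm_density[symmetric] mult_ac)
  finally show ?thesis using nn_energy[OF f] by simp
qed

lemma flow_int_le: "(\<integral>\<^sup>+y. ennreal (flow x y) \<partial>lborel) \<le> ennreal (\<rho> x)"
proof -
  have "(\<integral>\<^sup>+y. ennreal (flow x y) \<partial>lborel) = (\<integral>\<^sup>+y. ennreal (\<rho> x) * (ennreal (\<rho> y) * ennreal (rwm_density x y)) \<partial>lborel)"
    by (intro nn_integral_cong) (simp add: ennreal_mult'[symmetric] \<rho>_pos less_imp_le rwm_density_nonneg flow_rwm_density[symmetric])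
  also have "\<dots> = ennreal (\<rho> x) * (\<integral>\<^sup>+y. ennreal (\<rho> y) * ennreal (rwm_density x y) \<partial>lborel)"
    by (rule nn_integral_cmult) measurable
  also have "(\<integral>\<^sup>+y. ennreal (\<rho> y) * ennreal (rwm_density x y) \<partial>lborel) = (\<integral>\<^sup>+y. ennreal (rwm_density x y) \<partial>target)"
    by (rule nn_integral_target[symmetric]) measurable
  also have "\<dots> = ennreal (LINT y|target. rwm_density x y)"
    by (rule nn_integral_eq_integral[OF k_integrable]) (simp add: rwm_density_nonneg)
  also have "\<dots> \<le> 1" using rwm_density_mass_le by simp
  finally show ?thesis by (simp add: mult_left_mono)
qed

text \<open>Integrated with \<open>v = V x\<close> and \<open>w = V y\<close>, this turns a drift condition on \<open>V\<close> into a
  weighted Poincare inequality.\<close>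

lemma drift_pointwise:
  fixes a b :: complex
  assumes "0 < v" "0 < w"
  shows "(cmod a)\<^sup>2 + (cmod b)\<^sup>2 \<le> (cmod (a - b))\<^sup>2 + ((cmod a)\<^sup>2 * (w / v) + (cmod b)\<^sup>2 * (v / w))"
proof -
  define s where "s = sqrt (w / v)"
  have s: "0 < s" "s\<^sup>2 = w / v" "(1 / s)\<^sup>2 = v / w" using assms by (auto simp: s_def power_divide)
  have "2 * (cmod a * cmod b) \<le> (cmod a)\<^sup>2 * (w / v) + (cmod b)\<^sup>2 * (v / w)"
    using sum_squares_bound[of "cmod a * s" "cmod b * (1 / s)"] s(1)
    unfolding power_mult_distrib s(2,3) by simp
  moreover have "a \<bullet> b \<le> cmod a * cmod b" by (rule norm_cauchy_schwarz)
  moreover have "(cmod (a - b))\<^sup>2 = (cmod a)\<^sup>2 + (cmod b)\<^sup>2 - 2 * (a \<bullet> b)"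
    by (simp add: power2_norm_eq_inner inner_diff_left inner_diff_right inner_commute[of b a])
  ultimately show ?thesis by linarith
qed

text \<open>Multiply \<open>drift_pointwise\<close> by the flow and integrate: with \<open>A\<close>
  and \<open>B\<close> as below, \<open>2A\<close> is at most \<open>dirichlet f + 2B\<close>, while
  the drift condition integrated against the squared modulus bounds \<open>B\<close> by
  \<open>A\<close> up to the \<open>\<theta>\<close> and \<open>b\<close> terms. Both sides of
  \<open>drift\<close> contain accepted moves only, because a rejection has ratio
  \<open>V x / V x = 1\<close> and cancels.\<close>

lemma drift_inequality:
  fixes V :: "real \<Rightarrow> real" and f :: "real \<Rightarrow> complex"
  assumes [measurable]: "V \<in> borel_measurable borel" "f \<in> borel_measurable borel" "C \<in> sets borel"
    and V: "\<And>x. 0 < V x" and \<theta>: "0 \<le> \<theta>" and b: "0 \<le> b"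
    and fin: "(\<integral>\<^sup>+x. ennreal (\<rho> x * (cmod (f x))\<^sup>2) \<partial>lborel) < \<infinity>"
    and drift: "\<And>x. (\<integral>\<^sup>+y. ennreal (flow x y * (V y / V x)) \<partial>lborel) + ennreal (\<theta> * \<rho> x)
      \<le> (\<integral>\<^sup>+y. ennreal (flow x y) \<partial>lborel) + ennreal (b * \<rho> x) * indicator C x"
  shows "ennreal \<theta> * (\<integral>\<^sup>+x. ennreal (\<rho> x * (cmod (f x))\<^sup>2) \<partial>lborel)
    \<le> dirichlet f + ennreal b * (\<integral>\<^sup>+x. indicator C x * ennreal (\<rho> x * (cmod (f x))\<^sup>2) \<partial>lborel)"
proof -
  let ?F = "\<lambda>x. ennreal ((cmod (f x))\<^sup>2)"
  define A where "A = (\<integral>\<^sup>+x. \<integral>\<^sup>+y. ennreal (flow x y * (cmod (f x))\<^sup>2) \<partial>lborel \<partial>lborel)"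
  define B where "B = (\<integral>\<^sup>+x. \<integral>\<^sup>+y. ennreal (flow x y * ((cmod (f x))\<^sup>2 * (V y / V x))) \<partial>lborel \<partial>lborel)"
  define R where "R = (\<integral>\<^sup>+x. ennreal (\<rho> x * (cmod (f x))\<^sup>2) \<partial>lborel)"
  define P where "P = (\<integral>\<^sup>+x. indicator C x * ennreal (\<rho> x * (cmod (f x))\<^sup>2) \<partial>lborel)"
  note nonneg = flow_nonneg V[THEN less_imp_le] \<rho>_pos[THEN less_imp_le]
  have swap: "(\<integral>\<^sup>+x. \<integral>\<^sup>+y. ennreal (h x y) \<partial>lborel \<partial>lborel) = (\<integral>\<^sup>+x. \<integral>\<^sup>+y. ennreal (h y x) \<partial>lborel \<partial>lborel)"
    if "case_prod h \<in> borel_measurable (borel \<Otimes>\<^sub>M borel)" for h :: "real \<Rightarrow> real \<Rightarrow> real"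
  proof -
    have "(\<lambda>(x, y). ennreal (h x y)) \<in> borel_measurable (lborel \<Otimes>\<^sub>M lborel)"
      using that by (simp add: case_prod_beta')
    from lborel_pair.Fubini'[OF this] show ?thesis by simp
  qed
  have A2: "(\<integral>\<^sup>+x. \<integral>\<^sup>+y. ennreal (flow x y * (cmod (f y))\<^sup>2) \<partial>lborel \<partial>lborel) = A"
    unfolding A_def by (subst swap) (auto simp: flow_sym)
  have B2: "(\<integral>\<^sup>+x. \<integral>\<^sup>+y. ennreal (flow x y * ((cmod (f y))\<^sup>2 * (V x / V y))) \<partial>lborel \<partial>lborel) = B"
    unfolding B_def by (subst swap) (auto simp: flow_sym)
  have split: "(\<integral>\<^sup>+x. \<integral>\<^sup>+y. ennreal (h1 x y + h2 x y) \<partial>lborel \<partial>lborel)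
      = (\<integral>\<^sup>+x. \<integral>\<^sup>+y. ennreal (h1 x y) \<partial>lborel \<partial>lborel) + (\<integral>\<^sup>+x. \<integral>\<^sup>+y. ennreal (h2 x y) \<partial>lborel \<partial>lborel)"
    if m: "case_prod h1 \<in> borel_measurable (borel \<Otimes>\<^sub>M borel)" "case_prod h2 \<in> borel_measurable (borel \<Otimes>\<^sub>M borel)"
      and p: "\<And>x y. 0 \<le> h1 x y" "\<And>x y. 0 \<le> h2 x y" for h1 h2 :: "real \<Rightarrow> real \<Rightarrow> real"
  proof -
    have [measurable]: "(\<lambda>z. h1 (fst z) (snd z)) \<in> borel_measurable (borel \<Otimes>\<^sub>M borel)"
      "(\<lambda>z. h2 (fst z) (snd z)) \<in> borel_measurable (borel \<Otimes>\<^sub>M borel)"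
      using m by (simp_all add: case_prod_beta')
    have [measurable]: "h1 x \<in> borel_measurable borel" "h2 x \<in> borel_measurable borel" for x
      using measurable_compose[OF measurable_Pair1'[of x borel borel] m(1)]
        measurable_compose[OF measurable_Pair1'[of x borel borel] m(2)] by simp_all
    have "(\<integral>\<^sup>+x. \<integral>\<^sup>+y. ennreal (h1 x y + h2 x y) \<partial>lborel \<partial>lborel)
        = (\<integral>\<^sup>+x. (\<integral>\<^sup>+y. ennreal (h1 x y) \<partial>lborel) + (\<integral>\<^sup>+y. ennreal (h2 x y) \<partial>lborel) \<partial>lborel)"
      by (intro nn_integral_cong) (simp add: p ennreal_plus[symmetric] nn_integral_add[symmetric] del: ennreal_plus)
    also have "\<dots> = (\<integral>\<^sup>+x. \<integral>\<^sup>+y. ennreal (h1 x y) \<partial>lborel \<partial>lborel) + (\<integral>\<^sup>+x. \<integral>\<^sup>+y. ennreal (h2 x y) \<partial>lborel \<partial>lborel)"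
    proof (rule nn_integral_add)
      show "(\<lambda>x. \<integral>\<^sup>+y. ennreal (h1 x y) \<partial>lborel) \<in> borel_measurable lborel"
        using lborel.borel_measurable_nn_integral[of "\<lambda>x y. ennreal (h1 x y)" lborel] by (simp add: case_prod_beta')
      show "(\<lambda>x. \<integral>\<^sup>+y. ennreal (h2 x y) \<partial>lborel) \<in> borel_measurable lborel"
        using lborel.borel_measurable_nn_integral[of "\<lambda>x y. ennreal (h2 x y)" lborel] by (simp add: case_prod_beta')
    qed
    finally show ?thesis .
  qed
  have "A + A = (\<integral>\<^sup>+x. \<integral>\<^sup>+y. ennreal (flow x y * (cmod (f x))\<^sup>2 + flow x y * (cmod (f y))\<^sup>2) \<partial>lborel \<partial>lborel)"
    by (subst split) (auto simp: A2 A_def[symmetric] nonneg)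
  also have "\<dots> \<le> (\<integral>\<^sup>+x. \<integral>\<^sup>+y. ennreal (flow x y * (cmod (f x - f y))\<^sup>2
      + (flow x y * ((cmod (f x))\<^sup>2 * (V y / V x)) + flow x y * ((cmod (f y))\<^sup>2 * (V x / V y)))) \<partial>lborel \<partial>lborel)"
  proof (intro nn_integral_mono ennreal_leI)
    fix x y
    show "flow x y * (cmod (f x))\<^sup>2 + flow x y * (cmod (f y))\<^sup>2 \<le> flow x y * (cmod (f x - f y))\<^sup>2
      + (flow x y * ((cmod (f x))\<^sup>2 * (V y / V x)) + flow x y * ((cmod (f y))\<^sup>2 * (V x / V y)))"
      unfolding distrib_left[symmetric] by (intro mult_left_mono drift_pointwise V nonneg)
  qed
  also have "\<dots> = dirichlet f + (B + B)"
  proof -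
    let ?h2 = "\<lambda>x y. flow x y * ((cmod (f x))\<^sup>2 * (V y / V x))"
    let ?h3 = "\<lambda>x y. flow x y * ((cmod (f y))\<^sup>2 * (V x / V y))"
    have "(\<integral>\<^sup>+x. \<integral>\<^sup>+y. ennreal (?h2 x y + ?h3 x y) \<partial>lborel \<partial>lborel)
        = (\<integral>\<^sup>+x. \<integral>\<^sup>+y. ennreal (?h2 x y) \<partial>lborel \<partial>lborel) + (\<integral>\<^sup>+x. \<integral>\<^sup>+y. ennreal (?h3 x y) \<partial>lborel \<partial>lborel)"
      by (rule split) (auto simp: nonneg)
    also have "\<dots> = B + B" by (simp only: B2 B_def)
    finally have "(\<integral>\<^sup>+x. \<integral>\<^sup>+y. ennreal (?h2 x y + ?h3 x y) \<partial>lborel \<partial>lborel) = B + B" .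
    moreover have "(\<integral>\<^sup>+x. \<integral>\<^sup>+y. ennreal (flow x y * (cmod (f x - f y))\<^sup>2 + (?h2 x y + ?h3 x y)) \<partial>lborel \<partial>lborel)
        = dirichlet f + (\<integral>\<^sup>+x. \<integral>\<^sup>+y. ennreal (?h2 x y + ?h3 x y) \<partial>lborel \<partial>lborel)"
      unfolding dirichlet_def by (rule split) (auto simp: nonneg)
    ultimately show ?thesis by (simp only:)
  qed
  finally have 1: "A + A \<le> dirichlet f + (B + B)" .
  have eqB: "(\<integral>\<^sup>+x. ?F x * (\<integral>\<^sup>+y. ennreal (flow x y * (V y / V x)) \<partial>lborel) \<partial>lborel) = B"
    unfolding B_def
    by (subst nn_integral_cmult[symmetric], measurable)
      (intro nn_integral_cong, simp add: ennreal_mult''[symmetric] nonneg mult_ac)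
  have eqA: "(\<integral>\<^sup>+x. ?F x * (\<integral>\<^sup>+y. ennreal (flow x y) \<partial>lborel) \<partial>lborel) = A"
    unfolding A_def
    by (subst nn_integral_cmult[symmetric], measurable)
      (intro nn_integral_cong, simp add: ennreal_mult''[symmetric] nonneg mult_ac)
  have "B + ennreal \<theta> * R = (\<integral>\<^sup>+x. ?F x * (\<integral>\<^sup>+y. ennreal (flow x y * (V y / V x)) \<partial>lborel) + ennreal \<theta> * ennreal (\<rho> x * (cmod (f x))\<^sup>2) \<partial>lborel)"
    unfolding eqB[symmetric] R_def by (subst nn_integral_add, measurable) (simp add: nn_integral_cmult)
  also have "\<dots> = (\<integral>\<^sup>+x. ?F x * ((\<integral>\<^sup>+y. ennreal (flow x y * (V y / V x)) \<partial>lborel) + ennreal (\<theta> * \<rho> x)) \<partial>lborel)"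
    using \<theta> by (intro nn_integral_cong) (simp add: distrib_left ennreal_mult''[symmetric] ennreal_mult'[symmetric] nonneg mult_ac)
  also have "\<dots> \<le> (\<integral>\<^sup>+x. ?F x * ((\<integral>\<^sup>+y. ennreal (flow x y) \<partial>lborel) + ennreal (b * \<rho> x) * indicator C x) \<partial>lborel)"
    by (intro nn_integral_mono mult_left_mono drift) auto
  also have "\<dots> = (\<integral>\<^sup>+x. ?F x * (\<integral>\<^sup>+y. ennreal (flow x y) \<partial>lborel) + ennreal b * (indicator C x * ennreal (\<rho> x * (cmod (f x))\<^sup>2)) \<partial>lborel)"
    using b by (intro nn_integral_cong) (auto simp: distrib_left ennreal_mult''[symmetric] ennreal_mult'[symmetric] nonneg mult_ac split: split_indicator)
  also have "\<dots> = A + ennreal b * P"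
    unfolding eqA[symmetric] P_def by (subst nn_integral_add, measurable) (simp add: nn_integral_cmult)
  finally have 2: "B + ennreal \<theta> * R \<le> A + ennreal b * P" .
  \<comment> \<open>Cancelling in extended arithmetic requires finite quantities: \<open>A\<close>
    is bounded by the squared norm of \<open>f\<close>, and \<open>B\<close> by \<open>A\<close>
    through the drift condition.\<close>
  have "A \<le> (\<integral>\<^sup>+x. ?F x * ennreal (\<rho> x) \<partial>lborel)"
    unfolding eqA[symmetric] by (intro nn_integral_mono mult_left_mono flow_int_le) simp
  also have "\<dots> = R" unfolding R_def by (intro nn_integral_cong) (simp add: ennreal_mult''[symmetric] nonneg mult_ac)
  finally have A: "A < \<infinity>" using fin R_def by (simp add: order_le_less_trans)
  have "P \<le> R" unfolding P_def R_def by (intro nn_integral_mono) (auto split: split_indicator)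
  then have P: "P < \<infinity>" using fin R_def by (simp add: order_le_less_trans)
  have "B \<le> A + ennreal b * P" using 2 by (rule order_trans[rotated]) simp
  also have "\<dots> < \<infinity>" using A P by (simp add: ennreal_mult_less_top)
  finally have B: "B < \<infinity>" .
  have "(B + B) + (ennreal \<theta> * R + ennreal \<theta> * R) \<le> (A + A) + (ennreal b * P + ennreal b * P)"
    using add_mono[OF 2 2] by (simp add: ac_simps)
  also have "\<dots> \<le> (dirichlet f + (B + B)) + (ennreal b * P + ennreal b * P)" using 1 by (rule add_right_mono)
  finally have "(B + B) + (ennreal \<theta> * R + ennreal \<theta> * R) \<le> (B + B) + (dirichlet f + (ennreal b * P + ennreal b * P))"
    by (simp add: ac_simps)
  then have "ennreal \<theta> * R + ennreal \<theta> * R \<le> dirichlet f + (ennreal b * P + ennreal b * P)"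
    using B by (subst (asm) ennreal_add_left_cancel_le) auto
  \<comment> \<open>Doubling the Dirichlet form weakens the bound harmlessly and lets the whole
    inequality be halved.\<close>
  also have "\<dots> \<le> (dirichlet f + ennreal b * P) + (dirichlet f + ennreal b * P)"
  proof -
    have "(dirichlet f + ennreal b * P) + (dirichlet f + ennreal b * P) = dirichlet f + (dirichlet f + (ennreal b * P + ennreal b * P))"
      by (simp add: ac_simps)
    then show ?thesis by simp
  qed
  finally have "2 * (ennreal \<theta> * R) \<le> 2 * (dirichlet f + ennreal b * P)" by (simp only: mult_2)
  then show ?thesis unfolding R_def P_def by (subst (asm) ennreal_mult_le_mult_iff) auto
qed

section \<open>Straight-line paths\<close>

lemma path_bound:
  fixes f :: "real \<Rightarrow> complex"
  assumes [measurable]: "f \<in> borel_measurable borel" "A \<in> sets borel" "U \<in> sets borel"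
    and n: "0 < n" and B: "0 \<le> B"
    and le: "\<And>x u i. x \<in> A \<Longrightarrow> u \<in> U \<Longrightarrow> i < n \<Longrightarrow>
      \<rho> x \<le> B * flow (x + real i * ((u - x) / real n)) (x + real (Suc i) * ((u - x) / real n))"
  shows "(\<integral>\<^sup>+x. \<integral>\<^sup>+u. indicator A x * indicator U u * ennreal (\<rho> x * (cmod (f x - f u))\<^sup>2) \<partial>lborel \<partial>lborel)
    \<le> ennreal (B * real n ^ 3) * dirichlet f"
proof -
  define g where "g a b = ennreal (flow a b * (cmod (f a - f b))\<^sup>2)" for a b
  have g_comp[measurable (raw)]: "(\<lambda>x. g (a x) (b x)) \<in> borel_measurable N"
    if [measurable]: "a \<in> borel_measurable N" "b \<in> borel_measurable N" for a b and N :: "'c measure"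
    unfolding g_def by measurable
  let ?z = "\<lambda>x u i. x + real i * ((u - x) / real n)"
  have pt: "indicator A x * indicator U u * ennreal (\<rho> x * (cmod (f x - f u))\<^sup>2)
      \<le> ennreal (real n * B) * (\<Sum>i<n. g (?z x u i) (?z x u (Suc i)))" for x u
  proof (cases "x \<in> A \<and> u \<in> U")
    case True
    have "f u - f x = (\<Sum>i<n. f (?z x u (Suc i)) - f (?z x u i))"
      using n by (subst sum_lessThan_telescope) simp
    then have "cmod (f x - f u) \<le> (\<Sum>i<n. cmod (f (?z x u i) - f (?z x u (Suc i))))"
      by (subst norm_minus_commute) (auto intro!: order_trans[OF norm_sum] sum_mono simp: norm_minus_commute)
    then have "(cmod (f x - f u))\<^sup>2 \<le> (\<Sum>i<n. 1 * cmod (f (?z x u i) - f (?z x u (Suc i))))\<^sup>2"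
      by (intro power_mono) auto
    also have "\<dots> \<le> (\<Sum>i<n. 1\<^sup>2) * (\<Sum>i<n. (cmod (f (?z x u i) - f (?z x u (Suc i))))\<^sup>2)"
      by (rule Cauchy_Schwarz_ineq_sum)
    finally have "\<rho> x * (cmod (f x - f u))\<^sup>2 \<le> \<rho> x * (real n * (\<Sum>i<n. (cmod (f (?z x u i) - f (?z x u (Suc i))))\<^sup>2))"
      using \<rho>_pos[of x] by (intro mult_left_mono) (auto simp: less_imp_le)
    also have "\<dots> = real n * (\<Sum>i<n. \<rho> x * (cmod (f (?z x u i) - f (?z x u (Suc i))))\<^sup>2)"
      by (simp add: sum_distrib_left mult_ac)
    also have "\<dots> \<le> real n * (\<Sum>i<n. (B * flow (?z x u i) (?z x u (Suc i))) * (cmod (f (?z x u i) - f (?z x u (Suc i))))\<^sup>2)"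
      using le True by (intro mult_left_mono sum_mono mult_right_mono) auto
    also have "\<dots> = real n * B * (\<Sum>i<n. flow (?z x u i) (?z x u (Suc i)) * (cmod (f (?z x u i) - f (?z x u (Suc i))))\<^sup>2)"
      by (simp add: sum_distrib_left mult_ac)
    finally have "ennreal (\<rho> x * (cmod (f x - f u))\<^sup>2) \<le> ennreal (real n * B * (\<Sum>i<n. flow (?z x u i) (?z x u (Suc i)) * (cmod (f (?z x u i) - f (?z x u (Suc i))))\<^sup>2))"
      by (rule ennreal_leI)
    also have "\<dots> = ennreal (real n * B) * (\<Sum>i<n. g (?z x u i) (?z x u (Suc i)))"
      using B unfolding g_def by (subst ennreal_mult') (auto simp: flow_nonneg sum_ennreal)
    finally show ?thesis using True by simp
  next
    case False
    then show ?thesis by (auto split: split_indicator)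
  qed
  \<comment> \<open>The pair \<open>(x, u)\<close> is replaced by the start of edge \<open>i\<close>
    and the increment \<open>w = (u - x) / n\<close>. The substitution is linear with Jacobian
    \<open>n\<close> and maps the plane onto the plane, so each edge costs exactly \<open>n\<close>
    Dirichlet forms and no congestion has to be counted. Together with the \<open>n\<close> edges
    and the \<open>n\<close> from Cauchy--Schwarz this gives \<open>n ^ 3\<close>.\<close>
  have edge: "(\<integral>\<^sup>+x. \<integral>\<^sup>+u. g (?z x u i) (?z x u (Suc i)) \<partial>lborel \<partial>lborel) = ennreal (real n) * dirichlet f" for i
  proof -
    have m1: "(\<lambda>(x, w). g (x + real i * w) (x + real i * w + w)) \<in> borel_measurable (lborel \<Otimes>\<^sub>M lborel)"
      by measurable
    have m2: "(\<lambda>(x, w). g x (x + w)) \<in> borel_measurable (lborel \<Otimes>\<^sub>M lborel)" by measurable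
    have "(\<integral>\<^sup>+u. g (?z x u i) (?z x u (Suc i)) \<partial>lborel)
        = ennreal (real n) * (\<integral>\<^sup>+w. g (x + real i * w) (x + real i * w + w) \<partial>lborel)" for x
    proof -
      have "(\<integral>\<^sup>+u. g (?z x u i) (?z x u (Suc i)) \<partial>lborel)
          = ennreal \<bar>real n\<bar> * (\<integral>\<^sup>+w. g (?z x (x + real n * w) i) (?z x (x + real n * w) (Suc i)) \<partial>lborel)"
        using n by (intro nn_integral_real_affine) auto
      then show ?thesis using n by (simp add: algebra_simps)
    qed
    then have "(\<integral>\<^sup>+x. \<integral>\<^sup>+u. g (?z x u i) (?z x u (Suc i)) \<partial>lborel \<partial>lborel)
        = (\<integral>\<^sup>+x. ennreal (real n) * (\<integral>\<^sup>+w. g (x + real i * w) (x + real i * w + w) \<partial>lborel) \<partial>lborel)" by simp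
    also have "\<dots> = ennreal (real n) * (\<integral>\<^sup>+x. \<integral>\<^sup>+w. g (x + real i * w) (x + real i * w + w) \<partial>lborel \<partial>lborel)"
      by (rule nn_integral_cmult) measurable
    also have "(\<integral>\<^sup>+x. \<integral>\<^sup>+w. g (x + real i * w) (x + real i * w + w) \<partial>lborel \<partial>lborel)
        = (\<integral>\<^sup>+w. \<integral>\<^sup>+x. g (x + real i * w) (x + real i * w + w) \<partial>lborel \<partial>lborel)"
      using lborel_pair.Fubini'[OF m1] by simp
    also have "\<dots> = (\<integral>\<^sup>+w. \<integral>\<^sup>+x. g x (x + w) \<partial>lborel \<partial>lborel)"
    proof (rule nn_integral_cong)
      fix w
      have "(\<integral>\<^sup>+x. g x (x + w) \<partial>lborel) = ennreal \<bar>1\<bar> * (\<integral>\<^sup>+x. g (real i * w + 1 * x) (real i * w + 1 * x + w) \<partial>lborel)"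
        by (intro nn_integral_real_affine) auto
      then show "(\<integral>\<^sup>+x. g (x + real i * w) (x + real i * w + w) \<partial>lborel) = (\<integral>\<^sup>+x. g x (x + w) \<partial>lborel)"
        by (simp add: add.commute)
    qed
    also have "\<dots> = (\<integral>\<^sup>+x. \<integral>\<^sup>+w. g x (x + w) \<partial>lborel \<partial>lborel)"
      using lborel_pair.Fubini'[OF m2] by simp
    also have "\<dots> = (\<integral>\<^sup>+x. \<integral>\<^sup>+y. g x y \<partial>lborel \<partial>lborel)"
    proof (rule nn_integral_cong)
      fix x
      have "(\<integral>\<^sup>+y. g x y \<partial>lborel) = ennreal \<bar>1\<bar> * (\<integral>\<^sup>+w. g x (x + 1 * w) \<partial>lborel)"
        by (intro nn_integral_real_affine) auto
      then show "(\<integral>\<^sup>+w. g x (x + w) \<partial>lborel) = (\<integral>\<^sup>+y. g x y \<partial>lborel)" by simp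
    qed
    also have "\<dots> = dirichlet f" by (simp add: dirichlet_def g_def)
    finally show ?thesis .
  qed
  have "(\<integral>\<^sup>+x. \<integral>\<^sup>+u. indicator A x * indicator U u * ennreal (\<rho> x * (cmod (f x - f u))\<^sup>2) \<partial>lborel \<partial>lborel)
      \<le> (\<integral>\<^sup>+x. \<integral>\<^sup>+u. ennreal (real n * B) * (\<Sum>i<n. g (?z x u i) (?z x u (Suc i))) \<partial>lborel \<partial>lborel)"
    by (intro nn_integral_mono pt)
  also have "\<dots> = ennreal (real n * B) * (\<integral>\<^sup>+x. \<integral>\<^sup>+u. (\<Sum>i<n. g (?z x u i) (?z x u (Suc i))) \<partial>lborel \<partial>lborel)"
    by (subst nn_integral_cmult, measurable)+
  also have "(\<integral>\<^sup>+x. \<integral>\<^sup>+u. (\<Sum>i<n. g (?z x u i) (?z x u (Suc i))) \<partial>lborel \<partial>lborel)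
      = (\<Sum>i<n. \<integral>\<^sup>+x. \<integral>\<^sup>+u. g (?z x u i) (?z x u (Suc i)) \<partial>lborel \<partial>lborel)"
    by (subst nn_integral_sum, measurable)+
  also have "\<dots> = of_nat n * (ennreal (real n) * dirichlet f)" unfolding edge by simp
  also have "ennreal (real n * B) * (of_nat n * (ennreal (real n) * dirichlet f)) = ennreal (B * real n ^ 3) * dirichlet f"
    using B by (simp add: ennreal_of_nat_eq_real_of_nat ennreal_mult power3_eq_cube mult_ac)
  finally show ?thesis .
qed

text \<open>The centre set \<open>A1 \<union> A2\<close> left over from the drift is compared with a
  reference point \<open>u\<close>, averaged over \<open>U\<close>. Points of \<open>A1\<close>
  follow a path to \<open>U\<close>; points of \<open>A2\<close> follow a path to \<open>W\<close>
  and then jump to \<open>U\<close>, which by the triangle inequality for squares costs a factor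
  two. Hence \<open>1 + 2 = 3\<close> path terms, and \<open>2 * B' / l\<close> for the
  jump.\<close>

lemma poincare_from_paths:
  fixes V :: "real \<Rightarrow> real" and f :: "real \<Rightarrow> complex"
  assumes [measurable]: "V \<in> borel_measurable borel"
    "A1 \<in> sets borel" "A2 \<in> sets borel" "U \<in> sets borel" "W \<in> sets borel"
    and V: "\<And>x. 0 < V x" and \<theta>: "0 \<le> \<theta>" and b: "0 \<le> b"
    and drift: "\<And>x. (\<integral>\<^sup>+y. ennreal (flow x y * (V y / V x)) \<partial>lborel) + ennreal (\<theta> * \<rho> x)
      \<le> (\<integral>\<^sup>+y. ennreal (flow x y) \<partial>lborel) + ennreal (b * \<rho> x) * indicator (A1 \<union> A2) x"
    and n: "0 < n" and B: "0 \<le> B" and B': "0 \<le> B'" and l: "0 < l"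
    and U: "emeasure lborel U = ennreal l" and W: "emeasure lborel W = ennreal l"
    and path1: "\<And>x u i. x \<in> A1 \<Longrightarrow> u \<in> U \<Longrightarrow> i < n \<Longrightarrow>
      \<rho> x \<le> B * flow (x + real i * ((u - x) / real n)) (x + real (Suc i) * ((u - x) / real n))"
    and path2: "\<And>x u i. x \<in> A2 \<Longrightarrow> u \<in> W \<Longrightarrow> i < n \<Longrightarrow>
      \<rho> x \<le> B * flow (x + real i * ((u - x) / real n)) (x + real (Suc i) * ((u - x) / real n))"
    and jump: "\<And>u w. u \<in> U \<Longrightarrow> w \<in> W \<Longrightarrow> 1 \<le> B' * flow u w"
    and f: "f \<in> L2_mean_zero target"
  shows "l * \<theta> * ip f f \<le> (l + b * (3 * (B * real n ^ 3) + 2 * B' / l)) * (2 * energy f)"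
proof -
  have f2: "f \<in> L2_fun target" using f by (rule mean_zeroD)
  have [measurable]: "f \<in> borel_measurable borel" using L2_measurable[OF f2] .
  define D2 where "D2 = 2 * energy f"
  have D2: "0 \<le> D2" "dirichlet f = ennreal D2" using energy_nonneg[OF f2] dirichlet_energy[OF f2] by (auto simp: D2_def)
  have nn_ip: "(\<integral>\<^sup>+x. ennreal (\<rho> x * (cmod (F x))\<^sup>2) \<partial>lborel) = ennreal (ip F F)" if F: "F \<in> L2_fun target" for F
  proof -
    have [measurable]: "F \<in> borel_measurable borel" using L2_measurable[OF F] .
    have "ennreal (ip F F) = (\<integral>\<^sup>+x. ennreal ((cmod (F x))\<^sup>2) \<partial>target)"
      unfolding ip_self by (rule nn_integral_eq_integral[OF L2_integrable_norm[OF F], symmetric]) simp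
    also have "\<dots> = (\<integral>\<^sup>+x. ennreal (\<rho> x) * ennreal ((cmod (F x))\<^sup>2) \<partial>lborel)"
      by (rule nn_integral_target) measurable
    finally show ?thesis by (simp add: ennreal_mult''[symmetric])
  qed
  define h where "h x u = ennreal (\<rho> x * (cmod (f x - f u))\<^sup>2)" for x u
  define j where "j u w = ennreal ((cmod (f u - f w))\<^sup>2)" for u w
  define P where "P A S = (\<integral>\<^sup>+x. \<integral>\<^sup>+u. indicator A x * indicator S u * h x u \<partial>lborel \<partial>lborel)" for A S :: "real set"
  have h_comp[measurable (raw)]: "(\<lambda>x. h (a x) (c x)) \<in> borel_measurable N"
    if [measurable]: "a \<in> borel_measurable N" "c \<in> borel_measurable N" for a c and N :: "'c measure"
    unfolding h_def by measurable
  have j_comp[measurable (raw)]: "(\<lambda>x. j (a x) (c x)) \<in> borel_measurable N"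
    if [measurable]: "a \<in> borel_measurable N" "c \<in> borel_measurable N" for a c and N :: "'c measure"
    unfolding j_def by measurable
  \<comment> \<open>The mean-zero function \<open>f\<close> minimizes the squared norm among its
    shifts by constants, so the drift inequality may be applied to \<open>f - f u\<close> for any
    reference point \<open>u\<close>.\<close>
  have step1: "ennreal \<theta> * ennreal (ip f f) \<le> dirichlet f + ennreal b * (\<integral>\<^sup>+x. indicator (A1 \<union> A2) x * h x u \<partial>lborel)" for u
  proof -
    let ?F = "\<lambda>x. f x + (- f u)"
    have F2: "?F \<in> L2_fun target" by (intro L2_add f2 L2_const)
    have "ip f f \<le> ip ?F ?F"
      unfolding energy_shift(2)[OF f2] using mean_zeroD(2)[OF f] by simp
    then have "ennreal \<theta> * ennreal (ip f f) \<le> ennreal \<theta> * (\<integral>\<^sup>+x. ennreal (\<rho> x * (cmod (?F x))\<^sup>2) \<partial>lborel)"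
      unfolding nn_ip[OF F2] by (intro mult_left_mono ennreal_leI) auto
    also have "\<dots> \<le> dirichlet ?F + ennreal b * (\<integral>\<^sup>+x. indicator (A1 \<union> A2) x * ennreal (\<rho> x * (cmod (?F x))\<^sup>2) \<partial>lborel)"
      by (rule drift_inequality[OF _ _ _ V \<theta> b _ drift]) (use nn_ip[OF F2] in auto)
    also have "dirichlet ?F = dirichlet f" by (simp add: dirichlet_def)
    finally show ?thesis by (simp add: h_def)
  qed
  have swapP: "(\<integral>\<^sup>+u. indicator S u * (\<integral>\<^sup>+x. indicator A x * h x u \<partial>lborel) \<partial>lborel) = P A S"
    if [measurable]: "A \<in> sets borel" "S \<in> sets borel" for A S
  proof -
    have m: "(\<lambda>(x, u). indicator A x * indicator S u * h x u) \<in> borel_measurable (lborel \<Otimes>\<^sub>M lborel)" by measurable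
    have "(\<integral>\<^sup>+u. indicator S u * (\<integral>\<^sup>+x. indicator A x * h x u \<partial>lborel) \<partial>lborel)
        = (\<integral>\<^sup>+u. \<integral>\<^sup>+x. indicator S u * (indicator A x * h x u) \<partial>lborel \<partial>lborel)"
      by (intro nn_integral_cong nn_integral_cmult[symmetric]) measurable
    also have "\<dots> = (\<integral>\<^sup>+u. \<integral>\<^sup>+x. indicator A x * indicator S u * h x u \<partial>lborel \<partial>lborel)"
      by (intro nn_integral_cong) (simp add: mult_ac)
    also have "\<dots> = P A S" unfolding P_def by (rule lborel_pair.Fubini'[OF m])
    finally show ?thesis .
  qed
  have const: "(\<integral>\<^sup>+u. indicator S u * c \<partial>lborel) = emeasure lborel S * c" if "S \<in> sets borel" for S and c :: ennreal
    using that by (simp add: nn_integral_multc)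
  have "ennreal l * (ennreal \<theta> * ennreal (ip f f)) = (\<integral>\<^sup>+u. indicator U u * (ennreal \<theta> * ennreal (ip f f)) \<partial>lborel)"
    by (simp add: const U)
  also have "\<dots> \<le> (\<integral>\<^sup>+u. indicator U u * (dirichlet f + ennreal b * (\<integral>\<^sup>+x. indicator (A1 \<union> A2) x * h x u \<partial>lborel)) \<partial>lborel)"
    by (intro nn_integral_mono mult_left_mono step1) auto
  also have "\<dots> = (\<integral>\<^sup>+u. indicator U u * dirichlet f + ennreal b * (indicator U u * (\<integral>\<^sup>+x. indicator (A1 \<union> A2) x * h x u \<partial>lborel)) \<partial>lborel)"
    by (intro nn_integral_cong) (simp add: distrib_left mult_ac)
  also have "\<dots> = ennreal l * dirichlet f + ennreal b * P (A1 \<union> A2) U"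
    unfolding swapP[of "A1 \<union> A2" U, OF sets.Un[OF assms(2,3)] assms(4), symmetric]
    by (subst nn_integral_add, measurable) (simp add: const U nn_integral_cmult)
  finally have main: "ennreal l * (ennreal \<theta> * ennreal (ip f f)) \<le> ennreal l * dirichlet f + ennreal b * P (A1 \<union> A2) U" .
  have "P (A1 \<union> A2) U \<le> (\<integral>\<^sup>+x. (\<integral>\<^sup>+u. indicator A1 x * indicator U u * h x u \<partial>lborel)
      + (\<integral>\<^sup>+u. indicator A2 x * indicator U u * h x u \<partial>lborel) \<partial>lborel)"
    unfolding P_def
    by (intro nn_integral_mono, subst nn_integral_add[symmetric], measurable)
      (auto intro!: nn_integral_mono split: split_indicator)
  also have "\<dots> = P A1 U + P A2 U"
    unfolding P_def by (rule nn_integral_add) measurable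
  finally have Psplit: "P (A1 \<union> A2) U \<le> P A1 U + P A2 U" .
  have P1: "P A1 U \<le> ennreal (B * real n ^ 3) * dirichlet f"
    unfolding P_def h_def by (rule path_bound[OF _ _ _ n B path1]) auto
  have P2: "P A2 W \<le> ennreal (B * real n ^ 3) * dirichlet f"
    unfolding P_def h_def by (rule path_bound[OF _ _ _ n B path2]) auto
  define Q where "Q = (\<integral>\<^sup>+u. \<integral>\<^sup>+w. indicator U u * indicator W w * j u w \<partial>lborel \<partial>lborel)"
  have "Q \<le> (\<integral>\<^sup>+u. \<integral>\<^sup>+w. ennreal B' * ennreal (flow u w * (cmod (f u - f w))\<^sup>2) \<partial>lborel \<partial>lborel)"
    unfolding Q_def
  proof (intro nn_integral_mono)
    fix u w
    show "indicator U u * indicator W w * j u w \<le> ennreal B' * ennreal (flow u w * (cmod (f u - f w))\<^sup>2)"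
    proof (cases "u \<in> U \<and> w \<in> W")
      case True
      then have "1 * (cmod (f u - f w))\<^sup>2 \<le> (B' * flow u w) * (cmod (f u - f w))\<^sup>2"
        using jump by (intro mult_right_mono) auto
      then show ?thesis using True B' by (simp add: j_def ennreal_mult'[symmetric] ennreal_leI mult_ac)
    qed (auto split: split_indicator)
  qed
  also have "\<dots> = ennreal B' * dirichlet f"
    unfolding dirichlet_def by (subst nn_integral_cmult, measurable)+
  finally have Q: "Q \<le> ennreal B' * dirichlet f" .
  \<comment> \<open>An auxiliary point \<open>w\<close> is averaged over \<open>W\<close>, which has
    measure \<open>l\<close>. The jump part then decouples: the mass of \<open>A2\<close> multiplies
    the integral \<open>Q\<close>, which involves only \<open>u\<close> and
    \<open>w\<close>.\<close>
  have pt: "ennreal l * (\<integral>\<^sup>+u. indicator A2 x * indicator U u * h x u \<partial>lborel)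
      \<le> 2 * ennreal l * (\<integral>\<^sup>+w. indicator A2 x * indicator W w * h x w \<partial>lborel) + 2 * (indicator A2 x * ennreal (\<rho> x)) * Q" for x
  proof -
    have "ennreal l * (\<integral>\<^sup>+u. indicator A2 x * indicator U u * h x u \<partial>lborel)
        = (\<integral>\<^sup>+u. ennreal l * (indicator A2 x * indicator U u * h x u) \<partial>lborel)"
      by (rule nn_integral_cmult[symmetric]) measurable
    also have "\<dots> = (\<integral>\<^sup>+u. \<integral>\<^sup>+w. indicator W w * (indicator A2 x * indicator U u * h x u) \<partial>lborel \<partial>lborel)"
      by (simp add: const W)
    also have "\<dots> \<le> (\<integral>\<^sup>+u. \<integral>\<^sup>+w. 2 * indicator U u * (indicator A2 x * indicator W w * h x w)
        + 2 * (indicator A2 x * ennreal (\<rho> x)) * (indicator U u * indicator W w * j u w) \<partial>lborel \<partial>lborel)"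
    proof (intro nn_integral_mono)
      fix u w
      have "cmod (f x - f u) \<le> cmod (f x - f w) + cmod (f u - f w)"
        using norm_triangle_ineq4[of "f x - f w" "f u - f w"] by simp
      then have "(cmod (f x - f u))\<^sup>2 \<le> (cmod (f x - f w) + cmod (f u - f w))\<^sup>2" by (intro power_mono) auto
      also have "\<dots> \<le> 2 * (cmod (f x - f w))\<^sup>2 + 2 * (cmod (f u - f w))\<^sup>2"
        using sum_squares_bound[of "cmod (f x - f w)" "cmod (f u - f w)"] by (simp add: power2_sum)
      finally have "\<rho> x * (cmod (f x - f u))\<^sup>2 \<le> \<rho> x * (2 * (cmod (f x - f w))\<^sup>2 + 2 * (cmod (f u - f w))\<^sup>2)"
        using \<rho>_pos[of x] by (intro mult_left_mono) auto
      then have "h x u \<le> ennreal (2 * (\<rho> x * (cmod (f x - f w))\<^sup>2) + 2 * (\<rho> x * (cmod (f u - f w))\<^sup>2))"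
        unfolding h_def by (intro ennreal_leI) (simp add: algebra_simps)
      also have "\<dots> = 2 * h x w + 2 * (ennreal (\<rho> x) * j u w)"
        using \<rho>_pos[of x] by (simp add: h_def j_def ennreal_mult less_imp_le)
      finally have "h x u \<le> 2 * h x w + 2 * (ennreal (\<rho> x) * j u w)" .
      then show "indicator W w * (indicator A2 x * indicator U u * h x u)
          \<le> 2 * indicator U u * (indicator A2 x * indicator W w * h x w)
            + 2 * (indicator A2 x * ennreal (\<rho> x)) * (indicator U u * indicator W w * j u w)"
        by (auto split: split_indicator simp: mult_ac)
    qed
    also have "\<dots> = (\<integral>\<^sup>+u. indicator U u * (2 * (\<integral>\<^sup>+w. indicator A2 x * indicator W w * h x w \<partial>lborel))
        + 2 * (indicator A2 x * ennreal (\<rho> x)) * (\<integral>\<^sup>+w. indicator U u * indicator W w * j u w \<partial>lborel) \<partial>lborel)"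
    proof (rule nn_integral_cong)
      fix u
      have a: "(\<integral>\<^sup>+w. 2 * indicator U u * (indicator A2 x * indicator W w * h x w)
          + 2 * (indicator A2 x * ennreal (\<rho> x)) * (indicator U u * indicator W w * j u w) \<partial>lborel)
        = (\<integral>\<^sup>+w. 2 * indicator U u * (indicator A2 x * indicator W w * h x w) \<partial>lborel)
          + (\<integral>\<^sup>+w. 2 * (indicator A2 x * ennreal (\<rho> x)) * (indicator U u * indicator W w * j u w) \<partial>lborel)"
        by (rule nn_integral_add) measurable
      have c: "(\<integral>\<^sup>+w. 2 * indicator U u * (indicator A2 x * indicator W w * h x w) \<partial>lborel)
          = 2 * indicator U u * (\<integral>\<^sup>+w. indicator A2 x * indicator W w * h x w \<partial>lborel)"
        by (rule nn_integral_cmult) measurable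
      have d: "(\<integral>\<^sup>+w. 2 * (indicator A2 x * ennreal (\<rho> x)) * (indicator U u * indicator W w * j u w) \<partial>lborel)
          = 2 * (indicator A2 x * ennreal (\<rho> x)) * (\<integral>\<^sup>+w. indicator U u * indicator W w * j u w \<partial>lborel)"
        by (rule nn_integral_cmult) measurable
      show "(\<integral>\<^sup>+w. 2 * indicator U u * (indicator A2 x * indicator W w * h x w)
          + 2 * (indicator A2 x * ennreal (\<rho> x)) * (indicator U u * indicator W w * j u w) \<partial>lborel)
        = indicator U u * (2 * (\<integral>\<^sup>+w. indicator A2 x * indicator W w * h x w \<partial>lborel))
          + 2 * (indicator A2 x * ennreal (\<rho> x)) * (\<integral>\<^sup>+w. indicator U u * indicator W w * j u w \<partial>lborel)"
        unfolding a c d by (simp only: mult_ac)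
    qed
    also have "\<dots> = 2 * ennreal l * (\<integral>\<^sup>+w. indicator A2 x * indicator W w * h x w \<partial>lborel) + 2 * (indicator A2 x * ennreal (\<rho> x)) * Q"
    proof -
      define Z where "Z = (\<integral>\<^sup>+w. indicator A2 x * indicator W w * h x w \<partial>lborel)"
      define c where "c = 2 * (indicator A2 x * ennreal (\<rho> x))"
      have "(\<integral>\<^sup>+u. indicator U u * (2 * Z) + c * (\<integral>\<^sup>+w. indicator U u * indicator W w * j u w \<partial>lborel) \<partial>lborel)
          = (\<integral>\<^sup>+u. indicator U u * (2 * Z) \<partial>lborel) + (\<integral>\<^sup>+u. c * (\<integral>\<^sup>+w. indicator U u * indicator W w * j u w \<partial>lborel) \<partial>lborel)"
        by (rule nn_integral_add) measurable
      also have "(\<integral>\<^sup>+u. c * (\<integral>\<^sup>+w. indicator U u * indicator W w * j u w \<partial>lborel) \<partial>lborel) = c * Q"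
        unfolding Q_def by (rule nn_integral_cmult) measurable
      also have "(\<integral>\<^sup>+u. indicator U u * (2 * Z) \<partial>lborel) = emeasure lborel U * (2 * Z)"
        by (rule const[OF assms(4)])
      also have "\<dots> = 2 * ennreal l * Z" by (simp only: U mult_ac)
      finally show ?thesis unfolding Z_def c_def .
    qed
    finally show ?thesis .
  qed
  have "ennreal l * P A2 U = (\<integral>\<^sup>+x. ennreal l * (\<integral>\<^sup>+u. indicator A2 x * indicator U u * h x u \<partial>lborel) \<partial>lborel)"
    unfolding P_def by (rule nn_integral_cmult[symmetric]) measurable
  also have "\<dots> \<le> (\<integral>\<^sup>+x. 2 * ennreal l * (\<integral>\<^sup>+w. indicator A2 x * indicator W w * h x w \<partial>lborel) + 2 * (indicator A2 x * ennreal (\<rho> x)) * Q \<partial>lborel)"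
    by (intro nn_integral_mono pt)
  also have "\<dots> = 2 * ennreal l * P A2 W + 2 * (\<integral>\<^sup>+x. indicator A2 x * ennreal (\<rho> x) \<partial>lborel) * Q"
    unfolding P_def by (subst nn_integral_add, measurable) (simp add: nn_integral_cmult nn_integral_multc)
  also have "\<dots> \<le> 2 * ennreal l * (ennreal (B * real n ^ 3) * dirichlet f) + 2 * 1 * (ennreal B' * dirichlet f)"
  proof (intro add_mono mult_mono P2 Q mult_left_mono)
    have "(\<integral>\<^sup>+x. indicator A2 x * ennreal (\<rho> x) \<partial>lborel) \<le> (\<integral>\<^sup>+x. ennreal (\<rho> x) \<partial>lborel)"
      by (intro nn_integral_mono) (auto split: split_indicator)
    then show "(\<integral>\<^sup>+x. indicator A2 x * ennreal (\<rho> x) \<partial>lborel) \<le> 1" by (simp add: \<rho>_total)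
  qed auto
  also have "\<dots> = ennreal (2 * l * (B * real n ^ 3) * D2 + 2 * B' * D2)"
    using l B B' D2 by (simp add: ennreal_mult mult.assoc)
  finally have lP2: "ennreal l * P A2 U \<le> ennreal (2 * l * (B * real n ^ 3) * D2 + 2 * B' * D2)" .
  have P2U: "P A2 U \<le> ennreal (2 * (B * real n ^ 3) * D2 + 2 * B' / l * D2)"
  proof -
    have "2 * l * (B * real n ^ 3) * D2 + 2 * B' * D2 = l * (2 * (B * real n ^ 3) * D2 + 2 * B' / l * D2)"
      using l by (simp add: distrib_left)
    then have "ennreal l * P A2 U \<le> ennreal l * ennreal (2 * (B * real n ^ 3) * D2 + 2 * B' / l * D2)"
      using lP2 l by (simp only: ennreal_mult' less_imp_le)
    then show ?thesis using l by (subst (asm) ennreal_mult_le_mult_iff) auto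
  qed
  have "P (A1 \<union> A2) U \<le> ennreal ((B * real n ^ 3) * D2) + ennreal (2 * (B * real n ^ 3) * D2 + 2 * B' / l * D2)"
    using Psplit P1 P2U B D2 by (auto simp: ennreal_mult' intro: order_trans add_mono)
  also have "\<dots> = ennreal ((3 * (B * real n ^ 3) + 2 * B' / l) * D2)"
    using B B' D2 l by (subst ennreal_plus[symmetric]) (auto simp: algebra_simps)
  finally have "ennreal l * dirichlet f + ennreal b * P (A1 \<union> A2) U
      \<le> ennreal l * ennreal D2 + ennreal b * ennreal ((3 * (B * real n ^ 3) + 2 * B' / l) * D2)"
    unfolding D2(2) by (intro add_left_mono mult_left_mono) auto
  with main have "ennreal l * (ennreal \<theta> * ennreal (ip f f))
      \<le> ennreal l * ennreal D2 + ennreal b * ennreal ((3 * (B * real n ^ 3) + 2 * B' / l) * D2)"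
    by (rule order_trans)
  also have "\<dots> = ennreal (l * D2 + b * ((3 * (B * real n ^ 3) + 2 * B' / l) * D2))"
    using l b B B' D2 by (simp add: ennreal_mult'[symmetric])
  finally have "ennreal (l * (\<theta> * ip f f)) \<le> ennreal (l * D2 + b * ((3 * (B * real n ^ 3) + 2 * B' / l) * D2))"
    using l \<theta> by (simp add: ennreal_mult'[symmetric] ip_nonneg)
  then have "l * (\<theta> * ip f f) \<le> l * D2 + b * ((3 * (B * real n ^ 3) + 2 * B' / l) * D2)"
    using l b B B' D2 by (subst (asm) ennreal_le_iff) auto
  then show ?thesis unfolding D2_def[symmetric] by (simp add: algebra_simps)
qed

end

section \<open>The Gaussian mixture\<close>

lemma exp_uminus_le: 
  fixes t :: real
  assumes "0 \<le> t" "t \<le> 1" shows "exp (- t) \<le> 1 - t / 2"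
proof -
  have "exp (- t) = 1 / exp t" by (simp add: exp_minus inverse_eq_divide)
  also have "\<dots> \<le> 1 / (1 + t)" using assms exp_ge_add_one_self[of t] by (intro divide_left_mono) auto
  also have "\<dots> \<le> 1 - t / 2"
  proof -
    have "t * t \<le> t * 1" using assms by (intro mult_left_mono) auto
    then show ?thesis using assms by (simp add: field_simps)
  qed
  finally show ?thesis .
qed

text \<open>The threshold is dictated by \<open>drift_outside\<close>, where
  \<open>\<sigma> / 200 + 2 * \<sigma>\<^sup>2 \<le> \<sigma> / 108\<close> is required; elsewhere
  much weaker smallness would do.\<close>

locale metropolis_mixture =
  fixes \<sigma> :: real
  assumes \<sigma>_pos: "0 < \<sigma>" and \<sigma>_small: "\<sigma> \<le> 1 / 500"
begin

definition peak :: real where "peak = 1 / sqrt (2 * pi * \<sigma>\<^sup>2)"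

text \<open>The squared distance to the nearer mode. The density agrees with
  \<open>peak * exp (- well x / (2 * \<sigma>\<^sup>2))\<close> up to a factor two, since one of the
  two Gaussians always dominates; nearly all later estimates work with this form.\<close>

definition well :: "real \<Rightarrow> real" where "well x = (\<bar>x\<bar> - 1)\<^sup>2"

lemma peak_bounds: "1 / (3 * \<sigma>) \<le> peak" "peak \<le> 1 / (2 * \<sigma>)"
proof -
  have p: "3 < pi" "pi < 4" using pi_gt3 pi_less_4 by auto
  have "(2 * \<sigma>)\<^sup>2 \<le> 2 * pi * \<sigma>\<^sup>2"
    using mult_right_mono[of 4 "2 * pi" "\<sigma>\<^sup>2"] p by (simp add: power_mult_distrib)
  then have a: "2 * \<sigma> \<le> sqrt (2 * pi * \<sigma>\<^sup>2)" by (rule real_le_rsqrt)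
  have "2 * pi * \<sigma>\<^sup>2 \<le> (3 * \<sigma>)\<^sup>2"
    using mult_right_mono[of "2 * pi" 9 "\<sigma>\<^sup>2"] p by (simp add: power_mult_distrib)
  then have b: "sqrt (2 * pi * \<sigma>\<^sup>2) \<le> 3 * \<sigma>" using \<sigma>_pos by (intro real_le_lsqrt) auto
  show "1 / (3 * \<sigma>) \<le> peak" unfolding peak_def using a b \<sigma>_pos by (intro divide_left_mono) auto
  show "peak \<le> 1 / (2 * \<sigma>)" unfolding peak_def using a \<sigma>_pos by (intro divide_left_mono) auto
qed

lemma peak_pos: "0 < peak"
  using peak_bounds(1) \<sigma>_pos by (meson divide_pos_pos less_le_trans mult_pos_pos zero_less_numeral zero_less_one)

lemma normal_density_eq: "normal_density m \<sigma> x = peak * exp (- (x - m)\<^sup>2 / (2 * \<sigma>\<^sup>2))"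
  by (simp add: normal_density_def peak_def)

lemma mix_density_le: "mix_density \<sigma> x \<le> peak * exp (- well x / (2 * \<sigma>\<^sup>2))"
proof -
  have w: "well x \<le> (x - 1)\<^sup>2" "well x \<le> (x - -1)\<^sup>2"
    unfolding well_def by (auto simp: power2_eq_square algebra_simps abs_if)
  have "normal_density m \<sigma> x \<le> peak * exp (- well x / (2 * \<sigma>\<^sup>2))" if "well x \<le> (x - m)\<^sup>2" for m
    unfolding normal_density_eq using that peak_pos by (intro mult_left_mono) (auto intro!: divide_right_mono)
  from this[OF w(1)] this[OF w(2)] show ?thesis by (simp add: mix_density_def)
qed

lemma mix_density_ge: "peak / 2 * exp (- well x / (2 * \<sigma>\<^sup>2)) \<le> mix_density \<sigma> x"
proof -
  have nn: "0 \<le> normal_density m \<sigma> x" for m by simp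
  have "well x = (x - 1)\<^sup>2 \<or> well x = (x - -1)\<^sup>2"
    unfolding well_def by (auto simp: power2_eq_square algebra_simps abs_if)
  then show ?thesis
  proof
    assume "well x = (x - 1)\<^sup>2"
    then show ?thesis using nn[of "-1"] by (simp add: mix_density_def normal_density_eq[of 1])
  next
    assume "well x = (x - -1)\<^sup>2"
    then show ?thesis using nn[of 1] by (simp add: mix_density_def normal_density_eq[of "-1"])
  qed
qed

lemma mix_density_measurable[measurable]: "mix_density \<sigma> \<in> borel_measurable borel"
  unfolding mix_density_def[abs_def] by measurable

lemma mix_density_pos: "0 < mix_density \<sigma> x"
  unfolding mix_density_def using normal_density_pos[OF \<sigma>_pos] by (simp add: add_pos_pos)

lemma mix_total: "(\<integral>\<^sup>+x. ennreal (mix_density \<sigma> x) \<partial>lborel) = 1"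
proof -
  have i: "integrable lborel (mix_density \<sigma>)" unfolding mix_density_def[abs_def] using \<sigma>_pos by simp
  have "(LINT x|lborel. mix_density \<sigma> x) = 1" unfolding mix_density_def using \<sigma>_pos by simp
  then show ?thesis
    using nn_integral_eq_integral[OF i] mix_density_pos by (simp add: less_imp_le)
qed

sublocale rwm_target \<sigma> "mix_density \<sigma>"
  by (rule rwm_target.intro) (use \<sigma>_pos mix_density_pos mix_total in auto)

lemma target_eq: "target = mix_measure \<sigma>"
  by (simp add: target_def mix_measure_def)

lemma K_mix_eq: "rwm_kernel \<sigma> (mix_density \<sigma>) = K_mix \<sigma>"
  by (simp add: K_mix_def)

lemma ratio_le: "mix_density \<sigma> y / mix_density \<sigma> x \<le> 2 * exp ((well x - well y) / (2 * \<sigma>\<^sup>2))"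
proof -
  have "mix_density \<sigma> y / mix_density \<sigma> x \<le> (peak * exp (- well y / (2 * \<sigma>\<^sup>2))) / (peak / 2 * exp (- well x / (2 * \<sigma>\<^sup>2)))"
    using mix_density_le mix_density_ge peak_pos by (intro frac_le) auto
  also have "\<dots> = 2 * exp ((well x - well y) / (2 * \<sigma>\<^sup>2))"
    using peak_pos by (simp add: exp_minus exp_diff diff_divide_distrib field_simps)
  finally show ?thesis .
qed

lemma ratio_ge: "exp ((well x - well y) / (2 * \<sigma>\<^sup>2)) / 2 \<le> mix_density \<sigma> y / mix_density \<sigma> x"
proof -
  have "exp ((well x - well y) / (2 * \<sigma>\<^sup>2)) / 2 = (peak / 2 * exp (- well y / (2 * \<sigma>\<^sup>2))) / (peak * exp (- well x / (2 * \<sigma>\<^sup>2)))"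
    using peak_pos by (simp add: exp_minus exp_diff diff_divide_distrib field_simps)
  also have "\<dots> \<le> mix_density \<sigma> y / mix_density \<sigma> x"
    using mix_density_le mix_density_ge mix_density_pos peak_pos by (intro frac_le) (auto simp: less_imp_le)
  finally show ?thesis .
qed

lemma flow_ratio: "flow x y = mix_density \<sigma> x * (normal_density 0 \<sigma> (y - x) * min 1 (mix_density \<sigma> y / mix_density \<sigma> x))"
  using mix_density_pos[of x] by (auto simp: flow_def min_def field_simps)

lemma nn_normal: "(\<integral>\<^sup>+y. ennreal (normal_density 0 s (y - x)) \<partial>lborel) = 1" if "0 < s"
proof -
  have nd: "normal_density 0 s (y - x) = normal_density x s y" for y by (simp add: normal_density_def)
  show ?thesis
    using nn_integral_eq_integral[OF integrable_normal_density[OF that, of x]] integral_normal_density[OF that, of x]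
    unfolding nd by simp
qed

text \<open>Outside \<open>[-3, 3]\<close> a proposal away from the origin is accepted with probability at most
  \<open>2 exp (- 2 d / \<sigma>\<^sup>2)\<close>, where \<open>d\<close> is the increase of \<open>|x|\<close>, and so contributes only \<open>O(\<sigma>\<^sup>2)\<close> to the
  drift of \<open>exp |x|\<close>, whereas proposals towards the origin contribute order \<open>\<sigma>\<close>.\<close>

lemma drift_outside_pointwise:
  assumes x: "3 < \<bar>x\<bar>"
    and I: "I = (if 0 < x then {x - 2 * \<sigma>..x - \<sigma>} else {x + \<sigma>..x + 2 * \<sigma>})"
  shows "min 1 (mix_density \<sigma> y / mix_density \<sigma> x) * (exp \<bar>y\<bar> / exp \<bar>x\<bar>) + \<sigma> / 4 * indicator I y
    \<le> min 1 (mix_density \<sigma> y / mix_density \<sigma> x) + 2 * \<sigma>\<^sup>2"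
proof -
  define a where "a = min 1 (mix_density \<sigma> y / mix_density \<sigma> x)"
  have a: "0 \<le> a" "a \<le> 1" using mix_density_pos by (auto simp: a_def less_imp_le)
  show ?thesis
  proof (cases "y \<in> I")
    case True
    have y: "\<bar>y\<bar> \<le> \<bar>x\<bar> - \<sigma>" "1 \<le> \<bar>y\<bar>"
      using True x \<sigma>_pos \<sigma>_small unfolding I by (auto simp: abs_if split: if_splits)
    have "well y \<le> well x" unfolding well_def using y \<sigma>_pos by (intro power_mono) auto
    then have "0 \<le> (well x - well y) / (2 * \<sigma>\<^sup>2)" by (intro divide_nonneg_nonneg) auto
    then have "1 \<le> exp ((well x - well y) / (2 * \<sigma>\<^sup>2))" by simp
    then have "1 / 2 \<le> mix_density \<sigma> y / mix_density \<sigma> x" using ratio_ge[of x y] by linarith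
    \<comment> \<open>The move lowers \<open>well\<close>; the factor \<open>1/2\<close> is the
      price of comparing the mixture with its dominant component. Half of the gain
      \<open>\<sigma> / 2\<close> is then the \<open>\<sigma> / 4\<close> of the claim.\<close>
    then have a2: "1 / 2 \<le> a" by (simp add: a_def)
    have "exp \<bar>y\<bar> / exp \<bar>x\<bar> = exp (\<bar>y\<bar> - \<bar>x\<bar>)" by (simp add: exp_diff)
    also have "\<dots> \<le> exp (- \<sigma>)" using y by simp
    also have "\<dots> \<le> 1 - \<sigma> / 2" using \<sigma>_pos \<sigma>_small by (intro exp_uminus_le) auto
    finally have "a * (exp \<bar>y\<bar> / exp \<bar>x\<bar>) \<le> a * (1 - \<sigma> / 2)" using a by (intro mult_left_mono) auto
    also have "\<dots> = a - a * (\<sigma> / 2)" by (simp add: algebra_simps)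
    also have "\<dots> \<le> a - (1 / 2) * (\<sigma> / 2)" using a2 \<sigma>_pos by (intro diff_left_mono mult_right_mono) auto
    finally have "a * (exp \<bar>y\<bar> / exp \<bar>x\<bar>) + \<sigma> / 4 \<le> a + 2 * \<sigma>\<^sup>2" using zero_le_power2[of \<sigma>] by linarith
    then show ?thesis using True by (simp add: a_def)
  next
    case False
    show ?thesis
    proof (cases "\<bar>y\<bar> \<le> \<bar>x\<bar>")
      case True
      then have "exp \<bar>y\<bar> / exp \<bar>x\<bar> \<le> 1" by simp
      then have "a * (exp \<bar>y\<bar> / exp \<bar>x\<bar>) \<le> a * 1" using a by (intro mult_left_mono) auto
      then have "a * (exp \<bar>y\<bar> / exp \<bar>x\<bar>) + 0 \<le> a + 2 * \<sigma>\<^sup>2" by (intro add_mono) auto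
      then show ?thesis using False unfolding a_def[symmetric] by simp
    next
      case y: False
      define d where "d = \<bar>y\<bar> - \<bar>x\<bar>"
      have d: "0 < d" using y by (simp add: d_def)
      have s2: "0 < \<sigma>\<^sup>2" "\<sigma>\<^sup>2 \<le> 1" using \<sigma>_pos \<sigma>_small by (auto intro: power_le_one)
      have "well y - well x = d * (\<bar>x\<bar> + \<bar>y\<bar> - 2)" by (simp add: well_def d_def power2_eq_square algebra_simps)
      \<comment> \<open>Both \<open>|x|\<close> and \<open>|y|\<close> exceed \<open>3\<close>, so
        \<open>well\<close> grows at rate at least \<open>4\<close> there; divided by
        \<open>2 * \<sigma>\<^sup>2\<close> this gives the exponent
        \<open>2 * d / \<sigma>\<^sup>2\<close>.\<close>
      also have "\<dots> \<ge> d * 4" using d x y by (intro mult_left_mono) auto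
      finally have w: "4 * d \<le> well y - well x" by simp
      have "a \<le> 2 * exp ((well x - well y) / (2 * \<sigma>\<^sup>2))" using ratio_le[of y x] by (simp add: a_def min_le_iff_disj)
      also have "\<dots> \<le> 2 * exp (- 2 * d / \<sigma>\<^sup>2)"
      proof -
        have "(well x - well y) / (2 * \<sigma>\<^sup>2) \<le> (- 4 * d) / (2 * \<sigma>\<^sup>2)" using w s2 by (intro divide_right_mono) auto
        then show ?thesis by simp
      qed
      finally have a2: "a \<le> 2 * exp (- 2 * d / \<sigma>\<^sup>2)" .
      have e: "exp \<bar>y\<bar> / exp \<bar>x\<bar> = exp d" by (simp add: exp_diff d_def)
      have "1 - d \<le> exp (- d)" using exp_ge_add_one_self[of "- d"] by simp
      then have "exp d * (1 - d) \<le> exp d * exp (- d)" by (intro mult_left_mono) auto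
      then have ed: "exp d - 1 \<le> d * exp d" by (simp add: exp_minus algebra_simps)
      have "a * (exp d - 1) \<le> (2 * exp (- 2 * d / \<sigma>\<^sup>2)) * (d * exp d)"
        using a2 ed a d by (intro mult_mono) auto
      also have "\<dots> = 2 * d * exp (d - 2 * d / \<sigma>\<^sup>2)" by (simp add: exp_diff exp_minus field_simps)
      also have "\<dots> \<le> 2 * d * exp (- (d / \<sigma>\<^sup>2))"
      proof -
        have "d * \<sigma>\<^sup>2 \<le> d * 1" using s2 d by (intro mult_left_mono) auto
        then have "d \<le> d / \<sigma>\<^sup>2" using s2 by (simp add: field_simps)
        then show ?thesis using d by (intro mult_left_mono) auto
      qed
      also have "\<dots> = 2 * \<sigma>\<^sup>2 * ((d / \<sigma>\<^sup>2) * exp (- (d / \<sigma>\<^sup>2)))" using s2 by simp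
      also have "\<dots> \<le> 2 * \<sigma>\<^sup>2 * 1"
      proof (intro mult_left_mono)
        have "d / \<sigma>\<^sup>2 \<le> exp (d / \<sigma>\<^sup>2)" using exp_ge_add_one_self[of "d / \<sigma>\<^sup>2"] by linarith
        then have "(d / \<sigma>\<^sup>2) * exp (- (d / \<sigma>\<^sup>2)) \<le> exp (d / \<sigma>\<^sup>2) * exp (- (d / \<sigma>\<^sup>2))" by (intro mult_right_mono) auto
        then show "(d / \<sigma>\<^sup>2) * exp (- (d / \<sigma>\<^sup>2)) \<le> 1" by (simp flip: exp_add)
      qed auto
      finally show ?thesis using False unfolding a_def[symmetric] e by (simp add: algebra_simps)
    qed
  qed
qed

text \<open>The interval \<open>I\<close> of length \<open>\<sigma>\<close> lies between one and two
  standard deviations towards the origin, where the proposal density is at least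
  \<open>1 / (27 * \<sigma>)\<close>. With the pointwise gain \<open>\<sigma> / 4\<close> this
  yields \<open>\<sigma> / 108\<close>; the outward loss of at most
  \<open>2 * \<sigma>\<^sup>2\<close> leaves \<open>\<sigma> / 200\<close>.\<close>

lemma drift_outside:
  assumes x: "3 < \<bar>x\<bar>"
  shows "(\<integral>\<^sup>+y. ennreal (flow x y * (exp \<bar>y\<bar> / exp \<bar>x\<bar>)) \<partial>lborel) + ennreal (\<sigma> / 200 * mix_density \<sigma> x)
      \<le> (\<integral>\<^sup>+y. ennreal (flow x y) \<partial>lborel)"
proof -
  define I where "I = (if 0 < x then {x - 2 * \<sigma>..x - \<sigma>} else {x + \<sigma>..x + 2 * \<sigma>})"
  have [measurable]: "I \<in> sets borel" by (simp add: I_def)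
  have Il: "emeasure lborel I = ennreal \<sigma>" using \<sigma>_pos by (simp add: I_def)
  let ?r = "mix_density \<sigma> x"
  let ?q = "\<lambda>y. normal_density 0 \<sigma> (y - x)"
  have r: "0 < ?r" by (rule mix_density_pos)
  have qI: "1 / (27 * \<sigma>) \<le> ?q y" if "y \<in> I" for y
  proof -
    have "\<bar>y - x\<bar> \<le> 2 * \<sigma>" using that \<sigma>_pos by (auto simp: I_def split: if_splits)
    then have "(y - x)\<^sup>2 \<le> (2 * \<sigma>)\<^sup>2" by (rule power2_le_iff_abs_le[THEN iffD2, rotated]) (use \<sigma>_pos in simp)
    then have "(y - x)\<^sup>2 / (2 * \<sigma>\<^sup>2) \<le> 4 * \<sigma>\<^sup>2 / (2 * \<sigma>\<^sup>2)" by (intro divide_right_mono) (auto simp: power_mult_distrib)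
    then have "exp (- 2) \<le> exp (- (y - x)\<^sup>2 / (2 * \<sigma>\<^sup>2))" using \<sigma>_pos by simp
    moreover have "1 / 9 \<le> exp (- 2 :: real)"
    proof -
      have "exp (2::real) = exp 1 * exp 1" by (simp flip: exp_add)
      also have "\<dots> \<le> 3 * 3" using exp_le by (intro mult_mono) auto
      finally show ?thesis by (simp add: exp_minus divide_simps)
    qed
    ultimately have "1 / 9 \<le> exp (- (y - x)\<^sup>2 / (2 * \<sigma>\<^sup>2))" by linarith
    then have "1 / (3 * \<sigma>) * (1 / 9) \<le> peak * exp (- (y - x)\<^sup>2 / (2 * \<sigma>\<^sup>2))"
      using peak_bounds(1) peak_pos by (intro mult_mono) auto
    then show ?thesis unfolding normal_density_eq by simp
  qed
  have "(\<integral>\<^sup>+y. ennreal (flow x y * (exp \<bar>y\<bar> / exp \<bar>x\<bar>)) \<partial>lborel) + ennreal (?r * (\<sigma> / 108))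
      \<le> (\<integral>\<^sup>+y. ennreal (flow x y * (exp \<bar>y\<bar> / exp \<bar>x\<bar>)) \<partial>lborel) + (\<integral>\<^sup>+y. ennreal (?r * (?q y * (\<sigma> / 4 * indicator I y))) \<partial>lborel)"
  proof (rule add_left_mono)
    have "ennreal (?r * (\<sigma> / 108)) = ennreal (?r * (1 / (27 * \<sigma>) * (\<sigma> / 4))) * emeasure lborel I"
      unfolding Il using \<sigma>_pos r by (subst ennreal_mult'[symmetric]) (auto simp: field_simps)
    also have "\<dots> = (\<integral>\<^sup>+y. ennreal (?r * (1 / (27 * \<sigma>) * (\<sigma> / 4))) * indicator I y \<partial>lborel)"
      by (simp add: nn_integral_cmult_indicator)
    also have "\<dots> \<le> (\<integral>\<^sup>+y. ennreal (?r * (?q y * (\<sigma> / 4 * indicator I y))) \<partial>lborel)"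
    proof (rule nn_integral_mono)
      fix y
      show "ennreal (?r * (1 / (27 * \<sigma>) * (\<sigma> / 4))) * indicator I y \<le> ennreal (?r * (?q y * (\<sigma> / 4 * indicator I y)))"
      proof (cases "y \<in> I")
        case True
        have "?r * (1 / (27 * \<sigma>) * (\<sigma> / 4)) \<le> ?r * (?q y * (\<sigma> / 4))"
          using qI[OF True] r \<sigma>_pos by (intro mult_left_mono mult_right_mono) auto
        then show ?thesis using True by (simp add: ennreal_leI)
      qed simp
    qed
    finally show "ennreal (?r * (\<sigma> / 108)) \<le> (\<integral>\<^sup>+y. ennreal (?r * (?q y * (\<sigma> / 4 * indicator I y))) \<partial>lborel)" .
  qed
  also have "\<dots> = (\<integral>\<^sup>+y. ennreal (flow x y * (exp \<bar>y\<bar> / exp \<bar>x\<bar>)) + ennreal (?r * (?q y * (\<sigma> / 4 * indicator I y))) \<partial>lborel)"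
    by (rule nn_integral_add[symmetric]) measurable
  also have "\<dots> \<le> (\<integral>\<^sup>+y. ennreal (flow x y) + ennreal (?r * (2 * \<sigma>\<^sup>2)) * ennreal (?q y) \<partial>lborel)"
  proof (rule nn_integral_mono)
    fix y
    have "flow x y * (exp \<bar>y\<bar> / exp \<bar>x\<bar>) + ?r * (?q y * (\<sigma> / 4 * indicator I y))
        = ?r * ?q y * (min 1 (mix_density \<sigma> y / ?r) * (exp \<bar>y\<bar> / exp \<bar>x\<bar>) + \<sigma> / 4 * indicator I y)"
      unfolding flow_ratio by (simp only: algebra_simps)
    also have "\<dots> \<le> ?r * ?q y * (min 1 (mix_density \<sigma> y / ?r) + 2 * \<sigma>\<^sup>2)"
      using drift_outside_pointwise[OF x I_def] r by (intro mult_left_mono) auto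
    also have "\<dots> = flow x y + ?r * (2 * \<sigma>\<^sup>2) * ?q y" unfolding flow_ratio by (simp only: algebra_simps)
    finally have "ennreal (flow x y * (exp \<bar>y\<bar> / exp \<bar>x\<bar>) + ?r * (?q y * (\<sigma> / 4 * indicator I y))) \<le> ennreal (flow x y + ?r * (2 * \<sigma>\<^sup>2) * ?q y)"
      by (rule ennreal_leI)
    then show "ennreal (flow x y * (exp \<bar>y\<bar> / exp \<bar>x\<bar>)) + ennreal (?r * (?q y * (\<sigma> / 4 * indicator I y)))
        \<le> ennreal (flow x y) + ennreal (?r * (2 * \<sigma>\<^sup>2)) * ennreal (?q y)"
      using r \<sigma>_pos by (simp add: flow_nonneg ennreal_mult'[symmetric] flip: ennreal_plus)
  qed
  also have "\<dots> = (\<integral>\<^sup>+y. ennreal (flow x y) \<partial>lborel) + ennreal (?r * (2 * \<sigma>\<^sup>2))"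
    using nn_normal[OF \<sigma>_pos, of x] by (subst nn_integral_add, measurable) (simp add: nn_integral_cmult)
  finally have 1: "(\<integral>\<^sup>+y. ennreal (flow x y * (exp \<bar>y\<bar> / exp \<bar>x\<bar>)) \<partial>lborel) + ennreal (?r * (\<sigma> / 108))
      \<le> (\<integral>\<^sup>+y. ennreal (flow x y) \<partial>lborel) + ennreal (?r * (2 * \<sigma>\<^sup>2))" .
  have 2: "ennreal (\<sigma> / 200 * ?r) + ennreal (?r * (2 * \<sigma>\<^sup>2)) \<le> ennreal (?r * (\<sigma> / 108))"
  proof -
    have "\<sigma> * \<sigma> \<le> \<sigma> * (1 / 500)" using \<sigma>_small \<sigma>_pos by (intro mult_left_mono) auto
    then have "\<sigma>\<^sup>2 \<le> \<sigma> / 500" by (simp add: power2_eq_square)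
    then have "\<sigma> / 200 + 2 * \<sigma>\<^sup>2 \<le> \<sigma> / 108" using \<sigma>_pos by linarith
    then have "?r * (\<sigma> / 200 + 2 * \<sigma>\<^sup>2) \<le> ?r * (\<sigma> / 108)" using r by (intro mult_left_mono) auto
    then show ?thesis using r \<sigma>_pos by (simp add: ennreal_leI algebra_simps flip: ennreal_plus)
  qed
  have "((\<integral>\<^sup>+y. ennreal (flow x y * (exp \<bar>y\<bar> / exp \<bar>x\<bar>)) \<partial>lborel) + (ennreal (\<sigma> / 200 * ?r) + ennreal (?r * (2 * \<sigma>\<^sup>2))))
      \<le> (\<integral>\<^sup>+y. ennreal (flow x y) \<partial>lborel) + ennreal (?r * (2 * \<sigma>\<^sup>2))"
    by (rule order_trans[OF add_left_mono[OF 2] 1])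
  then have "ennreal (?r * (2 * \<sigma>\<^sup>2)) + ((\<integral>\<^sup>+y. ennreal (flow x y * (exp \<bar>y\<bar> / exp \<bar>x\<bar>)) \<partial>lborel) + ennreal (\<sigma> / 200 * ?r))
      \<le> ennreal (?r * (2 * \<sigma>\<^sup>2)) + (\<integral>\<^sup>+y. ennreal (flow x y) \<partial>lborel)"
    by (simp only: ac_simps)
  then show ?thesis by (subst (asm) ennreal_add_left_cancel_le) auto
qed

text \<open>Near the centre a constant bound suffices. The growth of \<open>exp |y|\<close> is
  absorbed by half of the Gaussian exponent, through \<open>|e| \<le> e\<^sup>2 / (4 *
  \<sigma>\<^sup>2) + \<sigma>\<^sup>2\<close>; what remains is a normal density with doubled
  variance, times \<open>exp (\<sigma>\<^sup>2) * sqrt 2 \<le> 4\<close>.\<close>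

lemma drift_inside:
  "(\<integral>\<^sup>+y. ennreal (flow x y * (exp \<bar>y\<bar> / exp \<bar>x\<bar>)) \<partial>lborel) + ennreal (\<sigma> / 200 * mix_density \<sigma> x)
      \<le> ennreal (5 * mix_density \<sigma> x)"
proof -
  let ?r = "mix_density \<sigma> x"
  let ?s = "sqrt 2 * \<sigma>"
  have r: "0 < ?r" by (rule mix_density_pos)
  have s2: "0 < \<sigma>\<^sup>2" "\<sigma>\<^sup>2 \<le> 1 / 2"
  proof -
    show "0 < \<sigma>\<^sup>2" using \<sigma>_pos by simp
    have "\<sigma> * \<sigma> \<le> 1 * (1 / 500)" using \<sigma>_pos \<sigma>_small by (intro mult_mono) auto
    then show "\<sigma>\<^sup>2 \<le> 1 / 2" by (simp add: power2_eq_square)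
  qed
  have pt: "flow x y * (exp \<bar>y\<bar> / exp \<bar>x\<bar>) \<le> ?r * 4 * normal_density 0 ?s (y - x)" for y
  proof -
    define e where "e = y - x"
    have "0 \<le> (\<bar>e\<bar> / (2 * \<sigma>) - \<sigma>)\<^sup>2" by simp
    then have amgm: "\<bar>e\<bar> \<le> e\<^sup>2 / (4 * \<sigma>\<^sup>2) + \<sigma>\<^sup>2"
      using \<sigma>_pos by (simp add: power2_diff power_divide power_mult_distrib)
    have "exp \<bar>y\<bar> / exp \<bar>x\<bar> = exp (\<bar>y\<bar> - \<bar>x\<bar>)" by (simp add: exp_diff)
    also have "\<dots> \<le> exp \<bar>e\<bar>" by (simp add: e_def)
    finally have 1: "exp \<bar>y\<bar> / exp \<bar>x\<bar> \<le> exp \<bar>e\<bar>" .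
    have "flow x y * (exp \<bar>y\<bar> / exp \<bar>x\<bar>) \<le> (?r * (normal_density 0 \<sigma> e * 1)) * exp \<bar>e\<bar>"
      unfolding flow_ratio e_def[symmetric] using r 1 by (intro mult_mono mult_left_mono) (auto simp: mix_density_pos less_imp_le)
    also have "\<dots> = ?r * (peak * exp (- e\<^sup>2 / (2 * \<sigma>\<^sup>2) + \<bar>e\<bar>))"
      by (simp only: normal_density_eq exp_add diff_zero mult_1_right mult.assoc)
    also have "\<dots> \<le> ?r * (peak * exp (\<sigma>\<^sup>2 - e\<^sup>2 / (4 * \<sigma>\<^sup>2)))"
    proof -
      have "- e\<^sup>2 / (2 * \<sigma>\<^sup>2) = - (e\<^sup>2 / (4 * \<sigma>\<^sup>2)) - e\<^sup>2 / (4 * \<sigma>\<^sup>2)" by (simp add: field_simps)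
      then have "- e\<^sup>2 / (2 * \<sigma>\<^sup>2) + \<bar>e\<bar> \<le> \<sigma>\<^sup>2 - e\<^sup>2 / (4 * \<sigma>\<^sup>2)" using amgm by linarith
      then show ?thesis using r peak_pos by (intro mult_left_mono) auto
    qed
    also have "\<dots> = ?r * (exp (\<sigma>\<^sup>2) * sqrt 2 * normal_density 0 ?s e)"
    proof -
      define t where "t = e\<^sup>2 / (4 * \<sigma>\<^sup>2)"
      have "normal_density 0 ?s e = peak / sqrt 2 * exp (- t)"
        by (simp add: normal_density_def peak_def t_def power_mult_distrib real_sqrt_mult)
      then show ?thesis unfolding t_def[symmetric] by (simp add: exp_diff exp_minus field_simps)
    qed
    also have "\<dots> \<le> ?r * (2 * 2 * normal_density 0 ?s e)"
    proof -
      have "exp (\<sigma>\<^sup>2) \<le> 2" using exp_bound_half[of "\<sigma>\<^sup>2"] s2 by simp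
      moreover have "sqrt 2 \<le> (2::real)" by (rule real_le_lsqrt) auto
      ultimately show ?thesis using r by (intro mult_left_mono mult_right_mono mult_mono) auto
    qed
    finally show ?thesis by (simp add: e_def mult_ac)
  qed
  have "(\<integral>\<^sup>+y. ennreal (flow x y * (exp \<bar>y\<bar> / exp \<bar>x\<bar>)) \<partial>lborel) \<le> (\<integral>\<^sup>+y. ennreal (?r * 4) * ennreal (normal_density 0 ?s (y - x)) \<partial>lborel)"
    using pt r by (intro nn_integral_mono) (simp add: ennreal_mult'[symmetric] ennreal_leI)
  also have "\<dots> = ennreal (?r * 4)"
    using nn_normal[of ?s x] \<sigma>_pos by (subst nn_integral_cmult) auto
  finally have "(\<integral>\<^sup>+y. ennreal (flow x y * (exp \<bar>y\<bar> / exp \<bar>x\<bar>)) \<partial>lborel) + ennreal (\<sigma> / 200 * ?r)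
      \<le> ennreal (?r * 4) + ennreal (\<sigma> / 200 * ?r)" by (rule add_right_mono)
  also have "\<dots> \<le> ennreal (5 * ?r)"
  proof -
    have "\<sigma> / 200 * ?r \<le> 1 * ?r" using r \<sigma>_small by (intro mult_right_mono) auto
    then show ?thesis using r \<sigma>_pos by (simp add: ennreal_leI flip: ennreal_plus)
  qed
  finally show ?thesis .
qed

lemma drift_condition:
  "(\<integral>\<^sup>+y. ennreal (flow x y * (exp \<bar>y\<bar> / exp \<bar>x\<bar>)) \<partial>lborel) + ennreal (\<sigma> / 200 * mix_density \<sigma> x)
      \<le> (\<integral>\<^sup>+y. ennreal (flow x y) \<partial>lborel) + ennreal (5 * mix_density \<sigma> x) * indicator ({-3..0} \<union> {0..3}) x"
proof (cases "3 < \<bar>x\<bar>")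
  case True
  show ?thesis by (rule order_trans[OF drift_outside[OF True]]) simp
next
  case False
  then have "x \<in> {-3..0} \<union> {0..3}" by auto
  then have "ennreal (5 * mix_density \<sigma> x) \<le> (\<integral>\<^sup>+y. ennreal (flow x y) \<partial>lborel) + ennreal (5 * mix_density \<sigma> x) * indicator ({-3..0} \<union> {0..3}) x"
    by simp
  then show ?thesis by (rule order_trans[OF drift_inside])
qed

section \<open>The barrier and the Poincare constant\<close>

definition barrier :: real where "barrier = exp (2 / (5 * \<sigma>\<^sup>2))"

lemma barrier_ge_1: "1 \<le> barrier"
  by (simp add: barrier_def)

lemma \<sigma>2: "0 < \<sigma>\<^sup>2" "\<sigma>\<^sup>2 \<le> 1 / 250000"
proof -
  show "0 < \<sigma>\<^sup>2" using \<sigma>_pos by simp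
  have "\<sigma>\<^sup>2 \<le> (1 / 500)\<^sup>2" using \<sigma>_pos \<sigma>_small by (intro power_mono) auto
  then show "\<sigma>\<^sup>2 \<le> 1 / 250000" by (simp add: power2_eq_square)
qed

text \<open>The sign \<open>s\<close> treats both sides at once. On one side \<open>well\<close> is
  a convex square, so along the segment it exceeds \<open>well x\<close> by at most
  \<open>(4/5)\<^sup>2\<close>, giving the factor \<open>exp (8 / (25 * \<sigma>\<^sup>2))\<close>.
  The steps have length at most \<open>3 / n \<le> \<sigma>\<close>, so their proposal density is at
  least \<open>1 / (6 * \<sigma>)\<close>; with the factor two in the density comparison this gives
  \<open>12 * \<sigma>\<close>.\<close>

lemma small_step:
  assumes n: "3 \<le> real n * \<sigma>" and s: "s\<^sup>2 = 1"
    and x: "0 \<le> s * x" "s * x \<le> 3" and u: "1 / 5 \<le> s * u" "s * u \<le> 1 / 5 + \<sigma>\<^sup>2" and i: "i < n"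
  shows "mix_density \<sigma> x \<le> 12 * \<sigma> * barrier * flow (x + real i * ((u - x) / real n)) (x + real (Suc i) * ((u - x) / real n))"
proof -
  have n0: "0 < real n" using i by simp
  define z where "z j = x + real j * ((u - x) / real n)" for j
  have w: "mix_density \<sigma> x \<le> 2 * exp (8 / (25 * \<sigma>\<^sup>2)) * mix_density \<sigma> (z j)" if j: "j \<le> n" for j
  proof -
    define t where "t = real j / real n"
    have t: "0 \<le> t" "t \<le> 1" using j n0 by (auto simp: t_def)
    define a b where "a = s * x - 1" and "b = s * u - 1"
    have zt: "s * z j = (1 - t) * (s * x) + t * (s * u)"
      using n0 by (simp add: z_def t_def field_simps)
    have u0: "0 \<le> s * u" using u by linarith
    have z0: "0 \<le> s * z j" unfolding zt using mult_nonneg_nonneg[of "1 - t" "s * x"] mult_nonneg_nonneg[of t "s * u"] t x(1) u0 by simp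
    have abs: "\<bar>v\<bar> = s * v" if "0 \<le> s * v" for v
      using that s by (auto simp: power2_eq_1_iff)
    have "well (z j) = ((1 - t) * a + t * b)\<^sup>2"
      unfolding well_def abs[OF z0] zt a_def b_def by (simp add: algebra_simps)
    also have "\<dots> = (1 - t) * a\<^sup>2 + t * b\<^sup>2 - t * (1 - t) * (a - b)\<^sup>2"
      by (simp add: power2_eq_square algebra_simps)
    also have "\<dots> \<le> (1 - t) * a\<^sup>2 + t * b\<^sup>2" using t by simp
    also have "\<dots> \<le> 1 * a\<^sup>2 + 1 * b\<^sup>2" using t by (intro add_mono mult_right_mono) auto
    also have "b\<^sup>2 \<le> (4 / 5)\<^sup>2"
      unfolding b_def using u \<sigma>2 by (intro power2_le_iff_abs_le[THEN iffD2]) auto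
    finally have "well (z j) \<le> well x + 16 / 25"
      unfolding well_def abs[OF x(1)] a_def by (simp add: power2_eq_square)
    then have "- well x / (2 * \<sigma>\<^sup>2) \<le> (16 / 25 - well (z j)) / (2 * \<sigma>\<^sup>2)"
      by (intro divide_right_mono) auto
    then have "peak * exp (- well x / (2 * \<sigma>\<^sup>2)) \<le> peak * exp (8 / (25 * \<sigma>\<^sup>2) + - well (z j) / (2 * \<sigma>\<^sup>2))"
      using peak_pos by (intro mult_left_mono) (auto simp: diff_divide_distrib)
    also have "\<dots> = 2 * exp (8 / (25 * \<sigma>\<^sup>2)) * (peak / 2 * exp (- well (z j) / (2 * \<sigma>\<^sup>2)))"
      by (subst exp_add) simp
    also have "\<dots> \<le> 2 * exp (8 / (25 * \<sigma>\<^sup>2)) * mix_density \<sigma> (z j)"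
      by (intro mult_left_mono mix_density_ge) auto
    finally show ?thesis using mix_density_le[of x] by linarith
  qed
  have "x + real (Suc i) * v - (x + real i * v) = v" for v by (simp add: algebra_simps)
  then have step: "z (Suc i) - z i = (u - x) / real n" unfolding z_def by blast
  have "s * (u - x) \<le> 3" "- 3 \<le> s * (u - x)" using x u \<sigma>2 by (auto simp: right_diff_distrib)
  then have "\<bar>u - x\<bar> \<le> 3" using s by (auto simp: power2_eq_1_iff)
  then have "\<bar>(u - x) / real n\<bar> \<le> 3 / real n" using n0 by (simp add: abs_divide divide_right_mono)
  also have "\<dots> \<le> \<sigma>" using n n0 by (simp add: field_simps)
  finally have "((u - x) / real n)\<^sup>2 \<le> \<sigma>\<^sup>2" using \<sigma>_pos by (intro power2_le_iff_abs_le[THEN iffD2]) auto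
  then have "(z (Suc i) - z i)\<^sup>2 / (2 * \<sigma>\<^sup>2) \<le> \<sigma>\<^sup>2 / (2 * \<sigma>\<^sup>2)"
    unfolding step by (intro divide_right_mono) auto
  then have "(z (Suc i) - z i)\<^sup>2 / (2 * \<sigma>\<^sup>2) \<le> 1 / 2" using \<sigma>2 by simp
  then have "exp (- 1 / 2) \<le> exp (- (z (Suc i) - z i)\<^sup>2 / (2 * \<sigma>\<^sup>2))" by simp
  moreover have "1 / 2 \<le> exp (- 1 / 2 :: real)" using exp_ge_add_one_self[of "- 1 / 2 :: real"] by simp
  ultimately have "1 / 2 \<le> exp (- (z (Suc i) - z i)\<^sup>2 / (2 * \<sigma>\<^sup>2))" by linarith
  then have q: "1 / (3 * \<sigma>) * (1 / 2) \<le> normal_density 0 \<sigma> (z (Suc i) - z i)"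
    unfolding normal_density_eq using peak_bounds(1) peak_pos by (simp only: diff_zero) (intro mult_mono, auto)
  have m: "mix_density \<sigma> x \<le> 2 * exp (8 / (25 * \<sigma>\<^sup>2)) * min (mix_density \<sigma> (z i)) (mix_density \<sigma> (z (Suc i)))"
    using w[of i] w[of "Suc i"] i by (simp add: min_def)
  also have "\<dots> \<le> 2 * barrier * min (mix_density \<sigma> (z i)) (mix_density \<sigma> (z (Suc i)))"
  proof -
    have "8 / (25 * \<sigma>\<^sup>2) \<le> 2 / (5 * \<sigma>\<^sup>2)" using \<sigma>2 by (simp add: divide_simps)
    then show ?thesis unfolding barrier_def using mix_density_pos
      by (intro mult_right_mono mult_left_mono) (auto simp: less_imp_le)
  qed
  also have "\<dots> = 12 * \<sigma> * barrier * (1 / (3 * \<sigma>) * (1 / 2) * min (mix_density \<sigma> (z i)) (mix_density \<sigma> (z (Suc i))))"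
    using \<sigma>_pos by simp
  also have "\<dots> \<le> 12 * \<sigma> * barrier * flow (z i) (z (Suc i))"
    unfolding flow_def using q \<sigma>_pos barrier_ge_1 mix_density_pos
    by (intro mult_left_mono mult_right_mono) (auto simp: less_imp_le)
  finally show ?thesis by (simp only: z_def)
qed

text \<open>The density at the endpoints costs \<open>8 / (25 * \<sigma>\<^sup>2)\<close> in the
  exponent and the proposal of length about \<open>2/5\<close> costs
  \<open>2 / (25 * \<sigma>\<^sup>2)\<close>, together exactly the exponent of
  \<open>barrier\<close>. Intervals of width \<open>\<sigma>\<^sup>2\<close> raise the exponent by
  at most \<open>1\<close>. The constant is \<open>54 = 9 * 2 * 3\<close>, from the square of
  \<open>peak\<close>, the half in the density bound, and \<open>exp (- 1)\<close>.\<close>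

lemma big_jump:
  assumes u: "u \<in> {- 1 / 5 - \<sigma>\<^sup>2..- 1 / 5}" and w: "w \<in> {1 / 5..1 / 5 + \<sigma>\<^sup>2}"
  shows "1 \<le> 54 * \<sigma>\<^sup>2 * barrier * flow u w"
proof -
  have w64: "peak / 2 * exp (- (8 / (25 * \<sigma>\<^sup>2))) \<le> mix_density \<sigma> v" if "1 / 5 \<le> \<bar>v\<bar>" "\<bar>v\<bar> \<le> 1 / 5 + \<sigma>\<^sup>2" for v
  proof -
    have "well v \<le> (4 / 5)\<^sup>2"
      unfolding well_def using that \<sigma>2 by (intro power2_le_iff_abs_le[THEN iffD2]) auto
    then have "well v / (2 * \<sigma>\<^sup>2) \<le> (16 / 25) / (2 * \<sigma>\<^sup>2)"
      by (intro divide_right_mono) (auto simp: power2_eq_square)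
    then have "peak / 2 * exp (- (8 / (25 * \<sigma>\<^sup>2))) \<le> peak / 2 * exp (- well v / (2 * \<sigma>\<^sup>2))"
      using peak_pos by (intro mult_left_mono) auto
    then show ?thesis using mix_density_ge[of v] by linarith
  qed
  have m: "peak / 2 * exp (- (8 / (25 * \<sigma>\<^sup>2))) \<le> min (mix_density \<sigma> u) (mix_density \<sigma> w)"
    using w64[of u] w64[of w] u w \<sigma>2 by auto
  have d: "0 \<le> w - u" "w - u \<le> 2 / 5 + 2 * \<sigma>\<^sup>2" using u w by auto
  have "(w - u)\<^sup>2 \<le> (2 / 5 + 2 * \<sigma>\<^sup>2)\<^sup>2" using d by (intro power_mono)
  also have "\<dots> = 4 / 25 + (8 / 5 + 4 * \<sigma>\<^sup>2) * \<sigma>\<^sup>2" by (simp add: power2_eq_square algebra_simps)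
  also have "\<dots> \<le> 4 / 25 + 2 * \<sigma>\<^sup>2" using \<sigma>2 by (intro add_left_mono mult_right_mono) auto
  finally have "(w - u)\<^sup>2 / (2 * \<sigma>\<^sup>2) \<le> (4 / 25 + 2 * \<sigma>\<^sup>2) / (2 * \<sigma>\<^sup>2)" by (intro divide_right_mono) auto
  also have "\<dots> = 2 / (25 * \<sigma>\<^sup>2) + 1" using \<sigma>2 by (simp add: field_simps)
  finally have "peak * exp (- (2 / (25 * \<sigma>\<^sup>2)) - 1) \<le> peak * exp (- (w - u)\<^sup>2 / (2 * \<sigma>\<^sup>2))"
    using peak_pos by (intro mult_left_mono) auto
  then have q: "peak * exp (- (2 / (25 * \<sigma>\<^sup>2)) - 1) \<le> normal_density 0 \<sigma> (w - u)"
    by (simp add: normal_density_eq)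
  have e1: "1 / 3 \<le> exp (- 1 :: real)" using exp_le by (simp add: exp_minus divide_simps)
  have "(peak * exp (- (2 / (25 * \<sigma>\<^sup>2)) - 1)) * (peak / 2 * exp (- (8 / (25 * \<sigma>\<^sup>2)))) \<le> flow u w"
    unfolding flow_def using q m peak_pos by (intro mult_mono) auto
  also have "(peak * exp (- (2 / (25 * \<sigma>\<^sup>2)) - 1)) * (peak / 2 * exp (- (8 / (25 * \<sigma>\<^sup>2))))
      = (peak * peak) / 2 * exp (- 1) * exp (- (2 / (25 * \<sigma>\<^sup>2)) + - (8 / (25 * \<sigma>\<^sup>2)))"
  proof -
    have "(peak * exp (- a - 1)) * (peak / 2 * exp (- b)) = (peak * peak) / 2 * exp (- 1) * exp (- a + - b)" for a b :: real
      by (simp add: exp_diff exp_minus exp_add field_simps)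
    then show ?thesis by blast
  qed
  also have "- (2 / (25 * \<sigma>\<^sup>2)) + - (8 / (25 * \<sigma>\<^sup>2)) = - (2 / (5 * \<sigma>\<^sup>2))" by (simp add: field_simps)
  finally have J: "(peak * peak) / 2 * exp (- 1) * exp (- (2 / (5 * \<sigma>\<^sup>2))) \<le> flow u w" .
  have "1 / (3 * \<sigma>) * (1 / (3 * \<sigma>)) \<le> peak * peak" using peak_bounds(1) peak_pos \<sigma>_pos by (intro mult_mono) auto
  then have pp: "(1 / (3 * \<sigma>) * (1 / (3 * \<sigma>))) / 2 \<le> (peak * peak) / 2" by (intro divide_right_mono) auto
  have "(1 / (3 * \<sigma>) * (1 / (3 * \<sigma>))) / 2 * (1 / 3) \<le> (peak * peak) / 2 * exp (- 1)"
    by (rule mult_mono[OF pp e1]) (use peak_pos in auto)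
  then have "(1 / (3 * \<sigma>) * (1 / (3 * \<sigma>))) / 2 * (1 / 3) * exp (- (2 / (5 * \<sigma>\<^sup>2)))
      \<le> (peak * peak) / 2 * exp (- 1) * exp (- (2 / (5 * \<sigma>\<^sup>2)))"
    by (intro mult_right_mono) auto
  with J have "(1 / (3 * \<sigma>) * (1 / (3 * \<sigma>))) / 2 * (1 / 3) * exp (- (2 / (5 * \<sigma>\<^sup>2))) \<le> flow u w" by linarith
  then have "54 * \<sigma>\<^sup>2 * barrier * ((1 / (3 * \<sigma>) * (1 / (3 * \<sigma>))) / 2 * (1 / 3) * exp (- (2 / (5 * \<sigma>\<^sup>2))))
      \<le> 54 * \<sigma>\<^sup>2 * barrier * flow u w"
    using barrier_ge_1 by (intro mult_left_mono) auto
  moreover have "54 * \<sigma>\<^sup>2 * barrier * ((1 / (3 * \<sigma>) * (1 / (3 * \<sigma>))) / 2 * (1 / 3) * exp (- (2 / (5 * \<sigma>\<^sup>2)))) = 1"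
  proof -
    have 1: "barrier * exp (- (2 / (5 * \<sigma>\<^sup>2))) = 1" by (simp add: barrier_def flip: exp_add)
    have 2: "54 * \<sigma>\<^sup>2 * ((1 / (3 * \<sigma>) * (1 / (3 * \<sigma>))) / 2 * (1 / 3)) = 1"
      using \<sigma>_pos by (simp add: power2_eq_square)
    have "54 * \<sigma>\<^sup>2 * barrier * (c * e) = (54 * \<sigma>\<^sup>2 * c) * (barrier * e)" for c e by simp
    then show ?thesis by (simp only: 1 2 mult_1_right)
  qed
  ultimately show ?thesis by linarith
qed

text \<open>The power collects the interval length \<open>\<sigma>\<^sup>2\<close>, the drift rate
  \<open>\<sigma> / 200\<close>, and the reciprocal of the path and jump cost
  \<open>25000 * barrier / \<sigma>\<^sup>2\<close>; the constant is
  \<open>200 * 25000\<close>.\<close>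

definition gap_bound :: real where "gap_bound = \<sigma> ^ 5 / barrier / 5000000"

lemma poincare:
  assumes f: "f \<in> L2_mean_zero target"
  shows "gap_bound * ip f f \<le> energy f"
proof -
  \<comment> \<open>Paths cover a distance of at most \<open>3\<close>, so this many steps keep each
    one within a standard deviation of the proposal.\<close>
  define n where "n = nat \<lceil>3 / \<sigma>\<rceil>"
  have n: "3 / \<sigma> \<le> real n" "real n \<le> 3 / \<sigma> + 1" using \<sigma>_pos by (auto simp: n_def) 
  have n0: "0 < n" using n(1) \<sigma>_pos by (cases n) (auto simp: divide_le_0_iff)
  have n3: "3 \<le> real n * \<sigma>" using n(1) \<sigma>_pos by (simp add: field_simps)
  have "real n \<le> 4 / \<sigma>" using n(2) \<sigma>_pos \<sigma>_small by (simp add: field_simps)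
  then have nc: "real n ^ 3 \<le> (4 / \<sigma>) ^ 3" by (intro power_mono) auto
  have b0: "0 \<le> barrier" using barrier_ge_1 by simp
  have "\<sigma>\<^sup>2 * (\<sigma> / 200) * ip f f
      \<le> (\<sigma>\<^sup>2 + 5 * (3 * (12 * \<sigma> * barrier * real n ^ 3) + 2 * (54 * \<sigma>\<^sup>2 * barrier) / \<sigma>\<^sup>2)) * (2 * energy f)"
  proof (rule poincare_from_paths[where V = "\<lambda>x. exp \<bar>x\<bar>" and ?A1.0 = "{-3..0}" and ?A2.0 = "{0..3}"
        and U = "{- 1 / 5 - \<sigma>\<^sup>2..- 1 / 5}" and W = "{1 / 5..1 / 5 + \<sigma>\<^sup>2}"])
    show "(\<integral>\<^sup>+y. ennreal (flow x y * (exp \<bar>y\<bar> / exp \<bar>x\<bar>)) \<partial>lborel) + ennreal (\<sigma> / 200 * mix_density \<sigma> x)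
      \<le> (\<integral>\<^sup>+y. ennreal (flow x y) \<partial>lborel) + ennreal (5 * mix_density \<sigma> x) * indicator ({-3..0} \<union> {0..3}) x" for x
      by (rule drift_condition)
    show "mix_density \<sigma> x \<le> 12 * \<sigma> * barrier * flow (x + real i * ((u - x) / real n)) (x + real (Suc i) * ((u - x) / real n))"
      if "x \<in> {-3..0}" "u \<in> {- 1 / 5 - \<sigma>\<^sup>2..- 1 / 5}" "i < n" for x u i
      by (rule small_step[OF n3, of "-1"]) (use that in auto)
    show "mix_density \<sigma> x \<le> 12 * \<sigma> * barrier * flow (x + real i * ((u - x) / real n)) (x + real (Suc i) * ((u - x) / real n))"
      if "x \<in> {0..3}" "u \<in> {1 / 5..1 / 5 + \<sigma>\<^sup>2}" "i < n" for x u i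
      by (rule small_step[OF n3, of 1]) (use that in auto)
    show "1 \<le> 54 * \<sigma>\<^sup>2 * barrier * flow u w" if "u \<in> {- 1 / 5 - \<sigma>\<^sup>2..- 1 / 5}" "w \<in> {1 / 5..1 / 5 + \<sigma>\<^sup>2}" for u w
      using that by (rule big_jump)
  qed (use \<sigma>_pos b0 n0 f in auto)
  also have "\<dots> \<le> (25000 * barrier / \<sigma>\<^sup>2 / 2) * (2 * energy f)"
  proof (rule mult_right_mono)
    have 1: "\<sigma>\<^sup>2 \<le> barrier / \<sigma>\<^sup>2"
    proof -
      have "\<sigma>\<^sup>2 * \<sigma>\<^sup>2 \<le> 1 * 1" using \<sigma>2 by (intro mult_mono) auto
      then have "\<sigma>\<^sup>2 * \<sigma>\<^sup>2 \<le> barrier" using barrier_ge_1 by linarith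
      then show ?thesis using \<sigma>2 by (simp add: field_simps)
    qed
    have "12 * \<sigma> * barrier * real n ^ 3 \<le> 12 * \<sigma> * barrier * (4 / \<sigma>) ^ 3"
      using nc \<sigma>_pos b0 by (intro mult_left_mono) auto
    also have "\<dots> = 768 * (barrier / \<sigma>\<^sup>2)" using \<sigma>_pos by (simp add: power3_eq_cube power2_eq_square)
    finally have 2: "12 * \<sigma> * barrier * real n ^ 3 \<le> 768 * (barrier / \<sigma>\<^sup>2)" .
    have "\<sigma>\<^sup>2 * barrier \<le> 1 * barrier" using b0 \<sigma>2 by (intro mult_right_mono) auto
    then have 4: "barrier \<le> barrier / \<sigma>\<^sup>2" using \<sigma>2 by (simp add: field_simps)
    have 3: "2 * (54 * \<sigma>\<^sup>2 * barrier) / \<sigma>\<^sup>2 = 108 * barrier" using \<sigma>2 by simp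
    \<comment> \<open>The three contributions are at most \<open>T\<close>,
      \<open>15 * 768 * T = 11520 * T\<close> and \<open>540 * T\<close>, in total
      \<open>12061 * T\<close>.\<close>
    have "\<sigma>\<^sup>2 + 5 * (3 * R + 108 * barrier) \<le> 12500 * T"
      if r: "R \<le> 768 * T" "barrier \<le> T" "\<sigma>\<^sup>2 \<le> T" for R T :: real
    proof -
      have "0 \<le> T" using r(2) b0 by simp
      moreover have "\<sigma>\<^sup>2 + 5 * (3 * R + 108 * barrier) = \<sigma>\<^sup>2 + 15 * R + 540 * barrier" by simp
      ultimately show ?thesis using r by simp
    qed
    from this[OF 2 4 1]
    have "\<sigma>\<^sup>2 + 5 * (3 * (12 * \<sigma> * barrier * real n ^ 3) + 2 * (54 * \<sigma>\<^sup>2 * barrier) / \<sigma>\<^sup>2) \<le> 12500 * (barrier / \<sigma>\<^sup>2)"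
      unfolding 3 .
    then show "\<sigma>\<^sup>2 + 5 * (3 * (12 * \<sigma> * barrier * real n ^ 3) + 2 * (54 * \<sigma>\<^sup>2 * barrier) / \<sigma>\<^sup>2) \<le> 25000 * barrier / \<sigma>\<^sup>2 / 2"
      by (rule order_trans) simp
    show "0 \<le> 2 * energy f" using energy_nonneg f by (simp add: mean_zeroD)
  qed
  finally have "\<sigma>\<^sup>2 * (\<sigma> / 200) * ip f f \<le> 25000 * barrier / \<sigma>\<^sup>2 * energy f" by simp
  then have "(\<sigma>\<^sup>2 / (25000 * barrier)) * (\<sigma>\<^sup>2 * (\<sigma> / 200) * ip f f) \<le> (\<sigma>\<^sup>2 / (25000 * barrier)) * (25000 * barrier / \<sigma>\<^sup>2 * energy f)"
    using b0 by (intro mult_left_mono) auto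
  moreover have "(\<sigma>\<^sup>2 / (25000 * barrier)) * (25000 * barrier / \<sigma>\<^sup>2 * energy f) = energy f"
    using \<sigma>2 barrier_ge_1 by simp
  moreover have "(\<sigma>\<^sup>2 / (25000 * barrier)) * (\<sigma>\<^sup>2 * (\<sigma> / 200) * ip f f) = gap_bound * ip f f"
    by (simp add: gap_bound_def power2_eq_square eval_nat_numeral)
  ultimately show ?thesis by simp
qed

lemma gap_bound_bounds: "0 < gap_bound" "gap_bound < 1"
proof -
  show "0 < gap_bound" using \<sigma>_pos barrier_ge_1 by (simp add: gap_bound_def)
  have "\<sigma> ^ 5 \<le> 1" using \<sigma>_pos \<sigma>_small by (intro power_le_one) auto
  moreover have "\<sigma> ^ 5 / barrier \<le> \<sigma> ^ 5 / 1" using barrier_ge_1 \<sigma>_pos by (intro divide_left_mono) auto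
  ultimately show "gap_bound < 1" by (simp add: gap_bound_def)
qed

section \<open>Upper bounds on the flow across a cut\<close>

lemma flow_crossing:
  assumes s: "0 \<le> s" "s \<le> 1 / 10" and c: "(x < - s \<and> - s \<le> y) \<or> (y < - s \<and> - s \<le> x)"
  shows "flow x y \<le> 1 / (4 * \<sigma>\<^sup>2) / barrier"
proof -
  define m where "m = max (well x) (well y)"
  have ineq: "4 / 5 \<le> (b - a)\<^sup>2 + max (well a) (well b)" if ab: "a < - s" "- s \<le> b" for a b
  proof (cases "0 \<le> b")
    case True
    \<comment> \<open>The endpoint nearer to the origin has \<open>well\<close> equal to
      \<open>(r - 1)\<^sup>2\<close>, and the jump is at least \<open>2 * r\<close> long, so the
      two-variable problem reduces to
      \<open>4 * r\<^sup>2 + (1 - r)\<^sup>2 \<ge> 4/5\<close>.\<close>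
    define r where "r = min (- a) b"
    have r: "0 \<le> r" "2 * r \<le> b - a" using ab s True by (auto simp: r_def)
    have "well a = (r - 1)\<^sup>2 \<or> well b = (r - 1)\<^sup>2"
      using ab s True by (auto simp: well_def r_def min_def)
    then have 1: "(r - 1)\<^sup>2 \<le> max (well a) (well b)" by auto
    have 2: "(2 * r)\<^sup>2 \<le> (b - a)\<^sup>2" using r by (intro power_mono) auto
    have "0 \<le> 5 * (r - 1 / 5)\<^sup>2" by simp
    also have "5 * (r - 1 / 5)\<^sup>2 = (2 * r)\<^sup>2 + (r - 1)\<^sup>2 - 4 / 5" by (simp add: power2_eq_square algebra_simps)
    finally show ?thesis using 1 2 by linarith
  next
    case False
    \<comment> \<open>With the cut moved left of the origin, \<open>b\<close> may lie in the valley
      between cut and origin. There the density alone is small enough, as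
      \<open>(9/10)\<^sup>2 \<ge> 4/5\<close>; this is why \<open>s \<le> 1/10\<close> costs
      nothing.\<close>
    then have "(9 / 10)\<^sup>2 \<le> (1 - \<bar>b\<bar>)\<^sup>2" using ab s by (intro power_mono) auto
    then have "4 / 5 \<le> well b" by (simp add: well_def power2_commute[of 1] power2_eq_square[of "9 / 10"])
    then show ?thesis using zero_le_power2[of "b - a"] by linarith
  qed
  have main: "4 / 5 \<le> (y - x)\<^sup>2 + m"
    using c ineq[of x y] ineq[of y x] by (auto simp: m_def max.commute power2_commute)
  have "min (mix_density \<sigma> x) (mix_density \<sigma> y) \<le> peak * exp (- m / (2 * \<sigma>\<^sup>2))"
    using mix_density_le[of x] mix_density_le[of y] by (auto simp: m_def max_def min_le_iff_disj)
  then have "flow x y \<le> (peak * exp (- (y - x)\<^sup>2 / (2 * \<sigma>\<^sup>2))) * (peak * exp (- m / (2 * \<sigma>\<^sup>2)))"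
    unfolding flow_def normal_density_eq diff_zero using peak_pos by (intro mult_left_mono) auto
  also have "\<dots> = (peak * peak) * exp (- ((y - x)\<^sup>2 + m) / (2 * \<sigma>\<^sup>2))"
  proof -
    have "- ((y - x)\<^sup>2 + m) / (2 * \<sigma>\<^sup>2) = - (y - x)\<^sup>2 / (2 * \<sigma>\<^sup>2) + - m / (2 * \<sigma>\<^sup>2)"
      by (simp add: add_divide_distrib diff_divide_distrib)
    then show ?thesis by (simp only: exp_add mult_ac)
  qed
  also have "\<dots> \<le> (1 / (2 * \<sigma>) * (1 / (2 * \<sigma>))) * (1 / barrier)"
  proof (rule mult_mono)
    show "peak * peak \<le> 1 / (2 * \<sigma>) * (1 / (2 * \<sigma>))" using peak_bounds(2) peak_pos \<sigma>_pos by (intro mult_mono) auto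
    have "- ((y - x)\<^sup>2 + m) / (2 * \<sigma>\<^sup>2) \<le> - (4 / 5) / (2 * \<sigma>\<^sup>2)" using main by (intro divide_right_mono) auto
    then have "exp (- ((y - x)\<^sup>2 + m) / (2 * \<sigma>\<^sup>2)) \<le> exp (- (2 / (5 * \<sigma>\<^sup>2)))" by simp
    then show "exp (- ((y - x)\<^sup>2 + m) / (2 * \<sigma>\<^sup>2)) \<le> 1 / barrier" by (simp add: barrier_def exp_minus inverse_eq_divide)
  qed (use \<sigma>_pos in auto)
  also have "\<dots> = 1 / (4 * \<sigma>\<^sup>2) / barrier" by (simp add: power2_eq_square)
  finally show ?thesis .
qed

text \<open>Such points are at distance at least \<open>2\<close> from both modes. Half of the
  Gaussian exponent is then at least \<open>1 / \<sigma>\<^sup>2\<close> and pays for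
  \<open>barrier\<close>; the other half leaves an integrable normal density of variance
  \<open>2 * \<sigma>\<^sup>2\<close>.\<close>

lemma tail_mass: "(\<integral>\<^sup>+x. indicator {x. 3 < \<bar>x\<bar>} x * ennreal (mix_density \<sigma> x) \<partial>lborel) \<le> ennreal (2 / barrier)"
proof -
  let ?s = "sqrt 2 * \<sigma>"
  have nd: "normal_density m \<sigma> x \<le> 2 / barrier * normal_density m ?s x" if x: "3 < \<bar>x\<bar>" and m: "\<bar>m\<bar> = 1" for x m
  proof -
    define t where "t = (x - m)\<^sup>2 / (4 * \<sigma>\<^sup>2)"
    have "2 \<le> \<bar>x - m\<bar>" using x m by linarith
    then have "2\<^sup>2 \<le> \<bar>x - m\<bar>\<^sup>2" by (intro power_mono) auto
    then have "4 / (4 * \<sigma>\<^sup>2) \<le> t" unfolding t_def by (intro divide_right_mono) auto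
    moreover have "2 / (5 * \<sigma>\<^sup>2) \<le> 4 / (4 * \<sigma>\<^sup>2)" using \<sigma>2 by (simp add: divide_simps)
    ultimately have t: "2 / (5 * \<sigma>\<^sup>2) \<le> t" by linarith
    have n2: "normal_density m ?s x = peak / sqrt 2 * exp (- t)"
      by (simp add: normal_density_def peak_def t_def power_mult_distrib real_sqrt_mult)
    have "- (x - m)\<^sup>2 / (2 * \<sigma>\<^sup>2) = - t + - t" unfolding t_def by (simp add: field_simps)
    then have "normal_density m \<sigma> x = peak * (exp (- t) * exp (- t))" by (simp only: normal_density_eq exp_add)
    also have "\<dots> = sqrt 2 * exp (- t) * normal_density m ?s x" unfolding n2 by simp
    also have "\<dots> \<le> 2 * (1 / barrier) * normal_density m ?s x"
    proof (intro mult_right_mono mult_mono)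
      show "sqrt 2 \<le> (2::real)" by (rule real_le_lsqrt) auto
      have "exp (- t) \<le> exp (- (2 / (5 * \<sigma>\<^sup>2)))" using t by simp
      then show "exp (- t) \<le> 1 / barrier" by (simp add: barrier_def exp_minus inverse_eq_divide)
    qed auto
    finally show ?thesis by simp
  qed
  have "(\<integral>\<^sup>+x. indicator {x. 3 < \<bar>x\<bar>} x * ennreal (mix_density \<sigma> x) \<partial>lborel)
      \<le> (\<integral>\<^sup>+x. ennreal (1 / barrier) * (ennreal (normal_density 0 ?s (x - 1)) + ennreal (normal_density 0 ?s (x - (-1)))) \<partial>lborel)"
  proof (rule nn_integral_mono)
    fix x
    have n: "normal_density 0 ?s (x - m) = normal_density m ?s x" for m by (simp add: normal_density_def)
    show "indicator {x. 3 < \<bar>x\<bar>} x * ennreal (mix_density \<sigma> x)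
        \<le> ennreal (1 / barrier) * (ennreal (normal_density 0 ?s (x - 1)) + ennreal (normal_density 0 ?s (x - (-1))))"
    proof (cases "3 < \<bar>x\<bar>")
      case True
      have "mix_density \<sigma> x \<le> 1 / barrier * (normal_density 1 ?s x + normal_density (-1) ?s x)"
        using nd[OF True, of 1] nd[OF True, of "-1"] by (simp add: mix_density_def add_divide_distrib algebra_simps)
      then have "ennreal (mix_density \<sigma> x) \<le> ennreal (1 / barrier * (normal_density 1 ?s x + normal_density (-1) ?s x))"
        by (rule ennreal_leI)
      also have "\<dots> = ennreal (1 / barrier) * (ennreal (normal_density 1 ?s x) + ennreal (normal_density (-1) ?s x))"
        using barrier_ge_1 by (subst ennreal_mult') auto
      finally show ?thesis unfolding n using True by simp
    qed simp
  qed
  also have "\<dots> = ennreal (1 / barrier) * (1 + 1)"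
    using nn_normal[of ?s 1] nn_normal[of ?s "-1"] \<sigma>_pos
    by (subst nn_integral_cmult, measurable) (subst nn_integral_add, auto)
  also have "\<dots> = ennreal (1 / barrier) * ennreal 2" by simp
  also have "\<dots> = ennreal (1 / barrier * 2)" using barrier_ge_1 by (intro ennreal_mult[symmetric]) auto
  finally show ?thesis by simp
qed

lemma nn_integral2_add:
  fixes F H :: "real \<Rightarrow> real \<Rightarrow> ennreal"
  assumes m: "case_prod F \<in> borel_measurable (lborel \<Otimes>\<^sub>M lborel)" "case_prod H \<in> borel_measurable (lborel \<Otimes>\<^sub>M lborel)"
  shows "(\<integral>\<^sup>+x. \<integral>\<^sup>+y. F x y + H x y \<partial>lborel \<partial>lborel) = (\<integral>\<^sup>+x. \<integral>\<^sup>+y. F x y \<partial>lborel \<partial>lborel) + (\<integral>\<^sup>+x. \<integral>\<^sup>+y. H x y \<partial>lborel \<partial>lborel)"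
proof -
  have "(\<integral>\<^sup>+x. \<integral>\<^sup>+y. F x y + H x y \<partial>lborel \<partial>lborel) = (\<integral>\<^sup>+z. case_prod F z + case_prod H z \<partial>(lborel \<Otimes>\<^sub>M lborel))"
    using m by (subst lborel.nn_integral_fst[symmetric]) auto
  also have "\<dots> = (\<integral>\<^sup>+z. case_prod F z \<partial>(lborel \<Otimes>\<^sub>M lborel)) + (\<integral>\<^sup>+z. case_prod H z \<partial>(lborel \<Otimes>\<^sub>M lborel))"
    by (rule nn_integral_add[OF m])
  finally show ?thesis
    using lborel.nn_integral_fst[OF m(1)] lborel.nn_integral_fst[OF m(2)] by simp
qed

text \<open>The pointwise bound on crossing pairs is not integrable over the plane, so it is used
  only on the square of area \<open>36\<close> and the rest is charged to \<open>tail_mass\<close>.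
  This bounds the Dirichlet form by
  \<open>9 / \<sigma>\<^sup>2 + 4 \<le> 14 / \<sigma>\<^sup>2\<close> over \<open>barrier\<close>;
  the energy is half of that.\<close>

lemma flux_le:
  assumes s: "0 \<le> s" "s \<le> 1 / 10"
  shows "energy (ind {..<- s}) \<le> 7 / \<sigma>\<^sup>2 / barrier"
proof -
  let ?f = "ind {..<- s}"
  let ?c = "1 / (4 * \<sigma>\<^sup>2) / barrier"
  let ?T = "{x::real. 3 < \<bar>x\<bar>}"
  have f2: "?f \<in> L2_fun target" by (rule ind_L2) simp
  have c0: "0 \<le> ?c" using barrier_ge_1 by simp
  have "dirichlet ?f \<le> (\<integral>\<^sup>+x. \<integral>\<^sup>+y. (ennreal ?c * indicator {-3..3::real} x * indicator {-3..3::real} y + indicator ?T x * ennreal (flow x y)) + indicator ?T y * ennreal (flow y x) \<partial>lborel \<partial>lborel)"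
    unfolding dirichlet_def
  proof (intro nn_integral_mono)
    fix x y
    show "ennreal (flow x y * (cmod (?f x - ?f y))\<^sup>2)
      \<le> (ennreal ?c * indicator {-3..3::real} x * indicator {-3..3::real} y + indicator ?T x * ennreal (flow x y)) + indicator ?T y * ennreal (flow y x)"
    proof (cases "(x < - s \<and> - s \<le> y) \<or> (y < - s \<and> - s \<le> x)")
      case True
      then have e: "(cmod (?f x - ?f y))\<^sup>2 = 1" by (auto simp: ind_def)
      show ?thesis
      proof (cases "3 < \<bar>x\<bar> \<or> 3 < \<bar>y\<bar>")
        case True
        then show ?thesis unfolding e by (auto simp: flow_sym split: split_indicator)
      next
        case False
        then have "x \<in> {-3..3}" "y \<in> {-3..3}" "\<not> 3 < \<bar>x\<bar>" "\<not> 3 < \<bar>y\<bar>" by auto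
        then show ?thesis unfolding e using ennreal_leI[OF flow_crossing[OF s True]] by simp
      qed
    next
      case False
      then have "?f x = ?f y" by (auto simp: ind_def split: split_indicator)
      then show ?thesis by simp
    qed
  qed
  also have "\<dots> = (\<integral>\<^sup>+x. \<integral>\<^sup>+y. ennreal ?c * indicator {-3..3::real} x * indicator {-3..3::real} y \<partial>lborel \<partial>lborel)
      + (\<integral>\<^sup>+x. \<integral>\<^sup>+y. indicator ?T x * ennreal (flow x y) \<partial>lborel \<partial>lborel) + (\<integral>\<^sup>+x. \<integral>\<^sup>+y. indicator ?T y * ennreal (flow y x) \<partial>lborel \<partial>lborel)"
    by (subst nn_integral2_add, (simp add: case_prod_beta', measurable)+)+
  also have "(\<integral>\<^sup>+x. \<integral>\<^sup>+y. indicator ?T y * ennreal (flow y x) \<partial>lborel \<partial>lborel) = (\<integral>\<^sup>+x. \<integral>\<^sup>+y. indicator ?T x * ennreal (flow x y) \<partial>lborel \<partial>lborel)"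
  proof -
    have m: "(\<lambda>(y, x). indicator ?T y * ennreal (flow y x)) \<in> borel_measurable (lborel \<Otimes>\<^sub>M lborel)" by measurable
    show ?thesis by (rule lborel_pair.Fubini'[OF m])
  qed
  also have "(\<integral>\<^sup>+x. \<integral>\<^sup>+y. ennreal ?c * indicator {-3..3::real} x * indicator {-3..3::real} y \<partial>lborel \<partial>lborel) = ennreal (36 * ?c)"
  proof -
    have "(\<integral>\<^sup>+x. \<integral>\<^sup>+y. ennreal ?c * indicator {-3..3::real} x * indicator {-3..3::real} y \<partial>lborel \<partial>lborel)
        = (\<integral>\<^sup>+x. ennreal ?c * 6 * indicator {-3..3::real} x \<partial>lborel)"
      by (intro nn_integral_cong, subst nn_integral_cmult_indicator) (auto simp: mult_ac)
    also have "\<dots> = ennreal ?c * 6 * 6" by (subst nn_integral_cmult_indicator) auto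
    also have "\<dots> = ennreal ?c * ennreal 36" by (simp add: mult.assoc)
    also have "\<dots> = ennreal (36 * ?c)" using c0 by (subst ennreal_mult[symmetric]) (auto simp: mult.commute)
    finally show ?thesis .
  qed
  also have "(\<integral>\<^sup>+x. \<integral>\<^sup>+y. indicator ?T x * ennreal (flow x y) \<partial>lborel \<partial>lborel) \<le> ennreal (2 / barrier)"
  proof -
    have "(\<integral>\<^sup>+x. \<integral>\<^sup>+y. indicator ?T x * ennreal (flow x y) \<partial>lborel \<partial>lborel) = (\<integral>\<^sup>+x. indicator ?T x * (\<integral>\<^sup>+y. ennreal (flow x y) \<partial>lborel) \<partial>lborel)"
      by (intro nn_integral_cong nn_integral_cmult) measurable
    also have "\<dots> \<le> (\<integral>\<^sup>+x. indicator ?T x * ennreal (mix_density \<sigma> x) \<partial>lborel)"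
      by (intro nn_integral_mono mult_left_mono flow_int_le) auto
    finally show ?thesis using tail_mass by (rule order_trans)
  qed
  finally have "dirichlet ?f \<le> ennreal (36 * ?c) + ennreal (2 / barrier) + ennreal (2 / barrier)"
    by (auto simp: add_mono)
  also have "\<dots> = ennreal (36 * ?c + 2 / barrier + 2 / barrier)"
  proof -
    have "0 \<le> 36 * ?c" "0 \<le> 2 / barrier" "0 \<le> 36 * ?c + 2 / barrier" using c0 barrier_ge_1 by auto
    then show ?thesis by (simp only: ennreal_plus)
  qed
  finally have "ennreal (2 * energy ?f) \<le> ennreal (36 * ?c + 2 / barrier + 2 / barrier)"
    unfolding dirichlet_energy[OF f2] .
  then have "2 * energy ?f \<le> 36 * ?c + 2 / barrier + 2 / barrier"
    using c0 barrier_ge_1 by (subst (asm) ennreal_le_iff) auto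
  also have "\<dots> = (9 / \<sigma>\<^sup>2 + 4) / barrier" by (simp add: add_divide_distrib)
  also have "\<dots> \<le> (14 / \<sigma>\<^sup>2) / barrier"
  proof -
    have "4 * 1 \<le> 5 / \<sigma>\<^sup>2" using \<sigma>2 by (simp add: field_simps)
    then show ?thesis using barrier_ge_1 by (intro divide_right_mono) (auto simp: field_simps)
  qed
  finally show ?thesis by simp
qed

section \<open>Masses of the test sets and data at the starting point\<close>

lemma mix_density_even: "mix_density \<sigma> (- x) = mix_density \<sigma> x"
proof -
  have "(- x - 1)\<^sup>2 = (x - -1)\<^sup>2" "(- x - -1)\<^sup>2 = (x - 1)\<^sup>2" by (simp_all add: power2_eq_square algebra_simps)
  then show ?thesis unfolding mix_density_def normal_density_eq by simp
qed

lemma emeasure_target: "A \<in> sets borel \<Longrightarrow> emeasure target A = (\<integral>\<^sup>+x. ennreal (mix_density \<sigma> x) * indicator A x \<partial>lborel)"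
  by (simp add: target_def emeasure_density)

lemma measure_negative: "measure target {..<0} = 1 / 2"
proof -
  have "emeasure target {..<0} = (\<integral>\<^sup>+x. ennreal (mix_density \<sigma> x) * indicator {..<0} x \<partial>lborel)"
    by (rule emeasure_target) simp
  also have "\<dots> = ennreal \<bar>-1\<bar> * (\<integral>\<^sup>+x. ennreal (mix_density \<sigma> (0 + -1 * x)) * indicator {..<0} (0 + -1 * x) \<partial>lborel)"
    by (rule nn_integral_real_affine) auto
  also have "\<dots> = (\<integral>\<^sup>+x. ennreal (mix_density \<sigma> x) * indicator {0<..} x \<partial>lborel)"
    by (auto simp: mix_density_even intro!: nn_integral_cong split: split_indicator)
  also have "\<dots> = emeasure target {0<..}" by (rule emeasure_target[symmetric]) simp
  finally have sym: "measure target {..<0} = measure target {0<..}" by (simp add: measure_def)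
  have "emeasure target {0} = 0"
    unfolding emeasure_target[OF borel_singleton[OF sets.empty_sets]]
    by (simp add: nn_integral_indicator_singleton)
  then have z: "measure target {0} = 0" by (simp add: measure_def)
  have "{..<0} \<union> {0::real} \<union> {0<..} = UNIV" by auto
  then have "1 = measure target ({..<0} \<union> {0::real} \<union> {0<..})" using prob_UNIV by simp
  also have "\<dots> = measure target ({..<0} \<union> {0::real}) + measure target {0<..}"
    by (rule finite_measure_Union) auto
  also have "measure target ({..<0} \<union> {0::real}) = measure target {..<0} + measure target {0}"
    by (rule finite_measure_Union) auto
  finally show ?thesis using sym z by simp
qed

text \<open>Removing a short interval from the half-line makes its mass admissible for the
  conductance. The strict inequality comes from positivity of the density there, and the density
  bound \<open>5/2\<close> over length \<open>1/10\<close> shows that at most \<open>1/4\<close> is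
  lost.\<close>

lemma measure_left_part:
  "1 / 4 \<le> measure target {..<- (1 / 10)}" "measure target {..<- (1 / 10)} < 1 / 2"
proof -
  let ?A = "{- (1 / 10)..<0::real}"
  let ?lo = "peak / 2 * exp (- 1 / (2 * \<sigma>\<^sup>2))"
  let ?hi = "5 / 2 :: real"
  have b: "?lo \<le> mix_density \<sigma> x" "mix_density \<sigma> x \<le> ?hi" if x: "x \<in> ?A" for x
  proof -
    have "well x \<le> 1\<^sup>2" unfolding well_def using x by (intro power2_le_iff_abs_le[THEN iffD2]) auto
    then have "- 1 / (2 * \<sigma>\<^sup>2) \<le> - well x / (2 * \<sigma>\<^sup>2)" by (intro divide_right_mono) auto
    then have "?lo \<le> peak / 2 * exp (- well x / (2 * \<sigma>\<^sup>2))" using peak_pos by (intro mult_left_mono) auto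
    then show "?lo \<le> mix_density \<sigma> x" using mix_density_ge[of x] by linarith
    have "(9 / 10)\<^sup>2 \<le> (1 - \<bar>x\<bar>)\<^sup>2" using x by (intro power_mono) auto
    then have "4 / 5 \<le> well x" by (simp add: well_def power2_commute[of 1] power2_eq_square[of "9 / 10"])
    then have "- well x / (2 * \<sigma>\<^sup>2) \<le> - (4 / 5) / (2 * \<sigma>\<^sup>2)" by (intro divide_right_mono) auto
    then have "exp (- well x / (2 * \<sigma>\<^sup>2)) \<le> exp (- (2 / (5 * \<sigma>\<^sup>2)))" by simp
    also have "\<dots> \<le> 5 * \<sigma>\<^sup>2 / 2"
    proof -
      \<comment> \<open>The crude \<open>exp (- t) \<le> 1 / t\<close> is enough, because
        \<open>peak\<close> grows only like \<open>1 / \<sigma>\<close>.\<close>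
      have "2 / (5 * \<sigma>\<^sup>2) \<le> exp (2 / (5 * \<sigma>\<^sup>2))" using exp_ge_add_one_self[of "2 / (5 * \<sigma>\<^sup>2)"] by linarith
      then show ?thesis using \<sigma>2 by (simp add: exp_minus field_simps)
    qed
    finally have "peak * exp (- well x / (2 * \<sigma>\<^sup>2)) \<le> 1 / (2 * \<sigma>) * (5 * \<sigma>\<^sup>2 / 2)"
      using peak_bounds(2) \<sigma>_pos by (intro mult_mono) auto
    also have "\<dots> \<le> ?hi" using \<sigma>_pos \<sigma>_small by (simp add: power2_eq_square)
    finally show "mix_density \<sigma> x \<le> ?hi" using mix_density_le[of x] by linarith
  qed
  have lo0: "0 < ?lo" using peak_pos by simp
  have em: "emeasure lborel ?A = ennreal (1 / 10)" by simp
  have "emeasure target ?A = (\<integral>\<^sup>+x. ennreal (mix_density \<sigma> x) * indicator ?A x \<partial>lborel)" by (rule emeasure_target) simp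
  also have "\<dots> \<le> (\<integral>\<^sup>+x. ennreal ?hi * indicator ?A x \<partial>lborel)"
    using b(2) by (intro nn_integral_mono) (auto split: split_indicator intro!: ennreal_leI)
  also have "\<dots> = ennreal ?hi * ennreal (1 / 10)" by (simp only: nn_integral_cmult_indicator em sets_lborel atLeastLessThan_borel)
  also have "\<dots> = ennreal (1 / 4)" by (subst ennreal_mult[symmetric]) auto
  finally have up: "measure target ?A \<le> 1 / 4" by (simp add: emeasure_eq_measure)
  have "ennreal (?lo * (1 / 10)) = ennreal ?lo * ennreal (1 / 10)" using lo0 by (intro ennreal_mult) auto
  also have "\<dots> = (\<integral>\<^sup>+x. ennreal ?lo * indicator ?A x \<partial>lborel)" by (simp only: nn_integral_cmult_indicator em sets_lborel atLeastLessThan_borel)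
  also have "\<dots> \<le> (\<integral>\<^sup>+x. ennreal (mix_density \<sigma> x) * indicator ?A x \<partial>lborel)"
    using b(1) by (intro nn_integral_mono) (auto split: split_indicator intro!: ennreal_leI)
  also have "\<dots> = emeasure target ?A" by (rule emeasure_target[symmetric]) simp
  finally have "?lo * (1 / 10) \<le> measure target ?A" by (simp add: emeasure_eq_measure)
  then have low: "0 < measure target ?A" using lo0 by linarith
  have "{..<- (1 / 10)} \<union> ?A = {..<0}" by auto
  then have "1 / 2 = measure target ({..<- (1 / 10)} \<union> ?A)" using measure_negative by simp
  also have "\<dots> = measure target {..<- (1 / 10)} + measure target ?A" by (rule finite_measure_Union) auto
  finally have sum: "1 / 2 = measure target {..<- (1 / 10)} + measure target ?A" .
  show "1 / 4 \<le> measure target {..<- (1 / 10)}" using sum up by linarith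
  show "measure target {..<- (1 / 10)} < 1 / 2" using sum low by linarith
qed

text \<open>Only proposals of length at most \<open>\<sigma>\<^sup>2\<close> are counted. Over that
  distance \<open>well\<close> changes by \<open>\<sigma>\<^sup>2\<close> times a factor depending
  on \<open>x\<close>, so the acceptance probability is bounded below uniformly in
  \<open>\<sigma>\<close>. The result is linear in \<open>\<sigma>\<close>, far above
  \<open>gap_bound\<close>.\<close>

lemma move_probability: "\<sigma> * exp (- \<bar>x\<bar> - 2) / 12 \<le> p x"
proof -
  let ?I = "{x..x + \<sigma>\<^sup>2}"
  define c where "c = 1 / (6 * \<sigma>) * (exp (- \<bar>x\<bar> - 2) / 2)"
  have c: "0 \<le> c" using \<sigma>_pos by (simp add: c_def)
  have pt: "c \<le> mix_density \<sigma> y * rwm_density x y" if y: "y \<in> ?I" for y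
  proof -
    have "(y - x)\<^sup>2 \<le> \<sigma>\<^sup>2"
    proof (rule power2_le_iff_abs_le[THEN iffD2])
      have "\<sigma>\<^sup>2 \<le> \<sigma>" using mult_left_mono[of \<sigma> 1 \<sigma>] \<sigma>_pos \<sigma>_small by (simp add: power2_eq_square)
      then show "\<bar>y - x\<bar> \<le> \<sigma>" using y by auto
    qed (use \<sigma>_pos in simp)
    then have "(y - x)\<^sup>2 / (2 * \<sigma>\<^sup>2) \<le> \<sigma>\<^sup>2 / (2 * \<sigma>\<^sup>2)" by (intro divide_right_mono) auto
    then have "exp (- 1 / 2) \<le> exp (- (y - x)\<^sup>2 / (2 * \<sigma>\<^sup>2))" using \<sigma>2 by simp
    moreover have "1 / 2 \<le> exp (- 1 / 2 :: real)" using exp_ge_add_one_self[of "- 1 / 2 :: real"] by simp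
    ultimately have "1 / 2 \<le> exp (- (y - x)\<^sup>2 / (2 * \<sigma>\<^sup>2))" by linarith
    then have "1 / (3 * \<sigma>) * (1 / 2) \<le> normal_density 0 \<sigma> (y - x)"
      unfolding normal_density_eq using peak_bounds(1) peak_pos by (simp only: diff_zero) (intro mult_mono, auto)
    then have q: "1 / (6 * \<sigma>) \<le> normal_density 0 \<sigma> (y - x)" by simp
    have "well y - well x = (\<bar>y\<bar> - \<bar>x\<bar>) * (\<bar>y\<bar> + \<bar>x\<bar> - 2)" by (simp add: well_def power2_eq_square algebra_simps)
    also have "\<dots> \<le> \<bar>\<bar>y\<bar> - \<bar>x\<bar>\<bar> * \<bar>\<bar>y\<bar> + \<bar>x\<bar> - 2\<bar>" by (metis abs_ge_self abs_mult)
    also have "\<dots> \<le> \<sigma>\<^sup>2 * (2 * \<bar>x\<bar> + 4)" using y \<sigma>2 by (intro mult_mono) auto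
    finally have "(- (\<sigma>\<^sup>2 * (2 * \<bar>x\<bar> + 4))) / (2 * \<sigma>\<^sup>2) \<le> (well x - well y) / (2 * \<sigma>\<^sup>2)"
      by (intro divide_right_mono) auto
    moreover have "(- (\<sigma>\<^sup>2 * (2 * \<bar>x\<bar> + 4))) / (2 * \<sigma>\<^sup>2) = - \<bar>x\<bar> - 2" using \<sigma>2 by (simp add: field_simps)
    ultimately have "exp (- \<bar>x\<bar> - 2) / 2 \<le> exp ((well x - well y) / (2 * \<sigma>\<^sup>2)) / 2" by simp
    then have "exp (- \<bar>x\<bar> - 2) / 2 \<le> mix_density \<sigma> y / mix_density \<sigma> x" using ratio_ge[of x y] by linarith
    moreover have "exp (- \<bar>x\<bar> - 2) / 2 \<le> 1"
    proof -
      have "exp (- \<bar>x\<bar> - 2) \<le> 1" by simp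
      then show ?thesis by linarith
    qed
    ultimately have "exp (- \<bar>x\<bar> - 2) / 2 \<le> min 1 (mix_density \<sigma> y / mix_density \<sigma> x)" by simp
    then show ?thesis unfolding \<rho>_rwm_density c_def using q by (intro mult_mono) auto
  qed
  have "ennreal (c * \<sigma>\<^sup>2) = ennreal c * emeasure lborel ?I" using c by (simp add: ennreal_mult)
  also have "\<dots> = (\<integral>\<^sup>+y. ennreal c * indicator ?I y \<partial>lborel)" by (simp add: nn_integral_cmult_indicator)
  also have "\<dots> \<le> (\<integral>\<^sup>+y. ennreal (mix_density \<sigma> y) * ennreal (rwm_density x y) \<partial>lborel)"
  proof (rule nn_integral_mono)
    fix y
    show "ennreal c * indicator ?I y \<le> ennreal (mix_density \<sigma> y) * ennreal (rwm_density x y)"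
      using pt[of y] mix_density_pos[of y] rwm_density_nonneg
      by (auto simp: ennreal_mult'[symmetric] less_imp_le intro!: ennreal_leI split: split_indicator)
  qed
  also have "\<dots> = (\<integral>\<^sup>+y. ennreal (rwm_density x y) \<partial>target)" by (rule nn_integral_target[symmetric]) measurable
  also have "\<dots> = ennreal (p x)"
    unfolding p_def by (rule nn_integral_eq_integral[OF k_integrable]) (simp add: rwm_density_nonneg)
  finally have "c * \<sigma>\<^sup>2 \<le> p x" using p_nonneg by (subst (asm) ennreal_le_iff) auto
  moreover have "c * \<sigma>\<^sup>2 = \<sigma> * exp (- \<bar>x\<bar> - 2) / 12" using \<sigma>_pos by (simp add: c_def power2_eq_square)
  ultimately show ?thesis by simp
qed

lemma rwm_bound_le: "rwm_bound x \<le> 2 * exp (well x / (2 * \<sigma>\<^sup>2))"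
proof -
  have "rwm_bound x \<le> peak / (peak / 2 * exp (- well x / (2 * \<sigma>\<^sup>2)))"
    unfolding rwm_bound_def using mix_density_ge[of x] peak_pos by (intro frac_le) (auto simp: normal_density_eq)
  also have "\<dots> = 2 * exp (well x / (2 * \<sigma>\<^sup>2))" using peak_pos by (simp add: exp_minus field_simps)
  finally show ?thesis .
qed

end

section \<open>Small step sizes\<close>

text \<open>The constants are the weakest among the bounds for the three quantities:
  \<open>10000000\<close> comes from \<open>gap_bound / 2\<close>, and \<open>28\<close> from the
  upper bounds on the conductance and the spectral gap.\<close>

lemma log_rate_tendsto:
  assumes "\<forall>\<^sub>F \<sigma> in at_right 0. \<sigma> ^ 5 * exp (- (2 / (5 * \<sigma>\<^sup>2))) / 10000000 \<le> y \<sigma>"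
    and "\<forall>\<^sub>F \<sigma> in at_right 0. y \<sigma> \<le> 28 / \<sigma>\<^sup>2 * exp (- (2 / (5 * \<sigma>\<^sup>2)))"
  shows "((\<lambda>\<sigma>::real. \<sigma>\<^sup>2 * ln (1 / y \<sigma>)) \<longlongrightarrow> 2 / 5) (at_right 0)"
proof (rule tendsto_sandwich)
  have pos: "\<forall>\<^sub>F \<sigma> in at_right (0::real). 0 < \<sigma>" by (simp add: eventually_at_right_less)
  show "\<forall>\<^sub>F \<sigma> in at_right 0. \<sigma>\<^sup>2 * ln (1 / (28 / \<sigma>\<^sup>2 * exp (- (2 / (5 * \<sigma>\<^sup>2))))) \<le> \<sigma>\<^sup>2 * ln (1 / y \<sigma>)"
    using assms pos
  proof eventually_elim
    case (elim \<sigma>)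
    have "0 < \<sigma> ^ 5 * exp (- (2 / (5 * \<sigma>\<^sup>2))) / 10000000" using elim by simp
    then have y: "0 < y \<sigma>" using elim by linarith
    have "1 / (28 / \<sigma>\<^sup>2 * exp (- (2 / (5 * \<sigma>\<^sup>2)))) \<le> 1 / y \<sigma>" using elim y by (intro divide_left_mono) auto
    then show ?case using elim y by (intro mult_left_mono ln_mono) auto
  qed
  show "\<forall>\<^sub>F \<sigma> in at_right 0. \<sigma>\<^sup>2 * ln (1 / y \<sigma>) \<le> \<sigma>\<^sup>2 * ln (1 / (\<sigma> ^ 5 * exp (- (2 / (5 * \<sigma>\<^sup>2))) / 10000000))"
    using assms pos
  proof eventually_elim
    case (elim \<sigma>)
    have l: "0 < \<sigma> ^ 5 * exp (- (2 / (5 * \<sigma>\<^sup>2))) / 10000000" using elim by simp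
    then have y: "0 < y \<sigma>" using elim by linarith
    have "1 / y \<sigma> \<le> 1 / (\<sigma> ^ 5 * exp (- (2 / (5 * \<sigma>\<^sup>2))) / 10000000)"
      by (rule divide_left_mono[OF elim(1) _ mult_pos_pos[OF y l]]) simp
    then show ?case using elim y by (intro mult_left_mono ln_mono) auto
  qed
  show "((\<lambda>\<sigma>::real. \<sigma>\<^sup>2 * ln (1 / (28 / \<sigma>\<^sup>2 * exp (- (2 / (5 * \<sigma>\<^sup>2)))))) \<longlongrightarrow> 2 / 5) (at_right 0)"
    by real_asymp
  show "((\<lambda>\<sigma>::real. \<sigma>\<^sup>2 * ln (1 / (\<sigma> ^ 5 * exp (- (2 / (5 * \<sigma>\<^sup>2))) / 10000000))) \<longlongrightarrow> 2 / 5) (at_right 0)"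
    by real_asymp
qed

lemma log_ratio_tendsto_1:
  assumes "((\<lambda>\<sigma>::real. \<sigma>\<^sup>2 * f \<sigma>) \<longlongrightarrow> 2 / 5) (at_right 0)" "((\<lambda>\<sigma>::real. \<sigma>\<^sup>2 * g \<sigma>) \<longlongrightarrow> 2 / 5) (at_right 0)"
  shows "((\<lambda>\<sigma>. f \<sigma> / g \<sigma>) \<longlongrightarrow> 1) (at_right 0)"
proof -
  have "((\<lambda>\<sigma>. (\<sigma>\<^sup>2 * f \<sigma>) / (\<sigma>\<^sup>2 * g \<sigma>)) \<longlongrightarrow> (2 / 5) / (2 / 5)) (at_right 0)"
    by (rule tendsto_divide[OF assms]) simp
  moreover have "\<forall>\<^sub>F \<sigma> in at_right (0::real). (\<sigma>\<^sup>2 * f \<sigma>) / (\<sigma>\<^sup>2 * g \<sigma>) = f \<sigma> / g \<sigma>"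
    using eventually_at_right_less[of "0::real"] by eventually_elim simp
  ultimately have "((\<lambda>\<sigma>. f \<sigma> / g \<sigma>) \<longlongrightarrow> (2 / 5) / (2 / 5)) (at_right 0)" by (rule Lim_transform_eventually)
  then show ?thesis by simp
qed

text \<open>The first factor decays like
  \<open>exp (- c * \<sigma> ^ 5 * exp (\<delta> / \<sigma>\<^sup>2))\<close>, doubly exponentially.
  The number of steps and the initial density, with \<open>A\<close> the value of
  \<open>well\<close> at the start, contribute only single exponentials in
  \<open>1 / \<sigma>\<^sup>2\<close>.\<close>

lemma survival_bound_tendsto_0:
  fixes \<delta> A :: real
  assumes "0 < \<delta>"
  shows "((\<lambda>\<sigma>::real. exp (- (\<sigma> ^ 5 * exp (- (2 / (5 * \<sigma>\<^sup>2))) / 10000000 * (exp ((2 / 5 + \<delta>) / \<sigma>\<^sup>2) - 1)))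
      * (1 + 2 * exp ((2 / 5 + \<delta>) / \<sigma>\<^sup>2) * (2 * exp (A / (2 * \<sigma>\<^sup>2))))) \<longlongrightarrow> 0) (at_right 0)"
proof -
  let ?X = "\<lambda>\<sigma>::real. \<sigma> ^ 5 * (exp (\<delta> / \<sigma>\<^sup>2) - exp (- (2 / (5 * \<sigma>\<^sup>2)))) / 10000000"
  have "filterlim (\<lambda>\<sigma>. C / \<sigma>\<^sup>2 - ?X \<sigma>) at_bot (at_right 0)" for C
  proof -
    have "filterlim (\<lambda>\<sigma>::real. C / \<sigma>\<^sup>2 + \<sigma> ^ 5 * exp (- (2 / (5 * \<sigma>\<^sup>2))) / 10000000 - \<sigma> ^ 5 * exp (\<delta> / \<sigma>\<^sup>2) / 10000000) at_bot (at_right 0)"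
      using assms by real_asymp
    then show ?thesis by (simp add: right_diff_distrib diff_divide_distrib algebra_simps)
  qed
  then have lim: "((\<lambda>\<sigma>. exp (C / \<sigma>\<^sup>2 - ?X \<sigma>)) \<longlongrightarrow> 0) (at_right 0)" for C
    by (rule filterlim_compose[OF exp_at_bot])
  have "((\<lambda>\<sigma>. exp (0 / \<sigma>\<^sup>2 - ?X \<sigma>) + 4 * exp ((2 / 5 + \<delta> + A / 2) / \<sigma>\<^sup>2 - ?X \<sigma>)) \<longlongrightarrow> 0 + 4 * 0) (at_right 0)"
    by (intro tendsto_add tendsto_mult tendsto_const lim)
  moreover have "exp (0 / \<sigma>\<^sup>2 - ?X \<sigma>) + 4 * exp ((2 / 5 + \<delta> + A / 2) / \<sigma>\<^sup>2 - ?X \<sigma>)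
      = exp (- (\<sigma> ^ 5 * exp (- (2 / (5 * \<sigma>\<^sup>2))) / 10000000 * (exp ((2 / 5 + \<delta>) / \<sigma>\<^sup>2) - 1)))
        * (1 + 2 * exp ((2 / 5 + \<delta>) / \<sigma>\<^sup>2) * (2 * exp (A / (2 * \<sigma>\<^sup>2))))" for \<sigma> :: real
  proof -
    have "exp (- (2 / (5 * \<sigma>\<^sup>2))) * exp ((2 / 5 + \<delta>) / \<sigma>\<^sup>2) = exp (\<delta> / \<sigma>\<^sup>2)"
      by (simp add: add_divide_distrib flip: exp_add)
    then have X: "\<sigma> ^ 5 * exp (- (2 / (5 * \<sigma>\<^sup>2))) / 10000000 * (exp ((2 / 5 + \<delta>) / \<sigma>\<^sup>2) - 1) = ?X \<sigma>"
      by (simp add: right_diff_distrib)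
    have "exp ((2 / 5 + \<delta>) / \<sigma>\<^sup>2) * exp (A / (2 * \<sigma>\<^sup>2)) = exp ((2 / 5 + \<delta> + A / 2) / \<sigma>\<^sup>2)"
      by (simp add: add_divide_distrib flip: exp_add)
    moreover have "exp (c - ?X \<sigma>) = exp (- ?X \<sigma>) * exp c" for c
      by (simp only: exp_diff exp_minus divide_inverse mult.commute)
    ultimately show ?thesis unfolding X by (simp add: distrib_left)
  qed
  ultimately show ?thesis by simp
qed

section \<open>Two-sided bounds at a fixed step size\<close>

context metropolis_mixture
begin

abbreviation left_conductance :: real where
  "left_conductance \<equiv> set_conductance (K_mix \<sigma>) (mix_measure \<sigma>) {..<0}"

lemma gap_bound_half: "gap_bound / 2 = \<sigma> ^ 5 * exp (- (2 / (5 * \<sigma>\<^sup>2))) / 10000000"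
  by (simp add: gap_bound_def barrier_def exp_minus inverse_eq_divide)

lemma divide_barrier: "c / barrier = c * exp (- (2 / (5 * \<sigma>\<^sup>2)))"
  unfolding barrier_def exp_minus by (rule divide_inverse)

lemma barrier_large: "28 / \<sigma>\<^sup>2 / barrier < 1"
proof -
  define t where "t = 2 / (5 * \<sigma>\<^sup>2)"
  have "0 \<le> t" by (simp add: t_def)
  \<comment> \<open>The quadratic Taylor term suffices, since
    \<open>28 / \<sigma>\<^sup>2 = 70 * t\<close> is linear in \<open>t\<close>.\<close>
  then have "1 + t + t\<^sup>2 / 2 \<le> barrier" unfolding barrier_def t_def[symmetric] by (rule exp_lower_Taylor_quadratic)
  then have 1: "t * t / 2 < barrier" using \<open>0 \<le> t\<close> by (simp add: power2_eq_square)
  have "280 \<le> 2 * t" unfolding t_def using \<sigma>2 by (simp add: field_simps)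
  then have "140 * t \<le> t * t" using \<open>0 \<le> t\<close> by (intro mult_right_mono) auto
  moreover have "28 / \<sigma>\<^sup>2 = 70 * t" using \<sigma>2 by (simp add: t_def field_simps)
  ultimately have "28 / \<sigma>\<^sup>2 < barrier" using 1 by linarith
  moreover have "0 < barrier" using barrier_ge_1 by linarith
  ultimately show ?thesis by (simp only: divide_less_eq_1_pos)
qed

lemma left_conductance_bounds:
  "gap_bound / 2 \<le> left_conductance" "left_conductance \<le> 14 / \<sigma>\<^sup>2 / barrier"
proof -
  show "gap_bound / 2 \<le> left_conductance"
    using set_conductance_ge[OF poincare, of "{..<0}"] gap_bound_bounds measure_negative
    by (simp add: K_mix_eq target_eq)
  have "energy (ind {..<0}) = left_conductance * (1 / 2)"
    using energy_ind[of "{..<0}"] measure_negative by (simp add: K_mix_eq target_eq)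
  then show "left_conductance \<le> 14 / \<sigma>\<^sup>2 / barrier" using flux_le[of 0] by simp
qed

text \<open>The shifted half-line has flow at most \<open>7 / \<sigma>\<^sup>2 / barrier\<close> and
  mass at least \<open>1/4\<close>, whence \<open>28\<close>.\<close>

lemma conductance_mixture_bounds:
  "gap_bound / 2 \<le> conductance (K_mix \<sigma>) (mix_measure \<sigma>)"
  "conductance (K_mix \<sigma>) (mix_measure \<sigma>) \<le> 28 / \<sigma>\<^sup>2 / barrier"
proof -
  let ?S = "{..<- (1 / 10) :: real}"
  have S: "?S \<in> sets borel" "0 < measure target ?S" "measure target ?S < 1 / 2"
    using measure_left_part by auto
  note b = conductance_bounds[OF poincare _ S, unfolded K_mix_eq target_eq]
  show "gap_bound / 2 \<le> conductance (K_mix \<sigma>) (mix_measure \<sigma>)" using b(1) gap_bound_bounds by simp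
  have "set_conductance (K_mix \<sigma>) (mix_measure \<sigma>) ?S * measure target ?S = energy (ind ?S)"
    using energy_ind[OF S(1,2)] by (simp add: K_mix_eq target_eq)
  also have "\<dots> \<le> 7 / \<sigma>\<^sup>2 / barrier" using flux_le[of "1 / 10"] by simp
  finally have 1: "set_conductance (K_mix \<sigma>) (mix_measure \<sigma>) ?S * measure target ?S \<le> 7 / \<sigma>\<^sup>2 / barrier" .
  have "0 \<le> set_conductance (K_mix \<sigma>) (mix_measure \<sigma>) ?S"
    using set_conductance_ge[OF poincare _ S(1,2)] S(3) gap_bound_bounds by (simp add: K_mix_eq target_eq)
  then have "set_conductance (K_mix \<sigma>) (mix_measure \<sigma>) ?S * (1 / 4) \<le> set_conductance (K_mix \<sigma>) (mix_measure \<sigma>) ?S * measure target ?S"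
    using measure_left_part(1) by (rule mult_left_mono[rotated])
  with 1 have "set_conductance (K_mix \<sigma>) (mix_measure \<sigma>) ?S \<le> 28 / \<sigma>\<^sup>2 / barrier" by simp
  then show "conductance (K_mix \<sigma>) (mix_measure \<sigma>) \<le> 28 / \<sigma>\<^sup>2 / barrier" using b(2) gap_bound_bounds by simp
qed

lemma spectral_gap_mixture_bounds:
  "gap_bound \<le> spectral_gap (K_mix \<sigma>) (mix_measure \<sigma>)"
  "spectral_gap (K_mix \<sigma>) (mix_measure \<sigma>) \<le> 28 / \<sigma>\<^sup>2 / barrier"
proof -
  have "left_conductance < 1 / 2" using left_conductance_bounds(2) barrier_large by simp
  note b = spectral_gap_half_bounds[OF poincare gap_bound_bounds(2) _ measure_negative, unfolded K_mix_eq target_eq, OF _ _ this]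
  show "gap_bound \<le> spectral_gap (K_mix \<sigma>) (mix_measure \<sigma>)" using b(1) by simp
  show "spectral_gap (K_mix \<sigma>) (mix_measure \<sigma>) \<le> 28 / \<sigma>\<^sup>2 / barrier"
    using b(2) left_conductance_bounds(2) by simp
qed

lemma log_left_conductance_pos: "0 < ln (1 / left_conductance)"
proof -
  have "0 < left_conductance" using left_conductance_bounds(1) gap_bound_bounds by linarith
  moreover have "left_conductance < 1" using left_conductance_bounds(2) barrier_large by simp
  ultimately show ?thesis by simp
qed

text \<open>\<open>E\<close> is a real-valued time horizon, used through
  \<open>n = \<lfloor>E\<rfloor>\<close> with \<open>E - 1 \<le> n\<close> and
  \<open>n + 1 \<le> 2 * E\<close>. The hypothesis on \<open>\<sigma>\<close> makes the probability
  of leaving \<open>x\<close> at least of order \<open>\<sigma>\<^sup>2\<close>, hence at least the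
  decay rate \<open>gap_bound / 2\<close>, so the atom at the start does not slow the decay.\<close>

lemma exit_probability_ge:
  fixes x E :: real
  assumes mc: "markov_chain_from M (K_mix \<sigma>) x X" and x: "\<sigma> \<le> exp (- \<bar>x\<bar> - 2)" and E: "1 \<le> E"
    and ln: "ln (2 * E) / ln (1 / left_conductance) < a"
  shows "1 - exp (- (gap_bound / 2 * (E - 1))) * (1 + 2 * E * (2 * exp (well x / (2 * \<sigma>\<^sup>2))))
    \<le> measure M {\<omega> \<in> space M. ln_enat (exit_time X {..<0} \<omega>) / ereal (ln (1 / left_conductance)) < ereal a}"
proof -
  define n where "n = nat \<lfloor>E\<rfloor>"
  have "real n = of_int \<lfloor>E\<rfloor>" using E by (simp add: n_def)
  then have n: "real n \<le> E" "E - 1 \<le> real n" by linarith+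
  have "ln (real (Suc n)) \<le> ln (2 * E)" using n E by (intro ln_mono) auto
  then have "ln (real (Suc n)) / ln (1 / left_conductance) \<le> ln (2 * E) / ln (1 / left_conductance)"
    using log_left_conductance_pos by (intro divide_right_mono) auto
  then have ln': "ln (real (Suc n)) / ln (1 / left_conductance) < a" using ln by linarith
  let ?\<eta> = "gap_bound / 2"
  have "?\<eta> \<le> \<sigma> * exp (- \<bar>x\<bar> - 2) / 12"
  proof -
    define q where "q = \<sigma> ^ 5 / barrier"
    have "\<sigma> ^ 3 \<le> 1" using \<sigma>_pos \<sigma>_small by (intro power_le_one) auto
    then have "\<sigma> * (\<sigma> * \<sigma> ^ 3) \<le> \<sigma> * (\<sigma> * 1)" using \<sigma>_pos by (intro mult_left_mono) auto
    also have "\<dots> \<le> \<sigma> * exp (- \<bar>x\<bar> - 2)" using x \<sigma>_pos by (intro mult_left_mono) auto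
    finally have "\<sigma> ^ 5 \<le> \<sigma> * exp (- \<bar>x\<bar> - 2)" by (simp add: eval_nat_numeral)
    moreover have "q \<le> \<sigma> ^ 5 / 1" unfolding q_def using barrier_ge_1 \<sigma>_pos by (intro divide_left_mono) auto
    moreover have "0 \<le> \<sigma> ^ 5" using \<sigma>_pos by simp
    moreover have "gap_bound / 2 = q / 10000000" by (simp add: gap_bound_def q_def)
    ultimately show ?thesis by linarith
  qed
  then have \<eta>: "0 \<le> ?\<eta>" "?\<eta> \<le> 1 / 2" "?\<eta> \<le> p x" using move_probability[of x] gap_bound_bounds by auto
  have D: "0 \<le> rwm_bound x" using rwm_density_nonneg[of x x] rwm_density_le[of x x] by linarith
  have "survival {..<0} n x \<le> (1 - ?\<eta>) ^ n * (1 + 2 * real n * rwm_bound x)"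
    using gap_bound_bounds measure_negative by (intro survival_le[OF poincare] \<eta>) auto
  also have "\<dots> \<le> exp (- (?\<eta> * (E - 1))) * (1 + 2 * E * (2 * exp (well x / (2 * \<sigma>\<^sup>2))))"
  proof (rule mult_mono)
    have "(1 - ?\<eta>) ^ n \<le> exp (- ?\<eta>) ^ n" using \<eta> exp_ge_add_one_self[of "- ?\<eta>"] by (intro power_mono) auto
    also have "\<dots> = exp (- (real n * ?\<eta>))" by (simp add: exp_of_nat_mult[symmetric])
    also have "\<dots> \<le> exp (- (?\<eta> * (E - 1)))"
      using mult_right_mono[OF n(2) \<eta>(1)] by (simp only: exp_le_cancel_iff neg_le_iff_le mult.commute)
    finally show "(1 - ?\<eta>) ^ n \<le> exp (- (?\<eta> * (E - 1)))" .
    show "1 + 2 * real n * rwm_bound x \<le> 1 + 2 * E * (2 * exp (well x / (2 * \<sigma>\<^sup>2)))"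
      using n rwm_bound_le[of x] D E by (intro add_left_mono mult_mono) auto
  qed (use D in auto)
  finally show ?thesis
    using prob_exit_ge[OF mc[folded K_mix_eq] rwm_kernel_measurable _ log_left_conductance_pos ln', of "{..<0}"] by simp
qed

end

section \<open>Limits as the step size vanishes\<close>

lemma eventually_metropolis_mixture: "\<forall>\<^sub>F \<sigma> in at_right 0. metropolis_mixture \<sigma>"
  by (rule eventually_at_rightI[of 0 "1 / 500"]) (auto simp: metropolis_mixture_def)

lemma rate_left_conductance:
  "((\<lambda>\<sigma>. \<sigma>\<^sup>2 * ln (1 / set_conductance (K_mix \<sigma>) (mix_measure \<sigma>) {..<0})) \<longlongrightarrow> 2 / 5) (at_right 0)"
proof (rule log_rate_tendsto)
  show "\<forall>\<^sub>F \<sigma> in at_right 0. \<sigma> ^ 5 * exp (- (2 / (5 * \<sigma>\<^sup>2))) / 10000000 \<le> set_conductance (K_mix \<sigma>) (mix_measure \<sigma>) {..<0}"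
    using eventually_metropolis_mixture
  proof eventually_elim
    case (elim \<sigma>)
    then interpret metropolis_mixture \<sigma> .
    show ?case using left_conductance_bounds(1) by (simp only: gap_bound_half)
  qed
  show "\<forall>\<^sub>F \<sigma> in at_right 0. set_conductance (K_mix \<sigma>) (mix_measure \<sigma>) {..<0} \<le> 28 / \<sigma>\<^sup>2 * exp (- (2 / (5 * \<sigma>\<^sup>2)))"
    using eventually_metropolis_mixture
  proof eventually_elim
    case (elim \<sigma>)
    then interpret metropolis_mixture \<sigma> .
    have "14 / \<sigma>\<^sup>2 / barrier \<le> 28 / \<sigma>\<^sup>2 / barrier"
      using barrier_ge_1 by (intro divide_right_mono) auto
    then show ?case using left_conductance_bounds(2) unfolding divide_barrier by linarith
  qed
qed

lemma rate_conductance: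
  "((\<lambda>\<sigma>. \<sigma>\<^sup>2 * ln (1 / conductance (K_mix \<sigma>) (mix_measure \<sigma>))) \<longlongrightarrow> 2 / 5) (at_right 0)"
proof (rule log_rate_tendsto)
  show "\<forall>\<^sub>F \<sigma> in at_right 0. \<sigma> ^ 5 * exp (- (2 / (5 * \<sigma>\<^sup>2))) / 10000000 \<le> conductance (K_mix \<sigma>) (mix_measure \<sigma>)"
    using eventually_metropolis_mixture
  proof eventually_elim
    case (elim \<sigma>)
    then interpret metropolis_mixture \<sigma> .
    show ?case using conductance_mixture_bounds(1) by (simp only: gap_bound_half)
  qed
  show "\<forall>\<^sub>F \<sigma> in at_right 0. conductance (K_mix \<sigma>) (mix_measure \<sigma>) \<le> 28 / \<sigma>\<^sup>2 * exp (- (2 / (5 * \<sigma>\<^sup>2)))"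
    using eventually_metropolis_mixture
  proof eventually_elim
    case (elim \<sigma>)
    then interpret metropolis_mixture \<sigma> .
    show ?case using conductance_mixture_bounds(2) unfolding divide_barrier .
  qed
qed

lemma rate_relaxation_time:
  "((\<lambda>\<sigma>. \<sigma>\<^sup>2 * ln (relaxation_time (K_mix \<sigma>) (mix_measure \<sigma>))) \<longlongrightarrow> 2 / 5) (at_right 0)"
  unfolding relaxation_time_def
proof (rule log_rate_tendsto)
  show "\<forall>\<^sub>F \<sigma> in at_right 0. \<sigma> ^ 5 * exp (- (2 / (5 * \<sigma>\<^sup>2))) / 10000000 \<le> spectral_gap (K_mix \<sigma>) (mix_measure \<sigma>)"
    using eventually_metropolis_mixture
  proof eventually_elim
    case (elim \<sigma>)
    then interpret metropolis_mixture \<sigma> .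
    show ?case using spectral_gap_mixture_bounds(1) gap_bound_bounds(1) by (simp only: gap_bound_half[symmetric])
  qed
  show "\<forall>\<^sub>F \<sigma> in at_right 0. spectral_gap (K_mix \<sigma>) (mix_measure \<sigma>) \<le> 28 / \<sigma>\<^sup>2 * exp (- (2 / (5 * \<sigma>\<^sup>2)))"
    using eventually_metropolis_mixture
  proof eventually_elim
    case (elim \<sigma>)
    then interpret metropolis_mixture \<sigma> .
    show ?case using spectral_gap_mixture_bounds(2) unfolding divide_barrier .
  qed
qed

lemma exit_time_tendsto:
  fixes M :: "real \<Rightarrow> 'w measure"
  assumes \<epsilon>: "0 < \<epsilon>" and mc: "\<And>\<sigma>. 0 < \<sigma> \<Longrightarrow> markov_chain_from (M \<sigma>) (K_mix \<sigma>) x (X \<sigma>)"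
  shows "((\<lambda>\<sigma>. measure (M \<sigma>) {\<omega> \<in> space (M \<sigma>). ln_enat (exit_time (X \<sigma>) {..<0} \<omega>) /
      ereal (ln (1 / set_conductance (K_mix \<sigma>) (mix_measure \<sigma>) {..<0})) < ereal (1 + \<epsilon>)}) \<longlongrightarrow> 1) (at_right 0)"
proof (rule tendsto_sandwich)
  \<comment> \<open>The slack \<open>\<epsilon> / 5\<close> is half of what is allowed: the
    logarithm of this horizon, relative to that of the inverse conductance, tends to
    \<open>(2/5 + \<epsilon>/5) / (2/5) = 1 + \<epsilon>/2\<close>, strictly below
    \<open>1 + \<epsilon>\<close>.\<close>
  let ?E = "\<lambda>\<sigma>::real. exp ((2 / 5 + \<epsilon> / 5) / \<sigma>\<^sup>2)"
  let ?B = "\<lambda>\<sigma>::real. exp (- (\<sigma> ^ 5 * exp (- (2 / (5 * \<sigma>\<^sup>2))) / 10000000 * (?E \<sigma> - 1)))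
      * (1 + 2 * ?E \<sigma> * (2 * exp ((\<bar>x\<bar> - 1)\<^sup>2 / (2 * \<sigma>\<^sup>2))))"
  let ?c = "\<lambda>\<sigma>. ln (1 / set_conductance (K_mix \<sigma>) (mix_measure \<sigma>) {..<0})"
  let ?P = "\<lambda>\<sigma>. measure (M \<sigma>) {\<omega> \<in> space (M \<sigma>). ln_enat (exit_time (X \<sigma>) {..<0} \<omega>) / ereal (?c \<sigma>) < ereal (1 + \<epsilon>)}"
  have "((\<lambda>\<sigma>. 1 - ?B \<sigma>) \<longlongrightarrow> 1 - 0) (at_right 0)"
    using \<epsilon> by (intro tendsto_diff tendsto_const survival_bound_tendsto_0) auto
  then show "((\<lambda>\<sigma>. 1 - ?B \<sigma>) \<longlongrightarrow> 1) (at_right 0)" by simp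
  have "((\<lambda>\<sigma>::real. \<sigma>\<^sup>2 * ln (2 * ?E \<sigma>)) \<longlongrightarrow> 2 / 5 + \<epsilon> / 5) (at_right 0)"
    using \<epsilon> by real_asymp
  then have "((\<lambda>\<sigma>. (\<sigma>\<^sup>2 * ln (2 * ?E \<sigma>)) / (\<sigma>\<^sup>2 * ?c \<sigma>)) \<longlongrightarrow> (2 / 5 + \<epsilon> / 5) / (2 / 5)) (at_right 0)"
    by (rule tendsto_divide[OF _ rate_left_conductance]) simp
  then have "\<forall>\<^sub>F \<sigma> in at_right 0. (\<sigma>\<^sup>2 * ln (2 * ?E \<sigma>)) / (\<sigma>\<^sup>2 * ?c \<sigma>) < 1 + \<epsilon>"
    using \<epsilon> by (intro order_tendstoD(2)) (auto simp: field_simps)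
  moreover have "\<forall>\<^sub>F \<sigma> in at_right 0. \<sigma> < exp (- \<bar>x\<bar> - 2)"
    by (rule eventually_at_rightI[of 0 "exp (- \<bar>x\<bar> - 2)"]) auto
  ultimately show "\<forall>\<^sub>F \<sigma> in at_right 0. 1 - ?B \<sigma> \<le> ?P \<sigma>"
    using eventually_metropolis_mixture
  proof eventually_elim
    case (elim \<sigma>)
    interpret metropolis_mixture \<sigma> by (rule elim(3))
    have "ln (2 * ?E \<sigma>) / ?c \<sigma> < 1 + \<epsilon>" using elim(1) \<sigma>_pos by simp
    moreover have "1 \<le> ?E \<sigma>" using \<epsilon> by simp
    ultimately show ?case
      using exit_probability_ge[OF mc[OF \<sigma>_pos], of "?E \<sigma>" "1 + \<epsilon>"] elim(2)
      unfolding gap_bound_half well_def by simp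
  qed
  show "\<forall>\<^sub>F \<sigma> in at_right 0. ?P \<sigma> \<le> 1"
    using eventually_at_right_less[of "0::real"]
  proof eventually_elim
    case (elim \<sigma>)
    then interpret prob_space "M \<sigma>" using mc[OF elim] by (simp add: markov_chain_from_def)
    show ?case by (rule prob_le_1)
  qed
qed simp

theorem theorem2:
  shows "(\<forall>\<epsilon>>0. \<forall>x<0. \<forall>(M :: real \<Rightarrow> 'w measure) X.
            (\<forall>\<sigma>>0. markov_chain_from (M \<sigma>) (K_mix \<sigma>) x (X \<sigma>)) \<longrightarrow>
            ((\<lambda>\<sigma>. measure (M \<sigma>) {\<omega> \<in> space (M \<sigma>).
                 ln_enat (exit_time (X \<sigma>) {..<0} \<omega>) /
                   ereal (ln (1 / set_conductance (K_mix \<sigma>) (mix_measure \<sigma>) {..<0}))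
                 < ereal (1 + \<epsilon>)}) \<longlongrightarrow> 1) (at_right 0))
       \<and> ((\<lambda>\<sigma>. ln (relaxation_time (K_mix \<sigma>) (mix_measure \<sigma>)) /
               ln (1 / set_conductance (K_mix \<sigma>) (mix_measure \<sigma>) {..<0})) \<longlongrightarrow> 1) (at_right 0)
       \<and> ((\<lambda>\<sigma>. ln (relaxation_time (K_mix \<sigma>) (mix_measure \<sigma>)) /
               ln (1 / conductance (K_mix \<sigma>) (mix_measure \<sigma>))) \<longlongrightarrow> 1) (at_right 0)"
  by (intro conjI allI impI exit_time_tendsto
      log_ratio_tendsto_1[OF rate_relaxation_time rate_left_conductance]
      log_ratio_tendsto_1[OF rate_relaxation_time rate_conductance]) blast+

end
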